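(* Let $K_P$ be the $2$-complex associated to the presentation $P=\langle a,b \mid b,\ bab^{-1}a^{-2}\rangle$. Then $K_P$ has contracting non-positive immersions; that is, for every immersion $Y\looparrowright K_P$ with $Y$ a connected and compact $2$-complex, either $\chi(Y)\le 0$ or $Y$ is contractible.
   Context: We work in the category of combinatorial $2$-complexes and combinatorial maps, i.e. cellular maps sending each open $n$-cell homeomorphically onto an open $n$-cell. The $2$-complex $K_P$ associated to a presentation $P$ has a single vertex, one oriented edge for each generator, and one $2$-cell for each relator, attached along the closed edge path spelled by that relator. So here $K_P$ has one vertex, two edges $a,b$, and two $2$-cells, attached along $b$ and along $bab^{-1}a^{-2}$. An immersion $Y\looparrowright X$ is a (combinatorial) map between $2$-complexes that is locally injective. A $2$-complex $X$ has contracting non-positive immersions if for any immersion $Y\looparrowright X$ with $Y$ connected and compact, either $\chi(Y)\leq 0$ or $Y$ is contractible. Here $\chi$ denotes the Euler characteristic. *)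

theory Defs
  imports "HOL-Analysis.Analysis"
begin

section \<open>Combinatorial 2-complexes\<close>

text \<open>A letter \<open>(e, True)\<close> is the edge \<open>e\<close> traversed along its orientation,
  \<open>(e, False)\<close> is \<open>e\<close> traversed backwards.\<close>

type_synonym 'e word = "('e \<times> bool) list"

text \<open>A combinatorial 2-complex is given by its cells, the endpoints of its oriented edges, and for
  every 2-cell the closed edge path along which it is attached.\<close>

record ('v, 'e, 'f) two_complex =
  verts :: "'v set"
  edges :: "'e set"
  faces :: "'f set"
  src :: "'e \<Rightarrow> 'v"
  tgt :: "'e \<Rightarrow> 'v"
  bdry :: "'f \<Rightarrow> 'e word"

definition letter_start :: "('v, 'e, 'f) two_complex \<Rightarrow> 'e \<times> bool \<Rightarrow> 'v" where
  "letter_start Y l = (if snd l then src Y (fst l) else tgt Y (fst l))"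

definition letter_end :: "('v, 'e, 'f) two_complex \<Rightarrow> 'e \<times> bool \<Rightarrow> 'v" where
  "letter_end Y l = (if snd l then tgt Y (fst l) else src Y (fst l))"

definition closed_edge_path :: "('v, 'e, 'f) two_complex \<Rightarrow> 'e word \<Rightarrow> bool" where
  "closed_edge_path Y w \<longleftrightarrow> w \<noteq> [] \<and> fst ` set w \<subseteq> edges Y \<and>
     (\<forall>i < length w. letter_end Y (w ! i) = letter_start Y (w ! (Suc i mod length w)))"

definition is_two_complex :: "('v, 'e, 'f) two_complex \<Rightarrow> bool" where
  "is_two_complex Y \<longleftrightarrow>
     (\<forall>e \<in> edges Y. src Y e \<in> verts Y \<and> tgt Y e \<in> verts Y) \<and>
     (\<forall>c \<in> faces Y. closed_edge_path Y (bdry Y c))"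

section \<open>The underlying topological space\<close>

text \<open>The underlying space is the quotient of
  \<open>verts Y \<squnion> edges Y \<times> [0,1] \<squnion> faces Y \<times> D\<close>, with \<open>D\<close> the closed unit disc of the complex plane,
  by the attaching maps. Every point lies in exactly one open cell, so the elements of the quotient
  are represented without equivalence classes: a vertex, a parameter in \<open>{0<..<1}\<close> on an edge, or a
  parameter in the open disc on a 2-cell.\<close>

datatype ('v, 'e, 'f) point = Vert 'v | EdgePt 'e real | FacePt 'f complex

fun open_cells :: "('v, 'e, 'f) two_complex \<Rightarrow> nat \<Rightarrow> ('v, 'e, 'f) point set set" where
  "open_cells Y 0 = (\<lambda>v. {Vert v}) ` verts Y"
| "open_cells Y (Suc 0) = (\<lambda>e. EdgePt e ` {0<..<1}) ` edges Y"
| "open_cells Y (Suc (Suc 0)) = (\<lambda>c. FacePt c ` ball 0 1) ` faces Y"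
| "open_cells Y (Suc (Suc (Suc n))) = {}"

definition points :: "('v, 'e, 'f) two_complex \<Rightarrow> ('v, 'e, 'f) point set" where
  "points Y = (\<Union>n. \<Union> (open_cells Y n))"

text \<open>Characteristic maps, on the interval \<open>{0..1}\<close> and on the closed unit disc.\<close>

definition edge_map :: "('v, 'e, 'f) two_complex \<Rightarrow> 'e \<Rightarrow> real \<Rightarrow> ('v, 'e, 'f) point" where
  "edge_map Y e t =
     (if t = 0 then Vert (src Y e) else if t = 1 then Vert (tgt Y e) else EdgePt e t)"

definition letter_map ::
  "('v, 'e, 'f) two_complex \<Rightarrow> 'e \<times> bool \<Rightarrow> real \<Rightarrow> ('v, 'e, 'f) point" where
  "letter_map Y l t = edge_map Y (fst l) (if snd l then t else 1 - t)"

text \<open>The path spelled by a word of length \<open>n\<close>, parametrized by \<open>{0..<n}\<close>: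
  the \<open>i\<close>-th letter is traversed on \<open>{i..<i+1}\<close>.\<close>

definition word_map :: "('v, 'e, 'f) two_complex \<Rightarrow> 'e word \<Rightarrow> real \<Rightarrow> ('v, 'e, 'f) point" where
  "word_map Y w x = letter_map Y (w ! nat \<lfloor>x\<rfloor>) (frac x)"

definition face_map :: "('v, 'e, 'f) two_complex \<Rightarrow> 'f \<Rightarrow> complex \<Rightarrow> ('v, 'e, 'f) point" where
  "face_map Y c z =
     (if cmod z < 1 then FacePt c z
      else word_map Y (bdry Y c) (real (length (bdry Y c)) * Arg2pi z / (2 * pi)))"

text \<open>The quotient topology: a set is open iff its preimages under all characteristic maps are open.\<close>

definition open_in_complex :: "('v, 'e, 'f) two_complex \<Rightarrow> ('v, 'e, 'f) point set \<Rightarrow> bool" where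
  "open_in_complex Y U \<longleftrightarrow> U \<subseteq> points Y \<and>
     (\<forall>e \<in> edges Y. openin (top_of_set {0..1}) {t \<in> {0..1}. edge_map Y e t \<in> U}) \<and>
     (\<forall>c \<in> faces Y. openin (top_of_set (cball 0 1)) {z \<in> cball 0 1. face_map Y c z \<in> U})"

definition space_of :: "('v, 'e, 'f) two_complex \<Rightarrow> ('v, 'e, 'f) point topology" where
  "space_of Y = topology (open_in_complex Y)"

lemma istopology_open_in_complex: "istopology (open_in_complex Y)"
proof -
  have "open_in_complex Y (S \<inter> T)" if S: "open_in_complex Y S" and T: "open_in_complex Y T" for S T
  proof -
    have e: "{t \<in> {0..1}. edge_map Y e t \<in> S \<inter> T} =
        {t \<in> {0..1}. edge_map Y e t \<in> S} \<inter> {t \<in> {0..1}. edge_map Y e t \<in> T}" for e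
      by auto
    have c: "{z \<in> cball 0 1. face_map Y c z \<in> S \<inter> T} =
        {z \<in> cball 0 1. face_map Y c z \<in> S} \<inter> {z \<in> cball 0 1. face_map Y c z \<in> T}" for c
      by auto
    show ?thesis
      unfolding open_in_complex_def e c
    proof (intro conjI ballI)
      show "S \<inter> T \<subseteq> points Y"
        using S unfolding open_in_complex_def by blast
    qed (rule openin_Int; use S T in \<open>simp add: open_in_complex_def del: mem_cball\<close>)+
  qed
  moreover have "open_in_complex Y (\<Union>K)" if K: "\<forall>S\<in>K. open_in_complex Y S" for K
  proof -
    have e: "{t \<in> {0..1}. edge_map Y e t \<in> \<Union>K} = (\<Union>S\<in>K. {t \<in> {0..1}. edge_map Y e t \<in> S})" for e
      by auto
    have c: "{z \<in> cball 0 1. face_map Y c z \<in> \<Union>K} =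
        (\<Union>S\<in>K. {z \<in> cball 0 1. face_map Y c z \<in> S})" for c
      by auto
    show ?thesis
      unfolding open_in_complex_def e c
    proof (intro conjI ballI)
      show "\<Union>K \<subseteq> points Y"
        using K unfolding open_in_complex_def by blast
    qed (rule openin_Union, use K in \<open>force simp: open_in_complex_def simp del: mem_cball\<close>)+
  qed
  ultimately show ?thesis
    unfolding istopology_def by blast
qed

lemma openin_space_of: "openin (space_of Y) = open_in_complex Y"
  unfolding space_of_def by (rule topology_inverse'[OF istopology_open_in_complex])

lemma points_eq:
  "points Y = Vert ` verts Y \<union> (\<Union>e\<in>edges Y. EdgePt e ` {0<..<1}) \<union>
     (\<Union>c\<in>faces Y. FacePt c ` ball 0 1)"
proof -
  have "\<Union> (open_cells Y n) \<subseteq> Vert ` verts Y \<union> (\<Union>e\<in>edges Y. EdgePt e ` {0<..<1}) \<union>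
     (\<Union>c\<in>faces Y. FacePt c ` ball 0 1)" for n
    by (cases "(Y, n)" rule: open_cells.cases) auto
  moreover have "Vert ` verts Y = \<Union> (open_cells Y 0)"
    "(\<Union>e\<in>edges Y. EdgePt e ` {0<..<1}) = \<Union> (open_cells Y (Suc 0))"
    "(\<Union>c\<in>faces Y. FacePt c ` ball 0 1) = \<Union> (open_cells Y (Suc (Suc 0)))"
    by auto
  ultimately show ?thesis
    unfolding points_def by blast
qed

lemma edge_map_in_points:
  assumes "is_two_complex Y" "e \<in> edges Y" "t \<in> {0..1}"
  shows "edge_map Y e t \<in> points Y"
proof -
  have "src Y e \<in> verts Y" "tgt Y e \<in> verts Y"
    using assms unfolding is_two_complex_def by blast+
  then have "Vert (src Y e) \<in> points Y" "Vert (tgt Y e) \<in> points Y"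
    unfolding points_eq by blast+
  moreover have "EdgePt e t \<in> points Y" if "t \<noteq> 0" "t \<noteq> 1"
  proof -
    have "t \<in> {0<..<1}"
      using that assms(3) by simp
    then show ?thesis
      using assms(2) unfolding points_eq by blast
  qed
  ultimately show ?thesis
    unfolding edge_map_def by presburger
qed

lemma face_map_in_points:
  assumes Y: "is_two_complex Y" and c: "c \<in> faces Y" and z: "z \<in> cball 0 1"
  shows "face_map Y c z \<in> points Y"
proof (cases "cmod z < 1")
  case True
  then have "z \<in> ball 0 1"
    by simp
  then have "FacePt c z \<in> points Y"
    using c unfolding points_eq by blast
  then show ?thesis
    using True unfolding face_map_def by presburger
next
  case False
  define w x where "w = bdry Y c" and "x = real (length w) * Arg2pi z / (2 * pi)"
  have w: "w \<noteq> []" "fst ` set w \<subseteq> edges Y"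
    using Y c unfolding is_two_complex_def closed_edge_path_def w_def by auto
  have "real (length w) * Arg2pi z < real (length w) * (2 * pi)"
    using w by (intro mult_strict_left_mono Arg2pi_lt_2pi) auto
  then have "x < real (length w)" "0 \<le> x"
    unfolding x_def by (auto simp: field_simps Arg2pi_ge_0)
  then have "nat \<lfloor>x\<rfloor> < length w"
    by linarith
  then have "fst (w ! nat \<lfloor>x\<rfloor>) \<in> edges Y"
    using w by auto
  then have "word_map Y w x \<in> points Y"
    unfolding word_map_def letter_map_def
    using frac_lt_1[of x] by (intro edge_map_in_points[OF Y]) auto
  then show ?thesis
    using False unfolding face_map_def w_def x_def by simp
qed

lemma topspace_space_of:
  assumes "is_two_complex Y"
  shows "topspace (space_of Y) = points Y"
proof -
  have "{t \<in> {0..1}. edge_map Y e t \<in> points Y} = {0..1}" if "e \<in> edges Y" for e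
    using edge_map_in_points[OF assms that] by auto
  moreover have "{z \<in> cball 0 1. face_map Y c z \<in> points Y} = cball 0 1" if "c \<in> faces Y" for c
    using face_map_in_points[OF assms that] by auto
  ultimately have "open_in_complex Y (points Y)"
    unfolding open_in_complex_def by (auto simp del: mem_cball)
  then show ?thesis
    unfolding topspace_def openin_space_of by (auto simp: open_in_complex_def)
qed

section \<open>Combinatorial maps and immersions\<close>

definition combinatorial_map ::
  "('v, 'e, 'f) two_complex \<Rightarrow> ('x, 'y, 'z) two_complex \<Rightarrow>
   (('v, 'e, 'f) point \<Rightarrow> ('x, 'y, 'z) point) \<Rightarrow> bool" where
  "combinatorial_map Y X f \<longleftrightarrow> continuous_map (space_of Y) (space_of X) f \<and>
     (\<forall>n. \<forall>c \<in> open_cells Y n. f ` c \<in> open_cells X n \<and>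
        homeomorphic_map (subtopology (space_of Y) c) (subtopology (space_of X) (f ` c)) f)"

definition immersion ::
  "('v, 'e, 'f) two_complex \<Rightarrow> ('x, 'y, 'z) two_complex \<Rightarrow>
   (('v, 'e, 'f) point \<Rightarrow> ('x, 'y, 'z) point) \<Rightarrow> bool" where
  "immersion Y X f \<longleftrightarrow> combinatorial_map Y X f \<and>
     (\<forall>p \<in> topspace (space_of Y). \<exists>U. openin (space_of Y) U \<and> p \<in> U \<and> inj_on f U)"

text \<open>Meaningful for complexes with finitely many cells, i.e. with compact underlying space.\<close>

definition euler_char :: "('v, 'e, 'f) two_complex \<Rightarrow> int" where
  "euler_char Y = int (card (verts Y)) - int (card (edges Y)) + int (card (faces Y))"

text \<open>HOL cannot quantify over types inside a definition, so the types of the cells of \<open>Y\<close> are a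
  parameter; they are to be left as type variables.\<close>

definition contracting_nonpositive_immersions ::
  "('v \<times> 'e \<times> 'f) itself \<Rightarrow> ('x, 'y, 'z) two_complex \<Rightarrow> bool" where
  "contracting_nonpositive_immersions _ X \<longleftrightarrow>
     (\<forall>(Y :: ('v, 'e, 'f) two_complex) f.
        is_two_complex Y \<and> connected_space (space_of Y) \<and> compact_space (space_of Y) \<and>
        immersion Y X f \<longrightarrow> euler_char Y \<le> 0 \<or> contractible_space (space_of Y))"

section \<open>Presentation complexes\<close>

record 'g presentation =
  generators :: "'g set"
  relators :: "'g word list"

definition presentation_complex :: "'g presentation \<Rightarrow> (unit, 'g, nat) two_complex" where
  "presentation_complex P =
     \<lparr>verts = {()}, edges = generators P, faces = {..<length (relators P)},
      src = (\<lambda>_. ()), tgt = (\<lambda>_. ()), bdry = (\<lambda>i. relators P ! i)\<rparr>"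

datatype gen = Gen_a | Gen_b

definition pres_P :: "gen presentation" where
  "pres_P = \<lparr>generators = {Gen_a, Gen_b},
        relators =
          [[(Gen_b, True)],
           [(Gen_b, True), (Gen_a, True), (Gen_b, False), (Gen_a, False), (Gen_a, False)]]\<rparr>"

lemma is_two_complex_presentation_complex_pres_P: "is_two_complex (presentation_complex pres_P)"
  unfolding is_two_complex_def closed_edge_path_def presentation_complex_def pres_P_def
  by (auto simp: less_Suc_eq)

end

theory Submission
  imports Defs
begin

text \<open>
  An immersion is straightened first: the inverses of its restrictions to the open cells extend to the
  closed cells, because they lift a map that is already defined there through a map with finite fibres.
  So the 2-cells of the source may be assumed to read the relators \<open>b\<close> and \<open>b a b\<inverse> a\<inverse> a\<inverse>\<close> literally,
  and the letters \<open>a\<close>, \<open>b\<close> act on its vertices as partial injections.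

  Then one collapses vertical (\<open>b\<close>-labelled) edges lying on a single 2-cell side, and leaves. When no collapse is
  possible and there is no disc, every vertical edge meets no or two squares, and counting edge ends gives
  \<open>\<chi> \<le> 0\<close> or a point. If there is a disc, its boundary edge starts a chain of squares that has to close up,
  and the complex is a circle of \<open>n\<close> horizontal edges with an annulus attached to it by maps of degrees
  \<open>2\<close> and \<open>1\<close>, together with one disc. Without its last square it collapses onto the circle, and
  the last square is attached along a loop homotopic to the circle, so the complex is contractible although it
  need not be collapsible.
\<close>

section \<open>Continuous maps out of a complex\<close>

text \<open>A combinatorial map is known only through homeomorphisms of open cells; how boundary
  words correspond has to be recovered. Local injectivity does this in two forms: a lift is
  determined by one of its points, and two 2-cells with the same label and the same letter at the
  same place coincide. So a vertical edge lies on at most three sides: one disc, one first side and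
  one third side of a square.

  Each square has one horizontal edge opposite two of them. Hence in the chain starting at a disc
  the \<open>i\<close>-th vertical edge leads from position \<open>2 * i\<close> to position
  \<open>i\<close> of one horizontal path. A second disc would make that edge a loop, so these two
  positions would agree; as the letters act injectively, position \<open>i\<close> is then the start
  and the edge is the first one. The same doubling lets the boundary of the last square wind once,
  backwards, around the circle.

  Contractibility is topological, so homotopies are written down on closed cells, and winding
  numbers are read from explicit real lifts instead of a fundamental group.\<close>

abbreviation unit_interval :: "real topology" where
  "unit_interval \<equiv> top_of_set {0..1}"

abbreviation unit_disc :: "complex topology" where
  "unit_disc \<equiv> top_of_set (cball 0 1)"

abbreviation unit_circle :: "complex topology" where
  "unit_circle \<equiv> top_of_set (sphere 0 1)"

lemma points_cases:
  assumes "p \<in> points Y"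
  obtains (Vert) v where "v \<in> verts Y" "p = Vert v"
    | (EdgePt) e t where "e \<in> edges Y" "0 < t" "t < 1" "p = EdgePt e t"
    | (FacePt) c z where "c \<in> faces Y" "cmod z < 1" "p = FacePt c z"
  using assms unfolding points_eq by auto

lemma points_intros:
  "v \<in> verts Y \<Longrightarrow> Vert v \<in> points Y"
  "e \<in> edges Y \<Longrightarrow> 0 < t \<Longrightarrow> t < 1 \<Longrightarrow> EdgePt e t \<in> points Y"
  "c \<in> faces Y \<Longrightarrow> cmod z < 1 \<Longrightarrow> FacePt c z \<in> points Y"
  unfolding points_eq by (auto simp: image_iff)

lemma continuous_map_edge_map:
  assumes "is_two_complex Y" "e \<in> edges Y"
  shows "continuous_map unit_interval (space_of Y) (edge_map Y e)"
  unfolding continuous_map_def openin_space_of topspace_space_of[OF assms(1)]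
  using edge_map_in_points[OF assms] assms(2)
  by (auto simp: open_in_complex_def)

lemma continuous_map_face_map:
  assumes "is_two_complex Y" "c \<in> faces Y"
  shows "continuous_map unit_disc (space_of Y) (face_map Y c)"
  unfolding continuous_map_def openin_space_of topspace_space_of[OF assms(1)]
  using face_map_in_points[OF assms] assms(2)
  by (auto simp: open_in_complex_def simp del: mem_cball)

text \<open>Universal property of the quotient. Only a vertex can be missed by all edges and
  2-cells, which explains the separate condition on vertices.\<close>

lemma continuous_map_space_of:
  assumes Y: "is_two_complex Y"
    and v: "\<And>v. v \<in> verts Y \<Longrightarrow> g (Vert v) \<in> topspace T"
    and e: "\<And>e. e \<in> edges Y \<Longrightarrow> continuous_map unit_interval T (\<lambda>t. g (edge_map Y e t))"
    and c: "\<And>c. c \<in> faces Y \<Longrightarrow> continuous_map unit_disc T (\<lambda>z. g (face_map Y c z))"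
  shows "continuous_map (space_of Y) T g"
  unfolding continuous_map_def
proof (intro conjI allI impI)
  show "g \<in> topspace (space_of Y) \<rightarrow> topspace T"
  proof
    fix p assume "p \<in> topspace (space_of Y)"
    then have "p \<in> points Y"
      by (simp add: topspace_space_of[OF Y])
    then show "g p \<in> topspace T"
    proof (cases rule: points_cases)
      case (EdgePt e t)
      then show ?thesis
        using continuous_map_funspace[OF e, of e] by (auto simp: edge_map_def Pi_iff dest!: bspec[of _ _ t])
    next
      case (FacePt c z)
      then show ?thesis
        using continuous_map_funspace[OF c, of c] by (auto simp: face_map_def Pi_iff dest!: bspec[of _ _ z])
    qed (use v in auto)
  qed
next
  fix U assume U: "openin T U"
  have "openin unit_interval {t \<in> {0..1}. edge_map Y e t \<in> {p \<in> points Y. g p \<in> U}}"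
    if "e \<in> edges Y" for e
  proof -
    have "{t \<in> {0..1}. edge_map Y e t \<in> {p \<in> points Y. g p \<in> U}} =
        {t \<in> topspace unit_interval. g (edge_map Y e t) \<in> U}"
      using edge_map_in_points[OF Y that] by auto
    then show ?thesis
      using openin_continuous_map_preimage[OF e[OF that] U] by simp
  qed
  moreover have "openin unit_disc {z \<in> cball 0 1. face_map Y c z \<in> {p \<in> points Y. g p \<in> U}}"
    if "c \<in> faces Y" for c
  proof -
    have "{z \<in> cball 0 1. face_map Y c z \<in> {p \<in> points Y. g p \<in> U}} =
        {t \<in> topspace unit_disc. g (face_map Y c t) \<in> U}"
      using face_map_in_points[OF Y that] by auto
    then show ?thesis
      using openin_continuous_map_preimage[OF c[OF that] U] by simp
  qed
  ultimately show "openin (space_of Y) {p \<in> topspace (space_of Y). g p \<in> U}"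
    unfolding openin_space_of topspace_space_of[OF Y] open_in_complex_def by auto
qed

lemma closedin_space_of:
  assumes Y: "is_two_complex Y" and sub: "A \<subseteq> points Y"
    and e: "\<And>e. e \<in> edges Y \<Longrightarrow> closed {t \<in> {0..1}. edge_map Y e t \<in> A}"
    and c: "\<And>c. c \<in> faces Y \<Longrightarrow> closed {z \<in> cball 0 1. face_map Y c z \<in> A}"
  shows "closedin (space_of Y) A"
  unfolding closedin_def topspace_space_of[OF Y] openin_space_of open_in_complex_def
proof (intro conjI ballI)
  show "openin unit_interval {t \<in> {0..1}. edge_map Y e t \<in> points Y - A}" if "e \<in> edges Y" for e
  proof -
    have "{t \<in> {0..1}. edge_map Y e t \<in> points Y - A} = {0..1} - {t \<in> {0..1}. edge_map Y e t \<in> A}"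
      using edge_map_in_points[OF Y that] by auto
    then show ?thesis
      using openin_diff[OF openin_subtopology_self closed_subset[OF _ e[OF that], of "{0..1}"]]
      by (simp add: subset_eq)
  qed
  show "openin unit_disc {t \<in> cball 0 1. face_map Y c t \<in> points Y - A}" if "c \<in> faces Y" for c
  proof -
    have "{t \<in> cball 0 1. face_map Y c t \<in> points Y - A} = cball 0 1 - {t \<in> cball 0 1. face_map Y c t \<in> A}"
      using face_map_in_points[OF Y that] by auto
    then show ?thesis
      using openin_diff[OF openin_subtopology_self closed_subset[OF _ c[OF that], of "cball 0 1"]]
      by (simp add: subset_eq)
  qed
qed (use sub in auto)

text \<open>All cells are realised inside the complex plane, so that their disjoint sum lives on one type.\<close>

datatype ('v, 'e, 'f) cell = VCell 'v | ECell 'e | FCell 'f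

fun cell_index :: "('v, 'e, 'f) two_complex \<Rightarrow> ('v, 'e, 'f) cell \<Rightarrow> bool" where
  "cell_index Y (VCell v) = (v \<in> verts Y)"
| "cell_index Y (ECell e) = (e \<in> edges Y)"
| "cell_index Y (FCell c) = (c \<in> faces Y)"

fun cell_dom :: "('v, 'e, 'f) cell \<Rightarrow> complex set" where
  "cell_dom (VCell v) = {0}"
| "cell_dom (ECell e) = of_real ` {0..1}"
| "cell_dom (FCell c) = cball 0 1"

fun cell_map :: "('v, 'e, 'f) two_complex \<Rightarrow> ('v, 'e, 'f) cell \<times> complex \<Rightarrow> ('v, 'e, 'f) point" where
  "cell_map Y (VCell v, z) = Vert v"
| "cell_map Y (ECell e, z) = edge_map Y e (Re z)"
| "cell_map Y (FCell c, z) = face_map Y c z"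

definition cell_sum :: "('v, 'e, 'f) two_complex \<Rightarrow> (('v, 'e, 'f) cell \<times> complex) topology" where
  "cell_sum Y = sum_topology (\<lambda>i. top_of_set (cell_dom i)) {i. cell_index Y i}"

lemma continuous_map_from_sum:
  assumes "\<And>i. i \<in> I \<Longrightarrow> continuous_map (X i) T (\<lambda>x. g (i, x))"
  shows "continuous_map (sum_topology X I) T g"
  unfolding continuous_map_def
proof (intro conjI allI impI)
  show "g \<in> topspace (sum_topology X I) \<rightarrow> topspace T"
    using assms by (force simp: continuous_map_def Pi_iff)
  fix U assume "openin T U"
  then have "openin (X i) {x \<in> topspace (X i). g (i, x) \<in> U}" if "i \<in> I" for i
    using assms[OF that] openin_continuous_map_preimage by blast
  then show "openin (sum_topology X I) {x \<in> topspace (sum_topology X I). g x \<in> U}"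
    by (auto simp: openin_sum_topology)
qed

text \<open>A product distributes over a disjoint sum: each point of the sum has neighbourhoods
  inside its own summand, where the hypothesis applies.\<close>

lemma continuous_map_from_prod_sum:
  assumes "\<And>i. i \<in> I \<Longrightarrow> continuous_map (prod_topology Z (X i)) T (\<lambda>(z, x). g (z, (i, x)))"
  shows "continuous_map (prod_topology Z (sum_topology X I)) T g"
  unfolding continuous_map_def
proof (intro conjI allI impI)
  show "g \<in> topspace (prod_topology Z (sum_topology X I)) \<rightarrow> topspace T"
    using assms by (force simp: continuous_map_def Pi_iff)
  fix U assume U: "openin T U"
  let ?S = "{x \<in> topspace (prod_topology Z (sum_topology X I)). g x \<in> U}"
  show "openin (prod_topology Z (sum_topology X I)) ?S"
    unfolding openin_prod_topology_alt
  proof (intro allI impI)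
    fix z k assume k: "(z, k) \<in> ?S"
    obtain i x where ix: "k = (i, x)" "i \<in> I" "x \<in> topspace (X i)" "z \<in> topspace Z"
      using k by auto
    define V where "V = {p \<in> topspace (prod_topology Z (X i)). (\<lambda>(z, x). g (z, (i, x))) p \<in> U}"
    have "openin (prod_topology Z (X i)) V"
      unfolding V_def using assms[OF ix(2)] U by (rule openin_continuous_map_preimage)
    moreover have "(z, x) \<in> V"
      using k ix by (auto simp: V_def)
    ultimately obtain A B where AB: "openin Z A" "openin (X i) B" "z \<in> A" "x \<in> B" "A \<times> B \<subseteq> V"
      unfolding openin_prod_topology_alt by metis
    have "openin (X j) {y. j = i \<and> y \<in> B}" for j
      using AB(2) by (cases "j = i") auto
    then have "openin (sum_topology X I) ({i} \<times> B)"
      using AB(2) ix(2) openin_subset[OF AB(2)]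
      by (auto simp: openin_sum_topology)
    moreover have "A \<times> ({i} \<times> B) \<subseteq> ?S"
      using AB(5)[unfolded V_def] ix openin_subset[OF AB(1)] openin_subset[OF AB(2)] by auto
    ultimately show "\<exists>A B. openin Z A \<and> openin (sum_topology X I) B \<and> z \<in> A \<and> k \<in> B \<and> A \<times> B \<subseteq> ?S"
      using AB ix by blast
  qed
qed

lemma Re_ECell: "continuous_map (top_of_set (of_real ` {0..1})) unit_interval Re"
  by (auto intro!: continuous_intros)

text \<open>Presents the complex as one quotient map out of a disjoint union of cells. This is the
  form to which the theorem on products of quotient maps applies.\<close>

lemma quotient_map_cell_map:
  assumes Y: "is_two_complex Y"
  shows "quotient_map (cell_sum Y) (space_of Y) (cell_map Y)"
  unfolding quotient_map_def
proof (intro conjI allI impI)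
  have cont: "continuous_map (cell_sum Y) (space_of Y) (cell_map Y)"
    unfolding cell_sum_def
  proof (rule continuous_map_from_sum)
    fix i :: "('a, 'b, 'c) cell" assume i: "i \<in> {i. cell_index Y i}"
    show "continuous_map (top_of_set (cell_dom i)) (space_of Y) (\<lambda>x. cell_map Y (i, x))"
    proof (cases i)
      case (VCell v)
      then show ?thesis
        using i by (auto simp: topspace_space_of[OF Y] intro!: points_intros)
    next
      case (ECell e)
      then show ?thesis
        using i continuous_map_compose[OF Re_ECell continuous_map_edge_map[OF Y, of e]]
        by (auto simp: o_def)
    next
      case (FCell c)
      then show ?thesis
        using i continuous_map_face_map[OF Y, of c] by auto
    qed
  qed
  have ts: "topspace (cell_sum Y) = Sigma {i. cell_index Y i} cell_dom"
    by (simp add: cell_sum_def o_def)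
  show surj: "cell_map Y ` topspace (cell_sum Y) = topspace (space_of Y)"
  proof
    show "cell_map Y ` topspace (cell_sum Y) \<subseteq> topspace (space_of Y)"
      using cont by (rule continuous_map_image_subset_topspace)
    show "topspace (space_of Y) \<subseteq> cell_map Y ` topspace (cell_sum Y)"
    proof
      fix p assume "p \<in> topspace (space_of Y)"
      then have "p \<in> points Y" by (simp add: topspace_space_of[OF Y])
      then show "p \<in> cell_map Y ` topspace (cell_sum Y)"
      proof (cases rule: points_cases)
        case (Vert v)
        then show ?thesis
          unfolding ts by (intro image_eqI[of _ _ "(VCell v, 0)"]) auto
      next
        case (EdgePt e t)
        then show ?thesis
          unfolding ts by (intro image_eqI[of _ _ "(ECell e, of_real t)"]) (auto simp: edge_map_def)
      next
        case (FacePt c z)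
        then show ?thesis
          unfolding ts by (intro image_eqI[of _ _ "(FCell c, z)"]) (auto simp: face_map_def)
      qed
    qed
  qed
  fix U assume U: "U \<subseteq> topspace (space_of Y)"
  show "openin (cell_sum Y) {x \<in> topspace (cell_sum Y). cell_map Y x \<in> U} = openin (space_of Y) U"
  proof
    assume "openin (space_of Y) U"
    then show "openin (cell_sum Y) {x \<in> topspace (cell_sum Y). cell_map Y x \<in> U}"
      using cont openin_continuous_map_preimage by blast
  next
    assume op: "openin (cell_sum Y) {x \<in> topspace (cell_sum Y). cell_map Y x \<in> U}"
    then have sl: "openin (top_of_set (cell_dom i))
        {x. (i, x) \<in> {x \<in> topspace (cell_sum Y). cell_map Y x \<in> U}}" if "cell_index Y i" for i
      using that unfolding cell_sum_def openin_sum_topology by auto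
    have "openin unit_interval {t \<in> {0..1}. edge_map Y e t \<in> U}" if e: "e \<in> edges Y" for e
    proof -
      have "continuous_map unit_interval (top_of_set (of_real ` {0..1})) (of_real :: real \<Rightarrow> complex)"
        by (auto intro!: continuous_intros)
      from openin_continuous_map_preimage[OF this, of "{x. (ECell e, x) \<in> {x \<in> topspace (cell_sum Y). cell_map Y x \<in> U}}"]
      have "openin unit_interval {t \<in> {0..1}. edge_map Y e t \<in> U \<and> complex_of_real t \<in> of_real ` {0..1}}"
        using sl[of "ECell e"] e unfolding ts by (simp add: conj_commute)
      moreover have "{t \<in> {0..1}. edge_map Y e t \<in> U \<and> complex_of_real t \<in> of_real ` {0..1}} = {t \<in> {0..1}. edge_map Y e t \<in> U}"
        by auto
      ultimately show ?thesis
        by simp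
    qed
    moreover have "openin unit_disc {z \<in> cball 0 1. face_map Y c z \<in> U}" if c: "c \<in> faces Y" for c
      using sl[of "FCell c"] c unfolding ts by simp
    ultimately show "openin (space_of Y) U"
      using U unfolding openin_space_of open_in_complex_def topspace_space_of[OF Y] by blast
  qed
qed

text \<open>A homotopy may be tested on closed cells because the product of a quotient map with the
  locally compact Hausdorff interval is again a quotient map.\<close>

lemma continuous_map_homotopy_space_of:
  assumes Y: "is_two_complex Y"
    and v: "\<And>v. v \<in> verts Y \<Longrightarrow> continuous_map unit_interval T (\<lambda>t. H (t, Vert v))"
    and e: "\<And>e. e \<in> edges Y \<Longrightarrow>
      continuous_map (prod_topology unit_interval unit_interval) T (\<lambda>(t, s). H (t, edge_map Y e s))"
    and c: "\<And>c. c \<in> faces Y \<Longrightarrow>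
      continuous_map (prod_topology unit_interval unit_disc) T (\<lambda>(t, z). H (t, face_map Y c z))"
  shows "continuous_map (prod_topology unit_interval (space_of Y)) T H"
proof -
  have q: "quotient_map (prod_topology unit_interval (cell_sum Y)) (prod_topology unit_interval (space_of Y))
      (\<lambda>(x, y). (x, cell_map Y y))"
    by (rule quotient_map_prod_right[OF _ _ quotient_map_cell_map[OF Y]])
       (auto simp: compact_imp_locally_compact_space compact_space_subtopology Hausdorff_space_subtopology)
  have ev: "continuous_map (prod_topology unit_interval (top_of_set (cell_dom i))) T (\<lambda>(t, x). H (t, cell_map Y (i, x)))"
    if i: "cell_index Y i" for i
  proof (cases i)
    case (VCell w)
    then show ?thesis
      using i continuous_map_of_fst[of unit_interval "top_of_set {0::complex}" T "\<lambda>t. H (t, Vert w)"] v[of w]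
      by (auto simp: o_def case_prod_beta')
  next
    case (ECell w)
    have "continuous_map (prod_topology unit_interval (top_of_set (of_real ` {0..1}))) (prod_topology unit_interval unit_interval) (\<lambda>(t, x). (t, Re x))"
      using Re_ECell by (auto simp: continuous_map_paired o_def case_prod_beta' intro!: continuous_intros)
    from continuous_map_compose[OF this e[of w]] show ?thesis
      using i ECell by (simp add: o_def case_prod_beta')
  next
    case (FCell w)
    then show ?thesis
      using i c[of w] by auto
  qed
  have "continuous_map (prod_topology unit_interval (cell_sum Y)) T (\<lambda>(t, x). H (t, cell_map Y x))"
    unfolding cell_sum_def by (rule continuous_map_from_prod_sum) (use ev in auto)
  then have "continuous_map (prod_topology unit_interval (cell_sum Y)) T (H \<circ> (\<lambda>(x, y). (x, cell_map Y y)))"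
    by (simp add: o_def case_prod_beta')
  then show ?thesis
    using continuous_compose_quotient_map[OF q] by blast
qed

section \<open>The boundary circle of a face\<close>

text \<open>The circle is measured in letters of a word of length \<open>m\<close>:
  \<open>circ_pos m\<close> takes values from 0 up to, but excluding, \<open>m\<close> and jumps at
  the point 1; \<open>circ_pt m\<close> goes back and has period \<open>m\<close>.\<close>

definition circ_pos :: "nat \<Rightarrow> complex \<Rightarrow> real" where
  "circ_pos m z = real m * Arg2pi z / (2 * pi)"

definition circ_pt :: "nat \<Rightarrow> real \<Rightarrow> complex" where
  "circ_pt m x = cis (2 * pi * x / real m)"

lemma norm_circ_pt [simp]: "cmod (circ_pt m x) = 1"
  by (simp add: circ_pt_def)

lemma circ_pos_bounds:
  assumes "m > 0"
  shows "0 \<le> circ_pos m z" "circ_pos m z < real m"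
proof -
  have "real m * Arg2pi z < real m * (2 * pi)"
    using assms by (intro mult_strict_left_mono Arg2pi_lt_2pi) auto
  then show "0 \<le> circ_pos m z" "circ_pos m z < real m"
    unfolding circ_pos_def by (auto simp: field_simps Arg2pi_ge_0)
qed

lemma circ_pt_pos: "m > 0 \<Longrightarrow> cmod z = 1 \<Longrightarrow> circ_pt m (circ_pos m z) = z"
  using complex_norm_eq_1_exp[of z] by (simp add: circ_pt_def circ_pos_def cis_conv_exp)

lemma circ_pos_pt:
  assumes "0 \<le> x" "x < real m"
  shows "circ_pos m (circ_pt m x) = x"
proof -
  have "m > 0"
    using assms by (cases m) auto
  then have "Arg2pi (circ_pt m x) = 2 * pi * x / real m"
    using assms by (intro Arg2pi_unique[of 1]) (auto simp: circ_pt_def cis_conv_exp field_simps)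
  then show ?thesis
    using \<open>m > 0\<close> by (simp add: circ_pos_def)
qed

lemma circ_pt_period: "m > 0 \<Longrightarrow> circ_pt m (real m) = circ_pt m 0"
  by (simp add: circ_pt_def)

lemma quotient_map_circ_pt:
  assumes "m > 0"
  shows "quotient_map (top_of_set {0..real m}) unit_circle (circ_pt m)"
proof -
  have cont: "continuous_map (top_of_set {0..real m}) unit_circle (circ_pt m)"
    unfolding circ_pt_def using assms by (auto intro!: continuous_intros)
  have "closed_map (top_of_set {0..real m}) unit_circle (circ_pt m)"
    by (rule continuous_imp_closed_map[OF cont])
       (auto simp: compact_space_subtopology Hausdorff_space_subtopology)
  moreover have "circ_pt m ` topspace (top_of_set {0..real m}) = topspace unit_circle"
  proof -
    have "z \<in> circ_pt m ` {0..real m}" if "cmod z = 1" for z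
      using that assms circ_pos_bounds[of m z] by (intro image_eqI[of _ _ "circ_pos m z"]) (auto simp: circ_pt_pos)
    then show ?thesis by auto
  qed
  ultimately show ?thesis
    using cont continuous_closed_imp_quotient_map by blast
qed

text \<open>The jump of \<open>circ_pos m\<close> is harmless when \<open>g\<close> takes the same
  value at both ends, since \<open>circ_pt m\<close> is a quotient map from the interval to the
  circle.\<close>

lemma continuous_map_on_circle:
  assumes m: "m > 0" and g: "continuous_map (top_of_set {0..real m}) T g" and eq: "g 0 = g (real m)"
  shows "continuous_map unit_circle T (\<lambda>z. g (circ_pos m z))"
proof -
  have "g (circ_pos m (circ_pt m x)) = g x" if "x \<in> {0..real m}" for x
    using that m eq circ_pos_pt[of x m] circ_pos_pt[of 0 m] circ_pt_period[OF m] by (cases "x = real m") auto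
  then have "continuous_map (top_of_set {0..real m}) T ((\<lambda>z. g (circ_pos m z)) \<circ> circ_pt m)"
    by (intro continuous_map_eq[OF g]) auto
  then show ?thesis
    by (rule continuous_compose_quotient_map[OF quotient_map_circ_pt[OF m]])
qed

lemma continuous_map_piecewise:
  assumes m: "m > 0"
    and g: "\<And>i. i < m \<Longrightarrow> continuous_map (top_of_set {real i..real i + 1}) T g"
  shows "continuous_map (top_of_set {0..real m}) T g"
proof (rule pasting_lemma_closed[of "{..<m}" _ "\<lambda>i. {real i..real i + 1}" _ "\<lambda>_. g"])
  have sub: "{0..real m} \<inter> {real i..real i + 1} = {real i..real i + 1}" if "i < m" for i
    using that by auto
  show "closedin (top_of_set {0..real m}) {real i..real i + 1}" if "i \<in> {..<m}" for i
    using that by (intro closed_subset) auto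
  show "continuous_map (subtopology (top_of_set {0..real m}) {real i..real i + 1}) T g" if "i \<in> {..<m}" for i
    using that g[of i] sub[of i] by (simp add: subtopology_subtopology)
  show "\<exists>j. j \<in> {..<m} \<and> x \<in> {real j..real j + 1} \<and> g x = g x" if "x \<in> topspace (top_of_set {0..real m})" for x
  proof (cases "x = real m")
    case True
    then show ?thesis using m by (intro exI[of _ "m - 1"]) auto
  next
    case False
    then show ?thesis using that by (intro exI[of _ "nat \<lfloor>x\<rfloor>"]) (auto, linarith+)
  qed
qed auto

lemma letter_map_0: "letter_map Y l 0 = Vert (letter_start Y l)"
  and letter_map_1: "letter_map Y l 1 = Vert (letter_end Y l)"
  by (auto simp: letter_map_def edge_map_def letter_start_def letter_end_def)

lemma word_map_letter:
  assumes "closed_edge_path Y w" "i < length w" "0 \<le> t" "t < 1"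
  shows "word_map Y w (real i + t) = letter_map Y (w ! i) t"
proof -
  have "\<lfloor>real i + t\<rfloor> = int i"
    using assms by linarith
  then show ?thesis
    by (simp add: word_map_def frac_def)
qed

lemma continuous_map_letter_map:
  assumes "continuous_map unit_interval T (\<lambda>t. g (edge_map Y (fst l) t))"
  shows "continuous_map unit_interval T (\<lambda>t. g (letter_map Y l t))"
proof -
  have "continuous_map unit_interval unit_interval (\<lambda>t. if snd l then t else 1 - t)"
    by (cases "snd l") (auto intro!: continuous_intros)
  from continuous_map_compose[OF this assms] show ?thesis
    by (simp add: o_def letter_map_def)
qed

text \<open>At \<open>t = 1\<close> the position is the start of the next letter, or wraps round
  from \<open>length w\<close> to 0; the values agree because consecutive letters of a closed edge
  path share a vertex.\<close>

lemma word_boundary: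
  assumes w: "closed_edge_path Y w" and i: "i < length w" and t: "0 \<le> t" "t \<le> 1"
  shows "word_map Y w (circ_pos (length w) (circ_pt (length w) (real i + t))) = letter_map Y (w ! i) t"
proof (cases "t = 1")
  case False
  then show ?thesis
    using assms by (subst circ_pos_pt) (auto intro!: word_map_letter[OF w])
next
  case t1: True
  have ne: "w \<noteq> []"
    using i by auto
  have adj: "letter_end Y (w ! i) = letter_start Y (w ! (Suc i mod length w))"
    using w i unfolding closed_edge_path_def by blast
  show ?thesis
  proof (cases "Suc i = length w")
    case True
    have "circ_pt (length w) (real i + t) = circ_pt (length w) 0"
      using circ_pt_period[of "length w"] t1 True i by (metis add.commute gr_implies_not0 neq0_conv of_nat_Suc)
    then show ?thesis
      using word_map_letter[OF w, of 0 0] i t1 True adj circ_pos_pt[of 0 "length w"] ne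
      by (simp add: letter_map_0 letter_map_1)
  next
    case False
    then show ?thesis
      using word_map_letter[OF w, of "Suc i" 0] i t1 adj
      by (simp add: add.commute circ_pos_pt letter_map_0 letter_map_1)
  qed
qed

lemma circ_pt_surj:
  assumes "m > 0" "cmod z = 1"
  obtains i t where "i < m" "0 \<le> t" "t < 1" "z = circ_pt m (real i + t)"
proof
  let ?x = "circ_pos m z"
  have b: "0 \<le> ?x" "?x < real m"
    using circ_pos_bounds[OF assms(1)] by auto
  show "nat \<lfloor>?x\<rfloor> < m" "0 \<le> frac ?x" "frac ?x < 1"
    using b frac_lt_1[of ?x] by (auto, linarith)
  have "real (nat \<lfloor>?x\<rfloor>) + frac ?x = ?x"
    using b by (simp add: frac_def)
  then show "z = circ_pt m (real (nat \<lfloor>?x\<rfloor>) + frac ?x)"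
    using circ_pt_pos[OF assms] by simp
qed

lemma continuous_map_word:
  assumes w: "closed_edge_path Y w"
    and g: "\<And>e. e \<in> fst ` set w \<Longrightarrow> continuous_map unit_interval T (\<lambda>t. g (edge_map Y e t))"
  shows "continuous_map unit_circle T (\<lambda>z. g (word_map Y w (circ_pos (length w) z)))"
proof -
  let ?m = "length w"
  have m: "?m > 0"
    using w by (auto simp: closed_edge_path_def)
  \<comment> \<open>Passing through \<open>circ_pt\<close> makes the path meaningful at the right
    end \<open>?m\<close> of the interval, where the word itself has no letter.\<close>
  define G where "G x = g (word_map Y w (circ_pos ?m (circ_pt ?m x)))" for x
  have "continuous_map (top_of_set {0..real ?m}) T G"
  proof (rule continuous_map_piecewise[OF m])
    fix i assume i: "i < ?m"
    have l: "continuous_map unit_interval T (\<lambda>t. g (letter_map Y (w ! i) t))"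
      using i by (intro continuous_map_letter_map g) auto
    have "continuous_map (top_of_set {real i..real i + 1}) unit_interval (\<lambda>x. x - real i)"
      by (auto intro!: continuous_intros)
    from continuous_map_compose[OF this l]
    have "continuous_map (top_of_set {real i..real i + 1}) T (\<lambda>x. g (letter_map Y (w ! i) (x - real i)))"
      by (simp add: o_def)
    then show "continuous_map (top_of_set {real i..real i + 1}) T G"
    proof (rule continuous_map_eq)
      fix x assume "x \<in> topspace (top_of_set {real i..real i + 1})"
      then show "g (letter_map Y (w ! i) (x - real i)) = G x"
        using word_boundary[OF w i, of "x - real i"] by (simp add: G_def)
    qed
  qed
  moreover have "G 0 = G (real ?m)"
    by (simp add: G_def circ_pt_period[OF m])
  ultimately have "continuous_map unit_circle T (\<lambda>z. G (circ_pos ?m z))"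
    by (rule continuous_map_on_circle[OF m])
  then show ?thesis
    by (rule continuous_map_eq) (simp add: G_def circ_pt_pos[OF m])
qed

lemma face_map_boundary: "cmod z = 1 \<Longrightarrow> face_map Y c z = word_map Y (bdry Y c) (circ_pos (length (bdry Y c)) z)"
  by (simp add: face_map_def circ_pos_def)

lemma face_map_interior: "cmod z < 1 \<Longrightarrow> face_map Y c z = FacePt c z"
  by (simp add: face_map_def)

lemma face_map_arc:
  assumes "closed_edge_path Y (bdry Y c)" "i < length (bdry Y c)" "0 \<le> t" "t \<le> 1"
  shows "face_map Y c (circ_pt (length (bdry Y c)) (real i + t)) = letter_map Y (bdry Y c ! i) t"
  using word_boundary[OF assms] by (simp add: face_map_boundary)

lemma closed_bdry: "is_two_complex Y \<Longrightarrow> c \<in> faces Y \<Longrightarrow> closed_edge_path Y (bdry Y c)"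
  by (simp add: is_two_complex_def)

lemma bdry_edges: "is_two_complex Y \<Longrightarrow> c \<in> faces Y \<Longrightarrow> i < length (bdry Y c) \<Longrightarrow> fst (bdry Y c ! i) \<in> edges Y"
  using closed_bdry[of Y c] by (auto simp: closed_edge_path_def)

lemma bdry_pos: "is_two_complex Y \<Longrightarrow> c \<in> faces Y \<Longrightarrow> length (bdry Y c) > 0"
  using closed_bdry[of Y c] by (auto simp: closed_edge_path_def)

lemma continuous_map_face_boundary:
  assumes "is_two_complex Y" "c \<in> faces Y"
    and "\<And>e. e \<in> fst ` set (bdry Y c) \<Longrightarrow> continuous_map unit_interval T (\<lambda>t. g (edge_map Y e t))"
  shows "continuous_map unit_circle T (\<lambda>z. g (face_map Y c z))"
  by (rule continuous_map_eq[OF continuous_map_word[OF closed_bdry[OF assms(1,2)] assms(3)]])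
     (auto simp: face_map_boundary)

section \<open>Separation and finiteness\<close>

definition in_skeleton :: "('v, 'e, 'f) point \<Rightarrow> bool" where
  "in_skeleton p \<longleftrightarrow> (\<forall>c z. p \<noteq> FacePt c z)"

lemma in_skeleton_simps [simp]:
  "in_skeleton (Vert v)" "in_skeleton (EdgePt e t)" "\<not> in_skeleton (FacePt c z)"
  "in_skeleton (edge_map Y e t)" "in_skeleton (letter_map Y l t)" "in_skeleton (word_map Y w x)"
  by (auto simp: in_skeleton_def edge_map_def letter_map_def word_map_def)

lemma in_skeleton_face_map: "in_skeleton (face_map Y c z) \<longleftrightarrow> \<not> cmod z < 1"
  by (auto simp: face_map_def)

text \<open>Tietze extends the values from the boundary of each disc to its interior. This turns
  functions on the graph into functions on the complex, for separating points.\<close>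

lemma extend_over_faces:
  fixes g :: "('v, 'e, 'f) point \<Rightarrow> real"
  assumes Y: "is_two_complex Y"
    and g: "\<And>e. e \<in> edges Y \<Longrightarrow> continuous_on {0..1} (\<lambda>t. g (edge_map Y e t))"
  obtains G where "continuous_map (space_of Y) euclideanreal G" "\<And>p. in_skeleton p \<Longrightarrow> G p = g p"
proof -
  have "\<exists>h. continuous_on (cball 0 1) h \<and> (\<forall>z \<in> sphere 0 1. h z = g (face_map Y c z))" if c: "c \<in> faces Y" for c
  proof -
    have "continuous_map unit_circle euclideanreal (\<lambda>z. g (face_map Y c z))"
      using g closed_bdry[OF Y c] by (intro continuous_map_face_boundary[OF Y c]) (auto simp: closed_edge_path_def)
    then have "continuous_on (sphere 0 1) (\<lambda>z. g (face_map Y c z))"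
      by auto
    moreover have "closedin unit_disc (sphere 0 1)"
      by (intro closed_subset) auto
    ultimately obtain h where "continuous_on (cball 0 1) h" "\<And>z. z \<in> sphere 0 1 \<Longrightarrow> h z = g (face_map Y c z)"
      using Tietze_unbounded by blast
    then show ?thesis by blast
  qed
  then obtain h where h: "\<And>c. c \<in> faces Y \<Longrightarrow> continuous_on (cball 0 1) (h c)"
    "\<And>c z. c \<in> faces Y \<Longrightarrow> z \<in> sphere 0 1 \<Longrightarrow> h c z = g (face_map Y c z)"
    by metis
  define G where "G p = (case p of FacePt c z \<Rightarrow> h c z | _ \<Rightarrow> g p)" for p
  have G: "G p = g p" if "in_skeleton p" for p
    using that by (auto simp: G_def split: point.splits)
  have "continuous_map (space_of Y) euclideanreal G"
  proof (rule continuous_map_space_of[OF Y])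
    fix e assume "e \<in> edges Y"
    then show "continuous_map unit_interval euclideanreal (\<lambda>t. G (edge_map Y e t))"
      using g by (simp add: G)
  next
    fix c assume c: "c \<in> faces Y"
    have "G (face_map Y c z) = h c z" if "cmod z \<le> 1" for z
    proof (cases "cmod z < 1")
      case True
      then show ?thesis by (simp add: face_map_interior G_def)
    next
      case False
      then show ?thesis using that h(2)[OF c, of z] by (simp add: G in_skeleton_face_map)
    qed
    then show "continuous_map unit_disc euclideanreal (\<lambda>z. G (face_map Y c z))"
      using h(1)[OF c] by (auto intro: continuous_on_eq)
  qed auto
  with G show ?thesis using that by blast
qed

lemma points_separated:
  assumes Y: "is_two_complex Y" and p: "p \<in> points Y" and q: "q \<in> points Y" and "p \<noteq> q"
  obtains G where "continuous_map (space_of Y) euclideanreal G" "G p \<noteq> G q"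
proof -
  have face: "\<exists>G. continuous_map (space_of Y) euclideanreal G \<and> G p \<noteq> G q"
    if p: "p = FacePt c w" "cmod w < 1" and "p \<noteq> q" for p q c w
  proof -
    \<comment> \<open>A bump at \<open>w\<close> whose radius \<open>1 - cmod w\<close> makes it
      vanish on the boundary circle, so that it extends by zero.\<close>
    define b where "b z = max 0 (1 - cmod w - cmod (z - w))" for z
    define G where "G x = (case x of FacePt c' z \<Rightarrow> if c' = c then b z else 0 | _ \<Rightarrow> 0)" for x :: "('a, 'b, 'c) point"
    have b0: "b z = 0" if "\<not> cmod z < 1" for z
      using that norm_triangle_ineq2[of z w] by (simp add: b_def)
    have eq: "G (face_map Y c' z) = (if c' = c then b z else 0)" for c' z
    proof (cases "cmod z < 1")
      case True
      then show ?thesis by (simp add: face_map_interior G_def)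
    next
      case False
      then have "in_skeleton (face_map Y c' z)"
        by (simp add: in_skeleton_face_map)
      then show ?thesis
        using b0[OF False] by (auto simp: G_def split: point.splits)
    qed
    have "continuous_map (space_of Y) euclideanreal G"
    proof (rule continuous_map_space_of[OF Y])
      show "continuous_map unit_interval euclideanreal (\<lambda>t. G (edge_map Y e t))" for e
      proof -
        have "G (edge_map Y e t) = 0" for t
          by (simp add: G_def edge_map_def)
        then show ?thesis by simp
      qed
      show "continuous_map unit_disc euclideanreal (\<lambda>z. G (face_map Y c' z))" for c'
        unfolding eq b_def by (cases "c' = c") (auto intro!: continuous_intros)
    qed auto
    moreover have "G p \<noteq> G q"
    proof -
      have bw: "b w > 0"
        using p(2) by (simp add: b_def)
      have "b z < b w" if "z \<noteq> w" for z
        using that p(2) by (auto simp: b_def)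
      then show ?thesis
        using that p(2) bw by (cases q) (auto simp: G_def, metis less_irrefl)
    qed
    ultimately show ?thesis by blast
  qed
  have edge: "\<exists>G. continuous_map (space_of Y) euclideanreal G \<and> G p \<noteq> G q"
    if p: "p = EdgePt e s" "0 < s" "s < 1" and "p \<noteq> q" "in_skeleton q" for p q e s
  proof -
    \<comment> \<open>The same kind of bump on an open edge; values on the 2-cells come from
      \<open>extend_over_faces\<close>.\<close>
    define b where "b t = max 0 (min s (1 - s) - \<bar>t - s\<bar>)" for t :: real
    define g where "g x = (case x of EdgePt e' t \<Rightarrow> if e' = e then b t else 0 | _ \<Rightarrow> 0)" for x :: "('a, 'b, 'c) point"
    have eq: "g (edge_map Y e' t) = (if e' = e then b t else 0)" for e' t
      using p by (auto simp: g_def edge_map_def b_def)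
    have "continuous_on {0..1} (\<lambda>t. g (edge_map Y e' t))" for e'
      unfolding eq b_def by (cases "e' = e") (auto intro!: continuous_intros)
    then obtain G where G: "continuous_map (space_of Y) euclideanreal G" "\<And>p. in_skeleton p \<Longrightarrow> G p = g p"
      using extend_over_faces[OF Y, of g] by blast
    have "g p \<noteq> g q"
      using that by (auto simp: g_def b_def split: point.splits)
    then show ?thesis
      using G that by (intro exI[of _ G]) auto
  qed
  have vert: "\<exists>G. continuous_map (space_of Y) euclideanreal G \<and> G p \<noteq> G q"
    if p: "p = Vert v" "q = Vert v'" "v \<noteq> v'" for p q v v'
  proof -
    \<comment> \<open>The indicator of \<open>v\<close>, interpolated linearly along the
      edges.\<close>
    define b where "b u = (if u = v then 1 else 0 :: real)" for u
    define g where "g x = (case x of Vert u \<Rightarrow> b u | EdgePt e t \<Rightarrow> (1 - t) * b (src Y e) + t * b (tgt Y e) | _ \<Rightarrow> 0)"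
      for x :: "('a, 'b, 'c) point"
    have eq: "g (edge_map Y e' t) = (1 - t) * b (src Y e') + t * b (tgt Y e')" for e' t
      by (auto simp: g_def edge_map_def)
    have "continuous_on {0..1} (\<lambda>t. g (edge_map Y e' t))" for e'
      unfolding eq by (auto intro!: continuous_intros)
    then obtain G where G: "continuous_map (space_of Y) euclideanreal G" "\<And>p. in_skeleton p \<Longrightarrow> G p = g p"
      using extend_over_faces[OF Y, of g] by blast
    then show ?thesis
      using that by (intro exI[of _ G]) (auto simp: g_def b_def)
  qed
  have "\<exists>G. continuous_map (space_of Y) euclideanreal G \<and> G p \<noteq> G q"
  proof (cases p)
    case (FacePt c w)
    then show ?thesis using face[of p c w q] p \<open>p \<noteq> q\<close> by (auto simp: points_eq)
  next
    case pe: (EdgePt e s)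
    show ?thesis
    proof (cases q)
      case (FacePt c w)
      moreover have "cmod w < 1" using q FacePt by (auto simp: points_eq)
      ultimately show ?thesis using face[of q c w p] \<open>p \<noteq> q\<close> by metis
    qed (use pe edge[of p e s q] p \<open>p \<noteq> q\<close> in \<open>auto simp: points_eq\<close>)
  next
    case pv: (Vert v)
    show ?thesis
    proof (cases q)
      case (FacePt c w)
      moreover have "cmod w < 1" using q FacePt by (auto simp: points_eq)
      ultimately show ?thesis using face[of q c w p] \<open>p \<noteq> q\<close> by metis
    next
      case (EdgePt e s)
      moreover have "0 < s" "s < 1" using q EdgePt by (auto simp: points_eq)
      ultimately show ?thesis using edge[of q e s p] \<open>p \<noteq> q\<close> pv in_skeleton_simps(1) by metis
    next
      case (Vert v')
      then show ?thesis using vert[of p v q v'] \<open>p \<noteq> q\<close> pv by auto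
    qed
  qed
  then show ?thesis using that by blast
qed

lemma Hausdorff_space_of:
  assumes "is_two_complex Y"
  shows "Hausdorff_space (space_of Y)"
  unfolding Hausdorff_space_def topspace_space_of[OF assms]
proof (intro allI impI)
  fix p q assume pq: "p \<in> points Y \<and> q \<in> points Y \<and> p \<noteq> q"
  then obtain G where G: "continuous_map (space_of Y) euclideanreal G" "G p \<noteq> G q"
    using points_separated[OF assms] by metis
  obtain A B where AB: "open A" "open B" "G p \<in> A" "G q \<in> B" "A \<inter> B = {}"
    using G(2) by (meson hausdorff)
  let ?P = "\<lambda>A. {x \<in> topspace (space_of Y). G x \<in> A}"
  have "openin (space_of Y) (?P A)" "openin (space_of Y) (?P B)"
    using openin_continuous_map_preimage[OF G(1)] AB by auto
  moreover have "p \<in> ?P A" "q \<in> ?P B" "disjnt (?P A) (?P B)"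
    using AB pq by (auto simp: disjnt_def topspace_space_of[OF assms])
  ultimately show "\<exists>U V. openin (space_of Y) U \<and> openin (space_of Y) V \<and> p \<in> U \<and> q \<in> V \<and> disjnt U V"
    by blast
qed

text \<open>Preimages under characteristic maps are finite: the boundary of a 2-cell has finitely
  many letters, and each meets \<open>A\<close> at most in its ends and one inner point.\<close>

lemma closedin_sparse:
  assumes Y: "is_two_complex Y" and A: "A \<subseteq> points Y"
    and e: "\<And>e t t'. EdgePt e t \<in> A \<Longrightarrow> EdgePt e t' \<in> A \<Longrightarrow> t = t'"
    and c: "\<And>c z z'. FacePt c z \<in> A \<Longrightarrow> FacePt c z' \<in> A \<Longrightarrow> z = z'"
  shows "closedin (space_of Y) A"
proof (rule closedin_space_of[OF Y A])
  have fin_e: "finite {t \<in> {0..1}. edge_map Y e t \<in> A}" for e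
  proof (rule finite_subset)
    show "{t \<in> {0..1}. edge_map Y e t \<in> A} \<subseteq> {0, 1} \<union> {t. EdgePt e t \<in> A}"
      by (auto simp: edge_map_def split: if_splits)
    have "{t. EdgePt e t \<in> A} \<subseteq> {THE t. EdgePt e t \<in> A}"
      using e by (auto intro!: the_equality[symmetric])
    then show "finite ({0, 1} \<union> {t. EdgePt e t \<in> A})"
      by (auto intro: finite_subset)
  qed
  then show "closed {t \<in> {0..1}. edge_map Y e t \<in> A}" for e
    by (rule finite_imp_closed)
  have fin_l: "finite {t \<in> {0..1}. letter_map Y l t \<in> A}" for l
  proof (rule finite_subset)
    show "{t \<in> {0..1}. letter_map Y l t \<in> A} \<subseteq>
        {t \<in> {0..1}. edge_map Y (fst l) t \<in> A} \<union> (\<lambda>t. 1 - t) ` {t \<in> {0..1}. edge_map Y (fst l) t \<in> A}"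
    proof
      fix t assume t: "t \<in> {t \<in> {0..1}. letter_map Y l t \<in> A}"
      show "t \<in> {t \<in> {0..1}. edge_map Y (fst l) t \<in> A} \<union> (\<lambda>t. 1 - t) ` {t \<in> {0..1}. edge_map Y (fst l) t \<in> A}"
      proof (cases "snd l")
        case False
        then show ?thesis using t by (intro UnI2 image_eqI[of _ _ "1 - t"]) (auto simp: letter_map_def)
      qed (use t in \<open>auto simp: letter_map_def\<close>)
    qed
  qed (use fin_e in auto)
  show "closed {z \<in> cball 0 1. face_map Y c z \<in> A}" if cf: "c \<in> faces Y" for c
  proof (rule finite_imp_closed, rule finite_subset)
    let ?w = "bdry Y c"
    let ?R = "\<Union>i<length ?w. (\<lambda>t. circ_pt (length ?w) (real i + t)) ` {t \<in> {0..1}. letter_map Y (?w ! i) t \<in> A}"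
    show "{z \<in> cball 0 1. face_map Y c z \<in> A} \<subseteq> {z. FacePt c z \<in> A} \<union> ?R"
    proof
      fix z assume z: "z \<in> {z \<in> cball 0 1. face_map Y c z \<in> A}"
      show "z \<in> {z. FacePt c z \<in> A} \<union> ?R"
      proof (cases "cmod z < 1")
        case True
        then show ?thesis using z by (simp add: face_map_interior)
      next
        case False
        then have "cmod z = 1" using z by simp
        then obtain i t where it: "i < length ?w" "0 \<le> t" "t < 1" "z = circ_pt (length ?w) (real i + t)"
          using circ_pt_surj[OF bdry_pos[OF Y cf]] by metis
        then have "letter_map Y (?w ! i) t \<in> A"
          using z face_map_arc[OF closed_bdry[OF Y cf] it(1), of t] by simp
        then show ?thesis using it by (auto intro!: UnI2 bexI[of _ i])
      qed
    qed
    have "{z. FacePt c z \<in> A} \<subseteq> {THE z. FacePt c z \<in> A}"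
      using assms(4) by (auto intro!: the_equality[symmetric])
    then show "finite ({z. FacePt c z \<in> A} \<union> ?R)"
      using fin_l by (auto intro: finite_subset)
  qed
qed

text \<open>One point is chosen in every open cell of a given dimension. All subsets of this
  selection are closed, so it is a closed discrete subspace of a compact space.\<close>

lemma finite_cells:
  assumes Y: "is_two_complex Y" and comp: "compact_space (space_of Y)"
  shows "finite (verts Y)" "finite (edges Y)" "finite (faces Y)"
proof -
  have fin: "finite P" if P: "P \<subseteq> points Y"
    and e: "\<And>e t t'. EdgePt e t \<in> P \<Longrightarrow> EdgePt e t' \<in> P \<Longrightarrow> t = t'"
    and c: "\<And>c z z'. FacePt c z \<in> P \<Longrightarrow> FacePt c z' \<in> P \<Longrightarrow> z = z'" for P
  proof -
    have cl: "closedin (space_of Y) A" if "A \<subseteq> P" for A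
      by (rule closedin_sparse[OF Y]) (use that P e c in blast)+
    have "subtopology (space_of Y) P = discrete_topology P"
    proof (rule sym, subst discrete_topology_unique, intro conjI ballI)
      show "topspace (subtopology (space_of Y) P) = P"
        using P by (auto simp: topspace_subtopology topspace_space_of[OF Y])
      fix x assume "x \<in> P"
      have "openin (space_of Y) (topspace (space_of Y) - (P - {x}))"
        by (rule openin_diff) (auto intro: cl)
      moreover have "{x} = (topspace (space_of Y) - (P - {x})) \<inter> P"
        using \<open>x \<in> P\<close> P by (auto simp: topspace_space_of[OF Y])
      ultimately show "openin (subtopology (space_of Y) P) {x}"
        unfolding openin_subtopology by blast
    qed
    moreover have "compact_space (subtopology (space_of Y) P)"
      using closedin_compact_space[OF comp cl[of P]] unfolding compactin_subspace by blast
    ultimately show ?thesis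
      by (simp add: compact_space_discrete_topology)
  qed
  have "finite (Vert ` verts Y :: ('a, 'b, 'c) point set)"
    by (rule fin) (auto simp: points_eq)
  then show "finite (verts Y)"
    by (rule finite_imageD) (auto simp: inj_on_def)
  have "finite ((\<lambda>e. EdgePt e (1/2)) ` edges Y :: ('a, 'b, 'c) point set)"
    by (rule fin) (auto intro: points_intros)
  then show "finite (edges Y)"
    by (rule finite_imageD) (auto simp: inj_on_def)
  have "finite ((\<lambda>c. FacePt c 0) ` faces Y :: ('a, 'b, 'c) point set)"
    by (rule fin) (auto intro: points_intros)
  then show "finite (faces Y)"
    by (rule finite_imageD) (auto simp: inj_on_def)
qed

section \<open>Collapses\<close>

lemma continuous_map_prod_right:
  assumes "continuous_map Z W f"
  shows "continuous_map (prod_topology X Z) (prod_topology X W) (\<lambda>(t, s). (t, f s))"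
  unfolding case_prod_beta'
  by (intro continuous_map_pairedI continuous_map_fst
      continuous_map_compose[OF continuous_map_snd assms, unfolded o_def])

text \<open>\<open>X'\<close> stands for a subcomplex with its own quotient topology, included by
  \<open>id\<close>; this spares a comparison with the subspace topology.\<close>

definition deforms_into :: "'a topology \<Rightarrow> 'a topology \<Rightarrow> bool" where
  "deforms_into X X' \<longleftrightarrow> continuous_map X' X id \<and>
     (\<exists>r. continuous_map X X' r \<and> homotopic_with (\<lambda>_. True) X X id r)"

text \<open>Up to homotopy both maps factor through \<open>r\<close>. This will reduce a homotopy on
  a complex with squares to an equation on a circle.\<close>

lemma deforms_into_homotopic:
  assumes d: "deforms_into X X'" and g: "continuous_map X T g" and h: "continuous_map X T h"
    and gh: "homotopic_with (\<lambda>_. True) X' T g h"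
  shows "homotopic_with (\<lambda>_. True) X T g h"
proof -
  obtain r where r: "continuous_map X X' r" "homotopic_with (\<lambda>_. True) X X id r"
    using d by (auto simp: deforms_into_def)
  have 1: "homotopic_with (\<lambda>_. True) X T g (g \<circ> r)"
    using homotopic_with_compose_continuous_map_left[OF r(2) g, of "\<lambda>_. True"] by simp
  have 2: "homotopic_with (\<lambda>_. True) X T h (h \<circ> r)"
    using homotopic_with_compose_continuous_map_left[OF r(2) h, of "\<lambda>_. True"] by simp
  have 3: "homotopic_with (\<lambda>_. True) X T (g \<circ> r) (h \<circ> r)"
    using homotopic_with_compose_continuous_map_right[OF gh r(1), of "\<lambda>_. True"] by simp
  show ?thesis
    using homotopic_with_trans[OF homotopic_with_trans[OF 1 3]] 2 by (simp add: homotopic_with_symD)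
qed

lemma deforms_into_refl: "deforms_into X X"
  unfolding deforms_into_def by (auto intro!: exI[of _ id])

lemma deforms_into_trans:
  assumes "deforms_into X X'" "deforms_into X' X''"
  shows "deforms_into X X''"
proof -
  obtain r r' where r: "continuous_map X X' r" "homotopic_with (\<lambda>_. True) X X id r"
    "continuous_map X' X'' r'" "homotopic_with (\<lambda>_. True) X' X' id r'"
    and i: "continuous_map X' X id" "continuous_map X'' X' id"
    using assms by (auto simp: deforms_into_def)
  have "homotopic_with (\<lambda>_. True) X' X (id \<circ> id) (id \<circ> r')"
    using homotopic_with_compose_continuous_map_left[OF r(4) i(1)] by simp
  then have "homotopic_with (\<lambda>_. True) X X (id \<circ> id \<circ> r) (id \<circ> r' \<circ> r)"
    using homotopic_with_compose_continuous_map_right[OF _ r(1)] by fastforce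
  then have "homotopic_with (\<lambda>_. True) X X id (r' \<circ> r)"
    using homotopic_with_trans[OF r(2)] by simp
  moreover have "continuous_map X X'' (r' \<circ> r)"
    using continuous_map_compose[OF r(1,3)] .
  moreover have "continuous_map X'' X id"
    using continuous_map_compose[OF i(2,1)] by simp
  ultimately show ?thesis
    unfolding deforms_into_def by blast
qed

lemma deforms_into_contractible:
  assumes d: "deforms_into X X'" and c: "contractible_space X'"
  shows "contractible_space X"
proof -
  have i: "continuous_map X' X id"
    using d by (simp add: deforms_into_def)
  obtain r where r: "continuous_map X X' r"
    using d by (auto simp: deforms_into_def)
  obtain a where a: "homotopic_with (\<lambda>_. True) X' X' id (\<lambda>_. a)"
    using c by (auto simp: contractible_space_def)
  then have "homotopic_with (\<lambda>_. True) X' X id (\<lambda>_. a)"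
    using homotopic_with_compose_continuous_map_left[OF a i, of "\<lambda>_. True"] by (simp add: o_def id_def)
  moreover have "continuous_map X X (\<lambda>_. a)"
  \<comment> \<open>For nonempty \<open>X\<close> the map \<open>r\<close> produces a point of
    \<open>X'\<close>, so the centre \<open>a\<close> of the contraction really lies in the
    space.\<close>
  proof (cases "topspace X = {}")
    case False
    then obtain y where "y \<in> topspace X" by blast
    then have "r y \<in> topspace X'"
      using continuous_map_funspace[OF r] by blast
    then have "a \<in> topspace X'"
      using homotopic_with_imp_continuous_maps[OF a] by (auto simp: continuous_map_def Pi_iff)
    then show ?thesis
      using i by (auto simp: continuous_map_def)
  qed (auto simp: continuous_map_on_empty)
  ultimately have "homotopic_with (\<lambda>_. True) X X id (\<lambda>_. a)"
    by (intro deforms_into_homotopic[OF d]) auto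
  then show ?thesis
    by (auto simp: contractible_space_def)
qed

lemma continuous_map_subcomplex:
  assumes Y: "is_two_complex Y" and Y': "is_two_complex Y'"
    and sub: "verts Y' \<subseteq> verts Y" "edges Y' \<subseteq> edges Y" "faces Y' \<subseteq> faces Y"
    and eq: "src Y' = src Y" "tgt Y' = tgt Y" "bdry Y' = bdry Y"
  shows "continuous_map (space_of Y') (space_of Y) id"
proof -
  have e: "edge_map Y' = edge_map Y"
    by (intro ext) (simp add: edge_map_def eq)
  then have "face_map Y' = face_map Y"
    by (intro ext) (simp add: face_map_def word_map_def letter_map_def eq)
  then show ?thesis
    using e sub continuous_map_edge_map[OF Y] continuous_map_face_map[OF Y]
    by (intro continuous_map_space_of[OF Y'])
       (auto simp: topspace_space_of[OF Y] eta_contract_eq intro!: points_intros)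
qed

lemma deforms_intoI:
  assumes Y: "is_two_complex Y" and i: "continuous_map X' (space_of Y) id"
    and H: "continuous_map (prod_topology unit_interval (space_of Y)) (space_of Y) H"
    and H0: "\<And>p. p \<in> points Y \<Longrightarrow> H (0, p) = p"
    and H1: "continuous_map (space_of Y) X' (\<lambda>p. H (1, p))"
  shows "deforms_into (space_of Y) X'"
  unfolding deforms_into_def
proof (intro conjI i exI)
  show "homotopic_with (\<lambda>_. True) (space_of Y) (space_of Y) id (\<lambda>p. H (1, p))"
    by (subst homotopic_with) (auto intro!: exI[of _ H] H simp: H0 topspace_space_of[OF Y])
qed (rule H1)

definition remove_face_edge :: "('v, 'e, 'f) two_complex \<Rightarrow> 'f \<Rightarrow> 'e \<Rightarrow> ('v, 'e, 'f) two_complex" where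
  "remove_face_edge Y c e = Y\<lparr>edges := edges Y - {e}, faces := faces Y - {c}\<rparr>"

text \<open>A free face in the sense of elementary collapses. It is given by a position because one
  edge may occur several times in a boundary word, and this has to be excluded.\<close>

definition free_edge :: "('v, 'e, 'f) two_complex \<Rightarrow> 'f \<Rightarrow> nat \<Rightarrow> bool" where
  "free_edge Y c p \<longleftrightarrow> c \<in> faces Y \<and> p < length (bdry Y c) \<and>
     (\<forall>i<length (bdry Y c). i \<noteq> p \<longrightarrow> fst (bdry Y c ! i) \<noteq> fst (bdry Y c ! p)) \<and>
     (\<forall>c'\<in>faces Y. c' \<noteq> c \<longrightarrow> fst (bdry Y c ! p) \<notin> fst ` set (bdry Y c'))"

lemma is_two_complex_remove_face_edge:
  assumes Y: "is_two_complex Y" and e: "\<And>c'. c' \<in> faces Y \<Longrightarrow> c' \<noteq> c \<Longrightarrow> e \<notin> fst ` set (bdry Y c')"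
  shows "is_two_complex (remove_face_edge Y c e)"
proof -
  have "letter_start (remove_face_edge Y c e) = letter_start Y" "letter_end (remove_face_edge Y c e) = letter_end Y"
    by (auto simp: letter_start_def letter_end_def remove_face_edge_def fun_eq_iff)
  then show ?thesis
    using Y e unfolding is_two_complex_def closed_edge_path_def by (force simp: remove_face_edge_def)
qed

text \<open>The complement of an open arc of length \<open>1/m\<close> in the circle is a retract of the disc.\<close>

lemma arc_coordinate:
  assumes m: "m > 0"
  obtains x where "continuous_on (cball 0 1) x" "\<And>z. z \<in> cball 0 1 \<Longrightarrow> x z \<in> {0..real (m - 1)}"
    "\<And>t. t \<in> {0..real (m - 1)} \<Longrightarrow> x (circ_pt m (a + t)) = t"
proof -
  let ?f = "\<lambda>t. circ_pt m (a + t)" and ?I = "{0..real (m - 1)}"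
  have "inj_on ?f ?I"
  proof (rule inj_onI)
    fix s t assume st: "s \<in> ?I" "t \<in> ?I" "?f s = ?f t"
    \<comment> \<open>The arc covers only \<open>m - 1\<close> of the \<open>m\<close> letters, so
      two angles on it differ by less than \<open>2 * pi\<close>.\<close>
    have "\<bar>2 * pi * (a + s) / real m - 2 * pi * (a + t) / real m\<bar> = 2 * pi * (\<bar>s - t\<bar> / real m)"
      by (simp add: diff_divide_distrib[symmetric] right_diff_distrib[symmetric] abs_mult abs_divide)
    also have "\<dots> < 2 * pi"
    proof -
      have "\<bar>s - t\<bar> < real m"
        using st m by auto
      then show ?thesis using m by (simp add: field_simps)
    qed
    finally have "\<bar>2 * pi * (a + s) / real m - 2 * pi * (a + t) / real m\<bar> < 2 * pi" .
    then have "2 * pi * (a + s) / real m = 2 * pi * (a + t) / real m"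
      using exp_complex_eqI[of "\<i> * of_real (2 * pi * (a + s) / real m)" "\<i> * of_real (2 * pi * (a + t) / real m)"] st(3)
      unfolding circ_pt_def cis_conv_exp by (simp del: of_real_divide of_real_mult of_real_add)
    then show "s = t" using m by simp
  qed
  moreover have "continuous_on ?I ?f"
    unfolding circ_pt_def using m by (auto intro!: continuous_intros)
  ultimately obtain g where g: "homeomorphism ?I (?f ` ?I) ?f g"
    using homeomorphism_compact[of ?I ?f "?f ` ?I"] by auto
  then have "continuous_on (?f ` ?I) g" "\<And>z. z \<in> ?f ` ?I \<Longrightarrow> g z \<in> cbox 0 (real (m - 1))"
    by (auto simp: homeomorphism_def)
  moreover have "closedin unit_disc (?f ` ?I)"
  proof (rule closed_subset)
    have "continuous_on ?I ?f"
      unfolding circ_pt_def using m by (auto intro!: continuous_intros)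
    then show "closed (?f ` ?I)"
      by (intro compact_imp_closed compact_continuous_image) auto
  qed auto
  \<comment> \<open>Tietze extends the inverse of the arc parametrisation to the whole disc, with
    values in the same interval.\<close>
  ultimately obtain x where x: "continuous_on (cball 0 1) x" "\<And>z. z \<in> ?f ` ?I \<Longrightarrow> x z = g z"
    "\<And>z. z \<in> cball 0 1 \<Longrightarrow> x z \<in> cbox 0 (real (m - 1))"
    using Tietze_closed_interval_1[of "?f ` ?I" g "cball 0 1" 0 "real (m - 1)"] by (metis of_nat_0_le_iff)
  show ?thesis
  proof
    show "x (circ_pt m (a + t)) = t" if "t \<in> ?I" for t
      using x(2)[of "?f t"] that g by (auto simp: homeomorphism_def)
  qed (use x in auto)
qed

text \<open>The elementary collapse is carried out in the disc: a straight-line homotopy pushes it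
  onto the complement of the open arc of letter \<open>p\<close>. The other letters stay fixed, so
  nothing else in the complex moves.\<close>

lemma deforms_into_remove_face_edge:
  assumes Y: "is_two_complex Y" and free: "free_edge Y c p" and e: "e = fst (bdry Y c ! p)"
  shows "deforms_into (space_of Y) (space_of (remove_face_edge Y c e))"
proof -
  let ?Y' = "remove_face_edge Y c e" and ?w = "bdry Y c"
  let ?m = "length ?w"
  have c: "c \<in> faces Y" and p: "p < ?m" and ei: "\<And>i. i < ?m \<Longrightarrow> i \<noteq> p \<Longrightarrow> fst (?w ! i) \<noteq> e"
    and ec: "\<And>c' i. c' \<in> faces Y \<Longrightarrow> c' \<noteq> c \<Longrightarrow> i < length (bdry Y c') \<Longrightarrow> fst (bdry Y c' ! i) \<noteq> e"
    using free e nth_mem unfolding free_edge_def by (blast, blast, blast, metis image_eqI)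
  have m: "?m > 0" using p by linarith
  have cl: "closed_edge_path Y ?w" using closed_bdry[OF Y c] .
  have Y': "is_two_complex ?Y'"
    using free e by (intro is_two_complex_remove_face_edge[OF Y]) (auto simp: free_edge_def)
  have sel: "verts ?Y' = verts Y" "edges ?Y' = edges Y - {e}" "faces ?Y' = faces Y - {c}"
    "src ?Y' = src Y" "tgt ?Y' = tgt Y" "bdry ?Y' = bdry Y"
    by (auto simp: remove_face_edge_def)
  have em: "edge_map ?Y' = edge_map Y"
    by (intro ext) (simp add: edge_map_def sel)
  then have fm: "face_map ?Y' = face_map Y" and lm: "letter_map ?Y' = letter_map Y"
    by (intro ext, simp add: face_map_def word_map_def letter_map_def sel)+
  obtain x where x: "continuous_on (cball 0 1) x" "\<And>z. z \<in> cball 0 1 \<Longrightarrow> x z \<in> {0..real (?m - 1)}"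
    "\<And>t. t \<in> {0..real (?m - 1)} \<Longrightarrow> x (circ_pt ?m (real (Suc p) + t)) = t"
    using arc_coordinate[OF m] by blast
  \<comment> \<open>The surviving arc starts at the end of letter \<open>p\<close>, which is
    position \<open>Suc p\<close>, and runs through the other \<open>?m - 1\<close> letters to the
    start of \<open>p\<close>.\<close>
  define R where "R z = circ_pt ?m (real (Suc p) + x z)" for z
  define H0 where "H0 = (\<lambda>(t, z). of_real (1 - t) * z + of_real t * R z)"
  \<comment> \<open>The place on the arc of letter \<open>p\<close> that maps to parameter
    \<open>s\<close> of \<open>e\<close>, whichever way the letter traverses \<open>e\<close>. The
    edge moves through the interior of the 2-cell, so its motion is defined there.\<close>
  define \<alpha> where "\<alpha> s = circ_pt ?m (real p + (if snd (?w ! p) then s else 1 - s))" for s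
  define H where "H = (\<lambda>(t, q). case q of Vert v \<Rightarrow> Vert v
    | EdgePt e' s \<Rightarrow> if e' = e then face_map Y c (H0 (t, \<alpha> s)) else q
    | FacePt c' z \<Rightarrow> if c' = c then face_map Y c (H0 (t, z)) else q)"
  have Rfix: "R z = z" if "z = circ_pt ?m (real (Suc p) + t)" "t \<in> {0..real (?m - 1)}" for z t
    using x(3)[of t] that by (simp add: R_def)
  have H0fix: "H0 (t, z) = z" if "R z = z" for t z
    using that by (simp add: H0_def algebra_simps)
  have Rarc: "R (circ_pt ?m (real i + s)) = circ_pt ?m (real i + s)"
    if i: "i < ?m" "i \<noteq> p" and s: "0 \<le> s" "s \<le> 1" for i s
  proof (cases "p < i")
    case True
    then show ?thesis
      using i s by (intro Rfix[of _ "real i + s - real (Suc p)"]) (auto simp: of_nat_diff)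
  next
    case False
    \<comment> \<open>Positions before \<open>p\<close> lie on the arc only after a full turn is
      added.\<close>
    have "circ_pt ?m (real i + s) = circ_pt ?m (real i + s + real ?m)"
      using m by (simp add: circ_pt_def add_divide_distrib distrib_left cis_mult[symmetric])
    then show ?thesis
      using False i s p by (intro Rfix[of _ "real i + s + real ?m - real (Suc p)"]) (auto simp: of_nat_diff)
  qed
  have Rend: "R (circ_pt ?m (real p)) = circ_pt ?m (real p)" "R (circ_pt ?m (real p + 1)) = circ_pt ?m (real p + 1)"
  proof -
    have "circ_pt ?m (real p) = circ_pt ?m (real p + real ?m)"
      using m by (simp add: circ_pt_def add_divide_distrib distrib_left cis_mult[symmetric])
    then show "R (circ_pt ?m (real p)) = circ_pt ?m (real p)"
      using p by (intro Rfix[of _ "real ?m - 1"]) (auto simp: of_nat_diff)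
    show "R (circ_pt ?m (real p + 1)) = circ_pt ?m (real p + 1)"
      using p by (intro Rfix[of _ 0]) (auto simp: add.commute)
  qed
  have \<alpha>: "face_map Y c (\<alpha> s) = edge_map Y e s" if "0 \<le> s" "s \<le> 1" for s
    using face_map_arc[OF cl p, of "if snd (?w ! p) then s else 1 - s"] that
    by (auto simp: \<alpha>_def letter_map_def e)
  have H_edge: "H (t, edge_map Y e s) = face_map Y c (H0 (t, \<alpha> s))" if "0 \<le> s" "s \<le> 1" for t s
  proof (cases "s = 0 \<or> s = 1")
    case True
    then have "R (\<alpha> s) = \<alpha> s"
      using Rend by (auto simp: \<alpha>_def)
    moreover have "H (t, edge_map Y e s) = edge_map Y e s"
      using True by (auto simp: H_def edge_map_def)
    ultimately show ?thesis
      using \<alpha>[OF that] H0fix by simp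
  qed (auto simp: H_def edge_map_def)
  have H_edge': "H (t, edge_map Y e' s) = edge_map Y e' s" if "e' \<noteq> e" for t e' s
    using that by (auto simp: H_def edge_map_def)
  have H_letter: "H (t, letter_map Y l s) = letter_map Y l s" if "fst l \<noteq> e" for t l s
    using H_edge'[OF that] by (simp add: letter_map_def)
  have H_face: "H (t, face_map Y c z) = face_map Y c (H0 (t, z))" if "cmod z \<le> 1" for t z
  proof (cases "cmod z < 1")
    case False
    then have "cmod z = 1" using that by simp
    then obtain i s where it: "i < ?m" "0 \<le> s" "s < 1" "z = circ_pt ?m (real i + s)"
      using circ_pt_surj[OF m] by metis
    show ?thesis
    proof (cases "i = p")
      case True
      let ?s = "if snd (?w ! p) then s else 1 - s"
      have "\<alpha> ?s = z" "0 \<le> ?s" "?s \<le> 1"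
        using it True by (auto simp: \<alpha>_def)
      then show ?thesis
        using H_edge[of ?s] \<alpha>[of ?s] by simp
    next
      case False
      have "H (t, face_map Y c z) = face_map Y c z"
        using face_map_arc[OF cl it(1), of s] it H_letter[OF ei[OF it(1) False]] by simp
      then show ?thesis
        using Rarc[OF it(1) False, of s] it H0fix by simp
    qed
  qed (simp add: face_map_interior H_def)
  have H_face': "H (t, face_map Y c' z) = face_map Y c' z" if c': "c' \<in> faces Y" "c' \<noteq> c" "cmod z \<le> 1" for t c' z
  proof (cases "cmod z < 1")
    case True
    then show ?thesis using c' by (simp add: face_map_interior H_def)
  next
    case False
    then have "cmod z = 1" using c' by simp
    then obtain i s where it: "i < length (bdry Y c')" "0 \<le> s" "s < 1" "z = circ_pt (length (bdry Y c')) (real i + s)"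
      using circ_pt_surj[OF bdry_pos[OF Y c'(1)]] by metis
    then show ?thesis
      using face_map_arc[OF closed_bdry[OF Y c'(1)] it(1), of s] H_letter[OF ec[OF c'(1,2) it(1)]] by simp
  qed
  have contR: "continuous_on (cball 0 1) R"
    unfolding R_def circ_pt_def using x(1) m by (auto intro!: continuous_intros)
  have H0_in: "H0 (t, z) \<in> cball 0 1" if "t \<in> {0..1}" "z \<in> cball 0 1" for t z
    using convexD_alt[OF convex_cball[of 0 1], of z "R z" t] that by (simp add: R_def H0_def scaleR_conv_of_real)
  have contH0: "continuous_map (prod_topology unit_interval unit_disc) unit_disc H0"
  proof -
    have "continuous_on ({0..1} \<times> cball 0 1) H0"
      unfolding H0_def case_prod_beta'
      by (intro continuous_intros continuous_on_compose2[OF contR]) auto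
    moreover have "H0 ` ({0..1} \<times> cball 0 1) \<subseteq> cball 0 1"
      using H0_in by (auto simp del: mem_cball)
    ultimately show ?thesis
      by (auto simp: subtopology_Times[symmetric] euclidean_product_topology simp del: mem_cball)
  qed
  have cont\<alpha>: "continuous_map unit_interval unit_disc \<alpha>"
    unfolding \<alpha>_def circ_pt_def using m by (cases "snd (?w ! p)") (auto intro!: continuous_intros)
  have contH: "continuous_map (prod_topology unit_interval (space_of Y)) (space_of Y) H"
  proof (rule continuous_map_homotopy_space_of[OF Y])
    show "continuous_map unit_interval (space_of Y) (\<lambda>t. H (t, Vert v))" if "v \<in> verts Y" for v
      using that by (auto simp: H_def topspace_space_of[OF Y] intro: points_intros)
  next
    fix e' assume e': "e' \<in> edges Y"
    show "continuous_map (prod_topology unit_interval unit_interval) (space_of Y) (\<lambda>(t, s). H (t, edge_map Y e' s))"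
    proof (cases "e' = e")
      case True
      have "continuous_map (prod_topology unit_interval unit_interval) (prod_topology unit_interval unit_disc) (\<lambda>(t, s). (t, \<alpha> s))"
        by (rule continuous_map_prod_right[OF cont\<alpha>])
      from continuous_map_compose[OF continuous_map_compose[OF this contH0] continuous_map_face_map[OF Y c]]
      show ?thesis
        by (rule continuous_map_eq) (auto simp: True H_edge)
    next
      case False
      have "continuous_map (prod_topology unit_interval unit_interval) (space_of Y) (edge_map Y e' \<circ> snd)"
        by (intro continuous_map_compose[OF continuous_map_snd] continuous_map_edge_map[OF Y e'])
      then show ?thesis
        by (rule continuous_map_eq) (auto simp: H_edge'[OF False])
    qed
  next
    fix c' assume c': "c' \<in> faces Y"
    show "continuous_map (prod_topology unit_interval unit_disc) (space_of Y) (\<lambda>(t, s). H (t, face_map Y c' s))"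
    proof (cases "c' = c")
      case True
      from continuous_map_compose[OF contH0 continuous_map_face_map[OF Y c]]
      show ?thesis
        by (rule continuous_map_eq) (auto simp: True H_face)
    next
      case False
      have "continuous_map (prod_topology unit_interval unit_disc) (space_of Y) (face_map Y c' \<circ> snd)"
        by (intro continuous_map_compose[OF continuous_map_snd] continuous_map_face_map[OF Y c'])
      then show ?thesis
        by (rule continuous_map_eq) (auto simp: H_face'[OF c' False])
    qed
  qed
  \<comment> \<open>The smaller complex has its own topology, so continuity into it is checked anew,
    letter by letter along the arc, none of whose letters is \<open>e\<close>.\<close>
  define P where "P t = face_map Y c (circ_pt ?m (real (Suc p) + t))" for t
  have contP: "continuous_map (top_of_set {0..real (?m - 1)}) (space_of ?Y') P"
  proof (cases "?m = 1")
    \<comment> \<open>For a one-letter boundary, such as that of a disc, the arc is a single point,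
      and this must be a vertex of the smaller complex.\<close>
    case True
    have "P 0 = letter_map Y (?w ! p) 1"
      using face_map_arc[OF cl p, of 1] by (simp add: P_def add.commute)
    moreover have "letter_map Y (?w ! p) 1 \<in> points Y"
      using bdry_edges[OF Y c p] by (auto simp: letter_map_def intro!: edge_map_in_points[OF Y])
    ultimately have "P 0 \<in> points ?Y'"
      unfolding letter_map_1 by (auto simp: points_eq sel)
    then have "continuous_map (top_of_set {0}) (space_of ?Y') (\<lambda>_. P 0)"
      by (simp add: topspace_space_of[OF Y'])
    then have "continuous_map (top_of_set {0}) (space_of ?Y') P"
      by (rule continuous_map_eq) simp
    then show ?thesis
      using True by simp
  next
    case False
    show ?thesis
    proof (rule continuous_map_piecewise)
      show "?m - 1 > 0" using False m by linarith
      fix i assume i: "i < ?m - 1"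
      \<comment> \<open>Letters after \<open>p\<close> in cyclic order; \<open>i = 0\<close> gives
        the successor of \<open>p\<close>.\<close>
      define k where "k = (Suc p + i) mod ?m"
      have k: "k < ?m" "k \<noteq> p"
      proof -
        show "k < ?m" using m by (simp add: k_def)
        show "k \<noteq> p"
          using i p by (cases "Suc p + i < ?m") (auto simp: k_def mod_if)
      qed
      have eqk: "circ_pt ?m (real k + s) = circ_pt ?m (real (Suc p) + real i + s)" for s
      proof (cases "Suc p + i < ?m")
        case True
        then show ?thesis by (simp add: k_def add.assoc)
      next
        case False
        moreover have "Suc p + i - ?m < ?m"
          using i p by linarith
        ultimately have "Suc p + i = k + ?m"
          by (simp add: k_def mod_if)
        then have "real (Suc p) + real i = real k + real ?m"
          by (metis of_nat_add)
        then show ?thesis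
          using m by (simp add: circ_pt_def add_divide_distrib distrib_left cis_mult[symmetric])
      qed
      have "fst (?w ! k) \<in> edges ?Y'"
        using bdry_edges[OF Y c k(1)] ei[OF k] by (simp add: sel)
      then have l: "continuous_map unit_interval (space_of ?Y') (letter_map Y (?w ! k))"
        using continuous_map_letter_map[of "space_of ?Y'" id ?Y' "?w ! k"] continuous_map_edge_map[OF Y']
        by (simp add: lm eta_contract_eq)
      have "continuous_map (top_of_set {real i..real i + 1}) unit_interval (\<lambda>x. x - real i)"
        by (auto intro!: continuous_intros)
      from continuous_map_compose[OF this l]
      show "continuous_map (top_of_set {real i..real i + 1}) (space_of ?Y') P"
      proof (rule continuous_map_eq)
        fix s assume "s \<in> topspace (top_of_set {real i..real i + 1})"
        then have "0 \<le> s - real i" "s - real i \<le> 1" by auto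
        then have "face_map Y c (circ_pt ?m (real k + (s - real i))) = letter_map Y (?w ! k) (s - real i)"
          by (rule face_map_arc[OF cl k(1)])
        then show "(letter_map Y (?w ! k) \<circ> (\<lambda>x. x - real i)) s = P s"
          unfolding eqk by (simp add: P_def add.assoc)
      qed
    qed
  qed
  have contx: "continuous_map unit_disc (top_of_set {0..real (?m - 1)}) x"
    using x by (auto simp del: mem_cball)
  have contFR: "continuous_map unit_disc (space_of ?Y') (\<lambda>z. face_map Y c (R z))"
    using continuous_map_compose[OF contx contP] by (simp add: o_def P_def R_def)
  have H01: "H0 (1, z) = R z" for z
    by (simp add: H0_def)
  show ?thesis
  proof (rule deforms_intoI[OF Y _ contH])
    show "continuous_map (space_of ?Y') (space_of Y) id"
      by (rule continuous_map_subcomplex[OF Y Y']) (auto simp: sel)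
    show "H (0, q) = q" if "q \<in> points Y" for q
      using that
    proof (cases rule: points_cases)
      case (EdgePt e' s)
      then show ?thesis using \<alpha>[of s] by (auto simp: H_def H0_def edge_map_def)
    next
      case (FacePt c' z)
      then show ?thesis by (auto simp: H_def H0_def face_map_interior)
    qed (auto simp: H_def)
    show "continuous_map (space_of Y) (space_of ?Y') (\<lambda>q. H (1, q))"
    proof (rule continuous_map_space_of[OF Y])
      show "H (1, Vert v) \<in> topspace (space_of ?Y')" if "v \<in> verts Y" for v
        using that by (auto simp: H_def topspace_space_of[OF Y'] sel intro!: points_intros)
    next
      fix e' assume e': "e' \<in> edges Y"
      show "continuous_map unit_interval (space_of ?Y') (\<lambda>t. H (1, edge_map Y e' t))"
      proof (cases "e' = e")
        case True
        from continuous_map_compose[OF cont\<alpha> contFR] show ?thesis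
          by (rule continuous_map_eq) (auto simp: True H_edge H01)
      next
        case False
        then show ?thesis
          using continuous_map_edge_map[OF Y', of e'] e' by (simp add: H_edge' sel em eta_contract_eq)
      qed
    next
      fix c' assume c': "c' \<in> faces Y"
      show "continuous_map unit_disc (space_of ?Y') (\<lambda>z. H (1, face_map Y c' z))"
      proof (cases "c' = c")
        case True
        show ?thesis
          by (rule continuous_map_eq[OF contFR]) (auto simp: True H_face H01)
      next
        case False
        have "continuous_map unit_disc (space_of ?Y') (face_map Y c')"
          using continuous_map_face_map[OF Y', of c'] c' False by (simp add: sel fm)
        then show ?thesis
          by (rule continuous_map_eq) (auto simp: H_face'[OF c' False])
      qed
    qed
  qed
qed

definition remove_leaf :: "('v, 'e, 'f) two_complex \<Rightarrow> 'v \<Rightarrow> 'e \<Rightarrow> ('v, 'e, 'f) two_complex" where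
  "remove_leaf Y v e = Y\<lparr>verts := verts Y - {v}, edges := edges Y - {e}\<rparr>"

definition leaf :: "('v, 'e, 'f) two_complex \<Rightarrow> 'v \<Rightarrow> 'e \<times> bool \<Rightarrow> bool" where
  "leaf Y v l \<longleftrightarrow> fst l \<in> edges Y \<and> letter_end Y l = v \<and> letter_start Y l \<noteq> v \<and>
     (\<forall>e'\<in>edges Y. e' \<noteq> fst l \<longrightarrow> src Y e' \<noteq> v \<and> tgt Y e' \<noteq> v) \<and>
     (\<forall>c\<in>faces Y. fst l \<notin> fst ` set (bdry Y c))"

lemma is_two_complex_remove_leaf:
  assumes Y: "is_two_complex Y" and l: "leaf Y v l"
  shows "is_two_complex (remove_leaf Y v (fst l))"
proof -
  have le: "letter_start (remove_leaf Y v (fst l)) = letter_start Y" "letter_end (remove_leaf Y v (fst l)) = letter_end Y"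
    by (auto simp: letter_start_def letter_end_def remove_leaf_def fun_eq_iff)
  have "src Y e \<in> verts Y - {v} \<and> tgt Y e \<in> verts Y - {v}" if "e \<in> edges Y - {fst l}" for e
    using that Y l unfolding is_two_complex_def leaf_def by blast
  moreover have "closed_edge_path (remove_leaf Y v (fst l)) (bdry Y c)" if "c \<in> faces Y" for c
  proof -
    have "fst l \<notin> fst ` set (bdry Y c)"
      using l that unfolding leaf_def by blast
    then have "fst ` set (bdry Y c) \<subseteq> edges Y - {fst l}"
      using closed_bdry[OF Y that] unfolding closed_edge_path_def by blast
    then show ?thesis
      using closed_bdry[OF Y that] unfolding closed_edge_path_def le by (simp add: remove_leaf_def)
  qed
  ultimately show ?thesis
    unfolding is_two_complex_def by (simp add: remove_leaf_def)
qed

lemma deforms_into_remove_leaf: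
  assumes Y: "is_two_complex Y" and l: "leaf Y v l"
  shows "deforms_into (space_of Y) (space_of (remove_leaf Y v (fst l)))"
proof -
  let ?Y' = "remove_leaf Y v (fst l)" and ?e = "fst l"
  let ?o = "\<lambda>s. if snd l then s else 1 - s :: real"
  have e: "?e \<in> edges Y" and le: "letter_end Y l = v" and ls: "letter_start Y l \<noteq> v"
    and e': "\<And>e'. e' \<in> edges Y \<Longrightarrow> e' \<noteq> ?e \<Longrightarrow> src Y e' \<noteq> v \<and> tgt Y e' \<noteq> v"
    and cf: "\<And>c i. c \<in> faces Y \<Longrightarrow> i < length (bdry Y c) \<Longrightarrow> fst (bdry Y c ! i) \<noteq> ?e"
    using l nth_mem unfolding leaf_def by (blast, blast, blast, blast, metis image_eqI)
  have Y': "is_two_complex ?Y'"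
    using is_two_complex_remove_leaf[OF Y l] .
  have sel: "verts ?Y' = verts Y - {v}" "edges ?Y' = edges Y - {?e}" "faces ?Y' = faces Y"
    "src ?Y' = src Y" "tgt ?Y' = tgt Y" "bdry ?Y' = bdry Y"
    by (auto simp: remove_leaf_def)
  have em: "edge_map ?Y' = edge_map Y"
    by (intro ext) (simp add: edge_map_def sel)
  then have fm: "face_map ?Y' = face_map Y"
    by (intro ext, simp add: face_map_def word_map_def letter_map_def sel)+
  \<comment> \<open>The leaf edge is measured by the parameter along \<open>l\<close>, which starts
    at the inner end; scaling it by \<open>1 - t\<close> draws the edge in. \<open>?o\<close>
    converts from the orientation of the edge.\<close>
  define H where "H = (\<lambda>(t, q). case q of Vert w \<Rightarrow> if w = v then letter_map Y l (1 - t) else q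
    | EdgePt e' s \<Rightarrow> if e' = ?e then letter_map Y l ((1 - t) * ?o s) else q
    | FacePt c' z \<Rightarrow> q)"
  have em_l: "edge_map Y ?e s = letter_map Y l (?o s)" for s
    by (simp add: letter_map_def)
  have H_edge: "H (t, edge_map Y ?e s) = letter_map Y l ((1 - t) * ?o s)" for t s
    using le ls unfolding H_def edge_map_def letter_start_def letter_end_def
    by (cases "snd l") (auto simp: letter_map_0[of Y l] letter_start_def)
  have H_edge': "H (t, edge_map Y e' s) = edge_map Y e' s" if "e' \<in> edges Y" "e' \<noteq> ?e" for t e' s
    using that e'[OF that] by (auto simp: H_def edge_map_def)
  have H_letter: "H (t, letter_map Y k s) = letter_map Y k s" if "fst k \<in> edges Y" "fst k \<noteq> ?e" for t k s
    using H_edge'[OF that] by (simp add: letter_map_def)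
  have H_face: "H (t, face_map Y c z) = face_map Y c z" if c: "c \<in> faces Y" "cmod z \<le> 1" for t c z
  proof (cases "cmod z < 1")
    case True
    then show ?thesis by (simp add: face_map_interior H_def)
  next
    case False
    then have "cmod z = 1" using c by simp
    then obtain i s where it: "i < length (bdry Y c)" "0 \<le> s" "s < 1" "z = circ_pt (length (bdry Y c)) (real i + s)"
      using circ_pt_surj[OF bdry_pos[OF Y c(1)]] by metis
    then show ?thesis
      using face_map_arc[OF closed_bdry[OF Y c(1)] it(1), of s] H_letter[OF bdry_edges[OF Y c(1) it(1)] cf[OF c(1) it(1)]]
      by simp
  qed
  have contl: "continuous_map unit_interval (space_of Y) (letter_map Y l)"
    using continuous_map_letter_map[of "space_of Y" id Y l] continuous_map_edge_map[OF Y e]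
    by (simp add: eta_contract_eq)
  have contH: "continuous_map (prod_topology unit_interval (space_of Y)) (space_of Y) H"
  proof (rule continuous_map_homotopy_space_of[OF Y])
    show "continuous_map unit_interval (space_of Y) (\<lambda>t. H (t, Vert w))" if "w \<in> verts Y" for w
    proof (cases "w = v")
      case True
      have "continuous_map unit_interval unit_interval (\<lambda>t. 1 - t)"
        by (auto intro!: continuous_intros)
      from continuous_map_compose[OF this contl] show ?thesis
        by (simp add: o_def H_def True)
    qed (use that in \<open>auto simp: H_def topspace_space_of[OF Y] intro: points_intros\<close>)
  next
    fix e1 assume e1: "e1 \<in> edges Y"
    show "continuous_map (prod_topology unit_interval unit_interval) (space_of Y) (\<lambda>(t, s). H (t, edge_map Y e1 s))"
    proof (cases "e1 = ?e")
      case True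
      have c: "continuous_on ({0..1} \<times> {0..1}) (\<lambda>(t, s). (1 - t) * ?o s)"
        by (cases "snd l") (auto simp: case_prod_beta' intro!: continuous_intros)
      have "(1 - t) * ?o s \<in> {0..1}" if "t \<in> {0..1}" "s \<in> {0..1}" for t s :: real
        using that by (auto intro!: mult_nonneg_nonneg mult_le_one)
      then have "continuous_map (prod_topology unit_interval unit_interval) unit_interval (\<lambda>(t, s). (1 - t) * ?o s)"
        using c by (auto simp: subtopology_Times[symmetric] euclidean_product_topology)
      from continuous_map_compose[OF this contl]
      show ?thesis
        by (rule continuous_map_eq) (auto simp: True H_edge)
    next
      case False
      have "continuous_map (prod_topology unit_interval unit_interval) (space_of Y) (edge_map Y e1 \<circ> snd)"
        by (intro continuous_map_compose[OF continuous_map_snd] continuous_map_edge_map[OF Y e1])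
      then show ?thesis
        by (rule continuous_map_eq) (auto simp: H_edge'[OF e1 False])
    qed
  next
    fix c assume c: "c \<in> faces Y"
    have "continuous_map (prod_topology unit_interval unit_disc) (space_of Y) (face_map Y c \<circ> snd)"
      by (intro continuous_map_compose[OF continuous_map_snd] continuous_map_face_map[OF Y c])
    then show "continuous_map (prod_topology unit_interval unit_disc) (space_of Y) (\<lambda>(t, s). H (t, face_map Y c s))"
      by (rule continuous_map_eq) (auto simp: H_face[OF c])
  qed
  have u: "Vert (letter_start Y l) \<in> points ?Y'"
    using Y e ls by (auto simp: letter_start_def is_two_complex_def sel intro!: points_intros split: if_splits)
  show ?thesis
  proof (rule deforms_intoI[OF Y _ contH])
    show "continuous_map (space_of ?Y') (space_of Y) id"
      by (rule continuous_map_subcomplex[OF Y Y']) (auto simp: sel)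
    show "H (0, q) = q" if "q \<in> points Y" for q
      using that
    proof (cases rule: points_cases)
      case (Vert w)
      then show ?thesis using le by (auto simp: H_def letter_map_1)
    next
      case (EdgePt e' s)
      then show ?thesis using em_l[of s] by (auto simp: H_def edge_map_def)
    qed (auto simp: H_def)
    show "continuous_map (space_of Y) (space_of ?Y') (\<lambda>q. H (1, q))"
    proof (rule continuous_map_space_of[OF Y])
      show "H (1, Vert w) \<in> topspace (space_of ?Y')" if "w \<in> verts Y" for w
        using that u by (auto simp: H_def topspace_space_of[OF Y'] sel letter_map_0 intro!: points_intros)
    next
      fix e1 assume e1: "e1 \<in> edges Y"
      show "continuous_map unit_interval (space_of ?Y') (\<lambda>t. H (1, edge_map Y e1 t))"
      proof (cases "e1 = ?e")
        case True
        then show ?thesis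
          using u by (simp add: H_edge letter_map_0 topspace_space_of[OF Y'])
      next
        case False
        then show ?thesis
          using continuous_map_edge_map[OF Y', of e1] e1 by (simp add: H_edge' sel em eta_contract_eq)
      qed
    next
      fix c assume c: "c \<in> faces Y"
      have "continuous_map unit_disc (space_of ?Y') (face_map Y c)"
        using continuous_map_face_map[OF Y', of c] c by (simp add: sel fm)
      then show "continuous_map unit_disc (space_of ?Y') (\<lambda>z. H (1, face_map Y c z))"
        by (rule continuous_map_eq) (auto simp: H_face[OF c])
    qed
  qed
qed

section \<open>Attaching a disc along a homotopy equivalence\<close>

definition remove_face :: "('v, 'e, 'f) two_complex \<Rightarrow> 'f \<Rightarrow> ('v, 'e, 'f) two_complex" where
  "remove_face Y c = Y\<lparr>faces := faces Y - {c}\<rparr>"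

lemma remove_face_sel [simp]:
  "verts (remove_face Y c) = verts Y" "edges (remove_face Y c) = edges Y"
  "faces (remove_face Y c) = faces Y - {c}" "src (remove_face Y c) = src Y"
  "tgt (remove_face Y c) = tgt Y" "bdry (remove_face Y c) = bdry Y"
  by (auto simp: remove_face_def)

lemma edge_map_remove_face [simp]: "edge_map (remove_face Y c) = edge_map Y"
  by (intro ext) (simp add: edge_map_def)

lemma face_map_remove_face [simp]: "face_map (remove_face Y c) = face_map Y"
  by (intro ext) (simp add: face_map_def word_map_def letter_map_def)

lemma is_two_complex_remove_face:
  assumes "is_two_complex Y"
  shows "is_two_complex (remove_face Y c)"
proof -
  have "letter_start (remove_face Y c) = letter_start Y" "letter_end (remove_face Y c) = letter_end Y"
    by (auto simp: letter_start_def letter_end_def fun_eq_iff)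
  then show ?thesis
    using assms by (auto simp: is_two_complex_def closed_edge_path_def)
qed

text \<open>Changes \<open>g\<close> on the open cell \<open>c\<close> only; as the boundary of
  \<open>c\<close> lies in the skeleton, continuity reduces to agreement of \<open>d\<close> with
  \<open>g\<close> there.\<close>

definition glue_face :: "'f \<Rightarrow> (complex \<Rightarrow> 'a) \<Rightarrow> (('v, 'e, 'f) point \<Rightarrow> 'a) \<Rightarrow> ('v, 'e, 'f) point \<Rightarrow> 'a" where
  "glue_face c d g q = (case q of FacePt c' z \<Rightarrow> if c' = c then d z else g q | _ \<Rightarrow> g q)"

lemma glue_face_simps [simp]:
  "glue_face c d g (Vert v) = g (Vert v)"
  "glue_face c d g (edge_map Y e t) = g (edge_map Y e t)"
  by (auto simp: glue_face_def edge_map_def)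

lemma glue_face_same:
  assumes "\<And>u. cmod u = 1 \<Longrightarrow> d u = g (face_map Y c u)" "cmod z \<le> 1"
  shows "glue_face c d g (face_map Y c z) = d z"
proof (cases "cmod z < 1")
  case False
  then have "in_skeleton (face_map Y c z)"
    by (simp add: in_skeleton_face_map)
  then show ?thesis
    using assms False by (auto simp: glue_face_def split: point.splits)
qed (auto simp: glue_face_def face_map_interior)

lemma glue_face_other: "c' \<noteq> c \<Longrightarrow> glue_face c d g (face_map Y c' z) = g (face_map Y c' z)"
proof (cases "cmod z < 1")
  case False
  then have "in_skeleton (face_map Y c' z)"
    by (simp add: in_skeleton_face_map)
  then show ?thesis
    by (auto simp: glue_face_def split: point.splits)
qed (auto simp: glue_face_def face_map_interior)

lemma continuous_map_glue_face:
  assumes Y: "is_two_complex Y"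
    and g: "continuous_map (space_of (remove_face Y c)) T g"
    and d: "continuous_map unit_disc T d"
    and eq: "\<And>u. cmod u = 1 \<Longrightarrow> d u = g (face_map Y c u)"
  shows "continuous_map (space_of Y) T (glue_face c d g)"
proof (rule continuous_map_space_of[OF Y])
  note Y' = is_two_complex_remove_face[OF Y, of c]
  show "glue_face c d g (Vert v) \<in> topspace T" if "v \<in> verts Y" for v
    using that continuous_map_funspace[OF g] by (auto simp: topspace_space_of[OF Y'] intro!: points_intros)
  show "continuous_map unit_interval T (\<lambda>t. glue_face c d g (edge_map Y e t))" if "e \<in> edges Y" for e
    using continuous_map_compose[OF continuous_map_edge_map[OF Y', of e] g] that by (simp add: o_def)
  show "continuous_map unit_disc T (\<lambda>z. glue_face c d g (face_map Y c' z))" if c': "c' \<in> faces Y" for c'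
  proof (cases "c' = c")
    case True
    show ?thesis
      by (rule continuous_map_eq[OF d]) (auto simp: True glue_face_same[where d=d and g=g, OF eq])
  next
    case False
    show ?thesis
      using continuous_map_compose[OF continuous_map_face_map[OF Y', of c'] g] c' False
      by (simp add: o_def glue_face_other)
  qed
qed

lemma homotopy_glue_face:
  assumes Y: "is_two_complex Y"
    and g: "continuous_map (prod_topology unit_interval (space_of (remove_face Y c))) T (\<lambda>(t, q). g t q)"
    and d: "continuous_map (prod_topology unit_interval unit_disc) T (\<lambda>(t, z). d t z)"
    and eq: "\<And>t u. 0 \<le> t \<Longrightarrow> t \<le> 1 \<Longrightarrow> cmod u = 1 \<Longrightarrow> d t u = g t (face_map Y c u)"
  shows "homotopic_with (\<lambda>_. True) (space_of Y) T (glue_face c (d 0) (g 0)) (glue_face c (d 1) (g 1))"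
  unfolding homotopic_with_def
proof (intro exI[of _ "\<lambda>(t, q). glue_face c (d t) (g t) q"] conjI)
  note Y' = is_two_complex_remove_face[OF Y, of c]
  let ?H = "\<lambda>(t, q). glue_face c (d t) (g t) q"
  show "continuous_map (prod_topology unit_interval (space_of Y)) T ?H"
  proof (rule continuous_map_homotopy_space_of[OF Y])
    fix v assume v: "v \<in> verts Y"
    have "continuous_map unit_interval (prod_topology unit_interval (space_of (remove_face Y c))) (\<lambda>t. (t, Vert v))"
      using v by (auto simp: continuous_map_paired topspace_space_of[OF Y'] intro!: points_intros)
    from continuous_map_compose[OF this g]
    show "continuous_map unit_interval T (\<lambda>t. ?H (t, Vert v))"
      by (simp add: o_def)
  next
    fix e assume e: "e \<in> edges Y"
    have "continuous_map unit_interval (space_of (remove_face Y c)) (edge_map Y e)"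
      using continuous_map_edge_map[OF Y', of e] e by simp
    from continuous_map_compose[OF continuous_map_prod_right[OF this] g]
    show "continuous_map (prod_topology unit_interval unit_interval) T (\<lambda>(t, s). ?H (t, edge_map Y e s))"
      by (simp add: o_def case_prod_beta')
  next
    fix c' assume c': "c' \<in> faces Y"
    show "continuous_map (prod_topology unit_interval unit_disc) T (\<lambda>(t, z). ?H (t, face_map Y c' z))"
    proof (cases "c' = c")
      case True
      show ?thesis
        by (rule continuous_map_eq[OF d]) (auto simp: True intro!: glue_face_same[symmetric] eq)
    next
      case False
      have "continuous_map unit_disc (space_of (remove_face Y c)) (face_map Y c')"
        using continuous_map_face_map[OF Y', of c'] c' False by simp
      from continuous_map_compose[OF continuous_map_prod_right[OF this] g]
      show ?thesis
        by (simp add: o_def case_prod_beta' glue_face_other[OF False])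
    qed
  qed
qed auto

text \<open>The map \<open>B\<close> of the proof prolongs the attached disc to radius 3: on the first collar the boundary loop \<open>\<phi>\<close>
  is moved by \<open>K\<close> to \<open>j \<circ> \<rho> \<circ> \<phi>\<close>, on the second one \<open>L\<close> moves that loop back to \<open>j\<close>. Up to reparametrising
  radii the identity is then homotopic to \<open>\<Theta> \<circ> \<Psi>\<close>, which factors through the disc; the passage along \<open>L\<close>
  and back cancels, so no obstruction in \<open>\<pi>\<^sub>2\<close> arises.\<close>

lemma contractible_attach_disc:
  assumes Y: "is_two_complex Y" and c: "c \<in> faces Y"
    and \<rho>: "continuous_map (space_of (remove_face Y c)) unit_circle \<rho>"
    and j: "continuous_map unit_circle (space_of Y) j"
    and K: "homotopic_with (\<lambda>_. True) (space_of (remove_face Y c)) (space_of Y) id (j \<circ> \<rho>)"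
    and L: "homotopic_with (\<lambda>_. True) unit_circle unit_circle id (\<lambda>z. \<rho> (face_map Y c z))"
  shows "contractible_space (space_of Y)"
proof -
  let ?Y' = "remove_face Y c" and ?\<phi> = "face_map Y c"
  note Y' = is_two_complex_remove_face[OF Y, of c]
  obtain K where K: "continuous_map (prod_topology unit_interval (space_of ?Y')) (space_of Y) K"
    "\<And>x. K (0, x) = x" "\<And>x. K (1, x) = j (\<rho> x)"
    using assms(5) by (auto simp: homotopic_with_def)
  obtain L where L: "continuous_map (prod_topology unit_interval unit_circle) unit_circle L"
    "\<And>x. L (0, x) = x" "\<And>x. L (1, x) = \<rho> (?\<phi> x)"
    using assms(6) by (auto simp: homotopic_with_def)
  have \<phi>: "continuous_map unit_circle (space_of ?Y') ?\<phi>"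
  proof -
    have "continuous_map unit_circle (space_of ?Y') (\<lambda>z. id (face_map Y c z))"
      using continuous_map_edge_map[OF Y'] closed_bdry[OF Y c]
      by (intro continuous_map_face_boundary[OF Y c]) (auto simp: closed_edge_path_def eta_contract_eq)
    then show ?thesis by (simp add: eta_contract_eq)
  qed
  define B where "B z = (if cmod z \<le> 1 then ?\<phi> z else
    if cmod z \<le> 2 then K (cmod z - 1, ?\<phi> (sgn z)) else j (L (3 - cmod z, sgn z)))" for z
  have contsgn: "continuous_map (top_of_set {z \<in> cball 0 3. a \<le> cmod z}) unit_circle sgn" if "a > 0" for a
    using that by (auto simp: norm_sgn intro!: continuous_on_sgn continuous_intros)
  have sgn_eq: "sgn u = u" if "cmod u = 1" for u
    using that by (simp add: sgn_div_norm)
  have B2: "continuous_map (top_of_set {z \<in> cball 0 3. 1 \<le> cmod z \<and> cmod z \<le> 2}) (space_of Y) (\<lambda>z. K (cmod z - 1, ?\<phi> (sgn z)))"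
    (is "continuous_map ?T _ _")
  proof -
    have "continuous_map ?T unit_circle sgn"
      by (rule continuous_map_from_subtopology_mono[OF contsgn[of 1]]) auto
    then have "continuous_map ?T (prod_topology unit_interval (space_of ?Y')) (\<lambda>z. (cmod z - 1, ?\<phi> (sgn z)))"
      using continuous_map_compose[OF _ \<phi>, of ?T sgn]
      by (intro continuous_map_pairedI) (auto simp: o_def intro!: continuous_intros)
    from continuous_map_compose[OF this K(1)] show ?thesis
      by (simp add: o_def)
  qed
  have B3: "continuous_map (top_of_set {z \<in> cball 0 3. 2 \<le> cmod z}) (space_of Y) (\<lambda>z. j (L (3 - cmod z, sgn z)))"
    (is "continuous_map ?T _ _")
  proof -
    have "continuous_map ?T (prod_topology unit_interval unit_circle) (\<lambda>z. (3 - cmod z, sgn z))"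
      using contsgn[of 2] by (intro continuous_map_pairedI) (auto intro!: continuous_intros)
    from continuous_map_compose[OF continuous_map_compose[OF this L(1)] j] show ?thesis
      by (simp add: o_def)
  qed
  have contB: "continuous_map (top_of_set (cball 0 3)) (space_of Y) B"
    unfolding B_def
  proof (rule continuous_map_cases_le)
    have "cball 0 3 \<inter> {z. cmod z \<le> 3 \<and> cmod z \<le> 1} = cball 0 1"
      by auto
    then show "continuous_map (subtopology (top_of_set (cball 0 3)) {z \<in> topspace (top_of_set (cball 0 3)). cmod z \<le> 1}) (space_of Y) ?\<phi>"
      using continuous_map_face_map[OF Y c] by (simp add: subtopology_subtopology)
    have sub: "subtopology (top_of_set (cball 0 3)) {z \<in> topspace (top_of_set (cball 0 3)). 1 \<le> cmod z} =
        top_of_set {z \<in> cball 0 3. 1 \<le> cmod z}"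
      by (auto simp: subtopology_subtopology intro!: arg_cong[of _ _ top_of_set])
    show "continuous_map (subtopology (top_of_set (cball 0 3)) {z \<in> topspace (top_of_set (cball 0 3)). 1 \<le> cmod z}) (space_of Y)
       (\<lambda>z. if cmod z \<le> 2 then K (cmod z - 1, ?\<phi> (sgn z)) else j (L (3 - cmod z, sgn z)))"
      unfolding sub
    proof (rule continuous_map_cases_le)
      have "{z \<in> cball 0 3. 1 \<le> cmod z} \<inter> {z \<in> topspace (top_of_set {z \<in> cball 0 3. 1 \<le> cmod z}). cmod z \<le> 2} =
          {z \<in> cball 0 3. 1 \<le> cmod z \<and> cmod z \<le> 2}"
        by auto
      then show "continuous_map (subtopology (top_of_set {z \<in> cball 0 3. 1 \<le> cmod z}) {z \<in> topspace (top_of_set {z \<in> cball 0 3. 1 \<le> cmod z}). cmod z \<le> 2})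
          (space_of Y) (\<lambda>z. K (cmod z - 1, ?\<phi> (sgn z)))"
        using B2 by (simp only: subtopology_subtopology)
      have "{z \<in> cball 0 3. 1 \<le> cmod z} \<inter> {z \<in> topspace (top_of_set {z \<in> cball 0 3. 1 \<le> cmod z}). 2 \<le> cmod z} =
          {z \<in> cball 0 3. 2 \<le> cmod z}"
        by auto
      then show "continuous_map (subtopology (top_of_set {z \<in> cball 0 3. 1 \<le> cmod z}) {z \<in> topspace (top_of_set {z \<in> cball 0 3. 1 \<le> cmod z}). 2 \<le> cmod z})
          (space_of Y) (\<lambda>z. j (L (3 - cmod z, sgn z)))"
        using B3 by (simp only: subtopology_subtopology)
    qed (auto simp: K(3) L(3) intro!: continuous_intros)
  qed (auto simp: K(2) sgn_eq intro!: continuous_intros)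
  \<comment> \<open>\<open>B\<close> in polar coordinates. At radius 2 the formulas with
    \<open>K\<close> and with \<open>L\<close> both give
    \<open>j (\<rho> (?\<phi> u))\<close>.\<close>
  have B_scale: "B (of_real r * u) = (if r \<le> 1 then ?\<phi> (of_real r * u) else
      if r \<le> 2 then K (r - 1, ?\<phi> u) else j (L (3 - r, u)))" if u: "cmod u = 1" and r: "0 \<le> r" for r u
  proof -
    have "cmod (of_real r * u) = r"
      using that by (simp add: norm_mult)
    moreover have "sgn (of_real r * u) = u" if "r > 1"
      using that u by (simp add: sgn_mult sgn_of_real sgn_eq)
    ultimately show ?thesis
      unfolding B_def by simp
  qed
  have scale: "continuous_map (prod_topology unit_interval unit_disc) (space_of Y) (\<lambda>(t, z). B (of_real (f t z) * z))"
    if "continuous_on ({0..1} \<times> cball 0 1) (\<lambda>(t, z). f t z)"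
      and "\<And>t z. 0 \<le> t \<Longrightarrow> t \<le> 1 \<Longrightarrow> cmod z \<le> 1 \<Longrightarrow> 0 \<le> f t z \<and> f t z * cmod z \<le> 3" for f
  proof -
    have "continuous_on ({0..1} \<times> cball 0 1) (\<lambda>(t, z). of_real (f t z) * z)"
      using that(1) unfolding case_prod_beta' by (intro continuous_intros)
    moreover have "(\<lambda>(t, z). of_real (f t z) * z) ` ({0..1} \<times> cball 0 1) \<subseteq> cball 0 3"
      using that(2) by (auto simp: norm_mult)
    ultimately have "continuous_map (prod_topology unit_interval unit_disc) (top_of_set (cball 0 3)) (\<lambda>(t, z). of_real (f t z) * z)"
      by (auto simp: subtopology_Times[symmetric] euclidean_product_topology simp del: mem_cball)
    from continuous_map_compose[OF this contB] show ?thesis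
      by (simp add: o_def case_prod_beta')
  qed
  \<comment> \<open>While \<open>K\<close> moves the rest of the complex, the disc is stretched from
    radius 1 to radius 2, so that its boundary follows \<open>K\<close>.\<close>
  define d1 where "d1 t z = B (of_real (1 + t) * z)" for t z
  have contd1: "continuous_map (prod_topology unit_interval unit_disc) (space_of Y) (\<lambda>(t, z). d1 t z)"
    unfolding d1_def
  proof (rule scale)
    show "0 \<le> 1 + t \<and> (1 + t) * cmod z \<le> 3" if "0 \<le> t" "t \<le> 1" "cmod z \<le> 1" for t z
      using mult_mono[of "1 + t" 2 "cmod z" 1] that by auto
  qed (auto simp: case_prod_beta' intro!: continuous_intros)
  \<comment> \<open>At time 1 of \<open>d2\<close> the radius \<open>\<kappa> z * cmod z\<close>
    grows as \<open>6 * cmod z\<close> up to 3, reached at \<open>cmod z = 1/2\<close>, and then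
    falls as \<open>4 - 2 * cmod z\<close> to 2. On the circle \<open>\<kappa>\<close> is 2, so the
    boundary values do not move during \<open>d2\<close>.\<close>
  define \<kappa> where "\<kappa> z = 4 / max (1/2) (cmod z) - 2" for z
  have \<kappa>: "\<kappa> z * cmod z \<le> 3" "2 \<le> \<kappa> z" if "cmod z \<le> 1" for z
  proof -
    show "2 \<le> \<kappa> z"
      using that divide_left_mono[of "max (1/2) (cmod z)" 1 4] by (simp add: \<kappa>_def)
    show "\<kappa> z * cmod z \<le> 3"
      by (auto simp: \<kappa>_def max_def left_diff_distrib)
  qed
  define d2 where "d2 t z = B (of_real ((1 - t) * 2 + t * \<kappa> z) * z)" for t z
  have contd2: "continuous_map (prod_topology unit_interval unit_disc) (space_of Y) (\<lambda>(t, z). d2 t z)"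
    unfolding d2_def
  proof (rule scale)
    show "continuous_on ({0..1} \<times> cball 0 1) (\<lambda>(t, z). (1 - t) * 2 + t * \<kappa> z)"
      unfolding \<kappa>_def case_prod_beta' by (intro continuous_intros) auto
    show "0 \<le> (1 - t) * 2 + t * \<kappa> z \<and> ((1 - t) * 2 + t * \<kappa> z) * cmod z \<le> 3" if "0 \<le> t" "t \<le> 1" "cmod z \<le> 1" for t z
    proof
      show "0 \<le> (1 - t) * 2 + t * \<kappa> z"
        using that \<kappa>(2)[of z] by (intro add_nonneg_nonneg mult_nonneg_nonneg) auto
      have "((1 - t) * 2 + t * \<kappa> z) * cmod z = (1 - t) * (2 * cmod z) + t * (\<kappa> z * cmod z)"
        by (simp add: algebra_simps)
      also have "\<dots> \<le> (1 - t) * 3 + t * 3"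
        using that \<kappa>(1)[of z] by (intro add_mono mult_left_mono) auto
      finally show "((1 - t) * 2 + t * \<kappa> z) * cmod z \<le> 3"
        by simp
    qed
  qed
  have hom1: "homotopic_with (\<lambda>_. True) (space_of Y) (space_of Y)
      (glue_face c (d1 0) (\<lambda>q. K (0, q))) (glue_face c (d1 1) (\<lambda>q. K (1, q)))"
  proof (rule homotopy_glue_face[OF Y _ contd1])
    show "d1 t u = K (t, ?\<phi> u)" if "0 \<le> t" "t \<le> 1" "cmod u = 1" for t u
    proof (cases "t = 0")
      case True
      then show ?thesis using B_scale[OF that(3), of 1] by (simp add: d1_def K(2))
    next
      case False
      then show ?thesis using B_scale[OF that(3), of "1 + t"] that by (simp add: d1_def del: of_real_add)
    qed
  qed (use K(1) in \<open>simp add: case_prod_beta'\<close>)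
  have hom2: "homotopic_with (\<lambda>_. True) (space_of Y) (space_of Y)
      (glue_face c (d2 0) (\<lambda>q. j (\<rho> q))) (glue_face c (d2 1) (\<lambda>q. j (\<rho> q)))"
  proof (rule homotopy_glue_face[OF Y _ contd2])
    show "continuous_map (prod_topology unit_interval (space_of ?Y')) (space_of Y) (\<lambda>(t, q). j (\<rho> q))"
      using continuous_map_compose[OF continuous_map_snd continuous_map_compose[OF \<rho> j]]
      by (simp add: o_def case_prod_beta')
    show "d2 t u = j (\<rho> (?\<phi> u))" if "cmod u = 1" for t u
    proof -
      have "(1 - t) * 2 + t * \<kappa> u = 2"
        using that unfolding \<kappa>_def by (simp add: algebra_simps)
      then show ?thesis
        using B_scale[OF that, of 2] by (simp only: d2_def) (simp add: K(3))
    qed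
  qed
  \<comment> \<open>The inner half disc is doubled; the outer collar carries \<open>L\<close> from
    the identity to \<open>\<rho> \<circ> ?\<phi>\<close>, so \<open>\<psi>\<close> fits
    \<open>\<rho>\<close> on the boundary. Followed by \<open>\<Theta>\<close>, it retraces
    \<open>d2 1\<close>.\<close>
  define \<psi> where "\<psi> z = (if cmod z \<le> 1/2 then 2 * z else L (2 * cmod z - 1, sgn z))" for z
  define \<Psi> where "\<Psi> = glue_face c \<psi> \<rho>"
  define \<Theta> where "\<Theta> z = B (3 * z)" for z
  have cont\<psi>: "continuous_map unit_disc unit_disc \<psi>"
    unfolding \<psi>_def
  proof (rule continuous_map_cases_le)
    show "continuous_map (subtopology unit_disc {z \<in> topspace unit_disc. cmod z \<le> 1/2}) unit_disc (\<lambda>z. 2 * z)"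
      by (auto simp: subtopology_subtopology norm_mult intro!: continuous_intros)
    have sub: "subtopology unit_disc {z \<in> topspace unit_disc. 1/2 \<le> cmod z} = top_of_set {z \<in> cball 0 1. 1/2 \<le> cmod z}"
      by (auto simp: subtopology_subtopology intro!: arg_cong[of _ _ top_of_set])
    have "continuous_map (top_of_set {z \<in> cball 0 1. 1/2 \<le> cmod z}) unit_circle sgn"
      by (rule continuous_map_from_subtopology_mono[OF contsgn[of "1/2"]]) auto
    then have "continuous_map (top_of_set {z \<in> cball 0 1. 1/2 \<le> cmod z}) (prod_topology unit_interval unit_circle) (\<lambda>z. (2 * cmod z - 1, sgn z))"
      by (intro continuous_map_pairedI) (auto intro!: continuous_intros)
    from continuous_map_compose[OF this L(1)]
    have "continuous_map (top_of_set {z \<in> cball 0 1. 1/2 \<le> cmod z}) unit_circle (\<lambda>z. L (2 * cmod z - 1, sgn z))"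
      by (simp add: o_def)
    then show "continuous_map (subtopology unit_disc {z \<in> topspace unit_disc. 1/2 \<le> cmod z}) unit_disc (\<lambda>z. L (2 * cmod z - 1, sgn z))"
      unfolding sub by (auto simp: Pi_iff)
    show "2 * z = L (2 * cmod z - 1, sgn z)" if "cmod z = 1/2" for z
    proof -
      have "2 * cmod z - 1 = 0" "sgn z = 2 * z"
        unfolding sgn_div_norm that by (simp_all add: scaleR_conv_of_real)
      then show ?thesis by (simp add: L(2))
    qed
  qed (auto intro!: continuous_intros)
  have cont\<Psi>: "continuous_map (space_of Y) unit_disc \<Psi>"
    unfolding \<Psi>_def
  proof (rule continuous_map_glue_face[OF Y _ cont\<psi>])
    show "continuous_map (space_of ?Y') unit_disc \<rho>"
      using \<rho> by (force simp: continuous_map_in_subtopology Pi_iff)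
  qed (auto simp: \<psi>_def L(3) sgn_eq)
  have cont\<Theta>: "continuous_map unit_disc (space_of Y) \<Theta>"
  proof -
    have "continuous_map unit_disc (top_of_set (cball 0 3)) (\<lambda>z. 3 * z)"
      by (auto simp: norm_mult intro!: continuous_intros)
    from continuous_map_compose[OF this contB] show ?thesis
      by (simp add: o_def \<Theta>_def[abs_def])
  qed
  obtain a where a: "homotopic_with (\<lambda>_. True) (space_of Y) (space_of Y) (\<Theta> \<circ> \<Psi>) (\<lambda>x. a)"
    using nullhomotopic_through_contractible_space[OF cont\<Psi> cont\<Theta>]
    by (auto simp: convex_imp_contractible)
  have \<Theta>j: "\<Theta> u = j u" if "cmod u = 1" for u
    using B_scale[OF that, of 3] by (simp add: \<Theta>_def L(2))
  have \<Theta>\<psi>: "\<Theta> (\<psi> z) = d2 1 z" if "cmod z \<le> 1" for z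
  proof (cases "cmod z \<le> 1/2")
    case True
    then have "\<kappa> z = 6"
      by (simp add: \<kappa>_def max_absorb1)
    then show ?thesis
      using True by (simp add: \<Theta>_def \<psi>_def d2_def mult.assoc[symmetric])
  next
    case False
    have u: "cmod (sgn z) = 1"
      using False by (auto simp: norm_sgn)
    have k: "of_real (\<kappa> z) * z = of_real (4 - 2 * cmod z) * sgn z"
    proof -
      have "\<kappa> z = 4 / cmod z - 2" "cmod z \<noteq> 0"
        using False by (auto simp: \<kappa>_def max_def)
      then have "4 - 2 * cmod z = \<kappa> z * cmod z"
        by (simp add: field_simps)
      moreover have "z = of_real (cmod z) * sgn z"
        by (cases "z = 0") (simp_all add: sgn_div_norm scaleR_conv_of_real)
      ultimately show ?thesis
        by (metis mult.assoc of_real_mult)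
    qed
    have "L (2 * cmod z - 1, sgn z) \<in> topspace unit_circle"
      using continuous_map_funspace[OF L(1)] that False u by (auto simp: Pi_iff)
    then have "\<Theta> (\<psi> z) = j (L (2 * cmod z - 1, sgn z))"
      using False by (simp add: \<psi>_def \<Theta>j)
    moreover have "d2 1 z = B (of_real (4 - 2 * cmod z) * sgn z)"
      using k by (simp add: d2_def)
    moreover have "\<dots> = j (L (2 * cmod z - 1, sgn z))"
      using B_scale[OF u, of "4 - 2 * cmod z"] that by (cases "cmod z = 1") (auto simp: K(3) L(3) sgn_eq)
    ultimately show ?thesis by simp
  qed
  have "homotopic_with (\<lambda>_. True) (space_of Y) (space_of Y) id (glue_face c (d1 1) (\<lambda>q. K (1, q)))"
  proof (rule homotopic_with_eq[OF hom1])
    show "id q = glue_face c (d1 0) (\<lambda>q. K (0, q)) q" if "q \<in> topspace (space_of Y)" for q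
    proof -
      have "q \<in> points Y" using that by (simp add: topspace_space_of[OF Y])
      then show ?thesis
        by (cases rule: points_cases) (auto simp: glue_face_def d1_def K(2) B_def face_map_interior)
    qed
  qed auto
  moreover have "homotopic_with (\<lambda>_. True) (space_of Y) (space_of Y) (glue_face c (d1 1) (\<lambda>q. K (1, q))) (\<Theta> \<circ> \<Psi>)"
  proof (rule homotopic_with_eq[OF hom2])
    fix q assume "q \<in> topspace (space_of Y)"
    then have q: "q \<in> points Y" by (simp add: topspace_space_of[OF Y])
    show "glue_face c (d1 1) (\<lambda>q. K (1, q)) q = glue_face c (d2 0) (\<lambda>q. j (\<rho> q)) q"
      by (simp add: glue_face_def K(3) d1_def d2_def split: point.splits)
    have \<rho>q: "\<Theta> (\<rho> q) = j (\<rho> q)" if "q \<in> points ?Y'"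
      using continuous_map_funspace[OF \<rho>] that by (intro \<Theta>j) (auto simp: topspace_space_of[OF Y'] Pi_iff)
    show "(\<Theta> \<circ> \<Psi>) q = glue_face c (d2 1) (\<lambda>q. j (\<rho> q)) q"
      using q
    proof (cases rule: points_cases)
      case (Vert v)
      then show ?thesis using \<rho>q by (simp add: \<Psi>_def glue_face_def points_intros)
    next
      case (EdgePt e t)
      then show ?thesis using \<rho>q by (simp add: \<Psi>_def glue_face_def points_intros)
    next
      case (FacePt c' z)
      then show ?thesis
        using \<rho>q \<Theta>\<psi>[of z] by (cases "c' = c") (simp_all add: \<Psi>_def glue_face_def points_intros)
    qed
  qed auto
  ultimately show ?thesis
    unfolding contractible_space_def using a homotopic_with_trans by blast
qed

section \<open>The dunce hats\<close>

text \<open>The covering of the circle by the line in which \<open>n\<close> units make one turn. It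
  runs clockwise because along the boundary of the last square the position drops by
  \<open>n\<close>, and this must become degree 1 rather than -1.\<close>

definition height :: "nat \<Rightarrow> real \<Rightarrow> complex" where
  "height n h = cis (- 2 * pi * h / real n)"

lemma norm_height [simp]: "cmod (height n h) = 1"
  by (simp add: height_def)

lemma height_add: "height n (g + h) = height n g * height n h"
  by (simp add: height_def cis_mult algebra_simps add_divide_distrib diff_divide_distrib)

lemma height_period: "n > 0 \<Longrightarrow> height n (h + real (k * n)) = height n h"
proof -
  assume "n > 0"
  then have "height n (real (k * n)) = cis (2 * pi * (- real k))"
    by (simp add: height_def mult.assoc)
  also have "\<dots> = 1"
    by (rule cis_multiple_2pi) simp
  finally show ?thesis
    by (simp add: height_add)
qed

lemma height_mod: "n > 0 \<Longrightarrow> i mod n = j mod n \<Longrightarrow> height n (real i + s) = height n (real j + s)"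
proof -
  assume n: "n > 0" and ij: "i mod n = j mod n"
  have *: "height n (real i + s) = height n (real (i mod n) + s)" for i
  proof -
    have "real i + s = (real (i mod n) + s) + real (i div n * n)"
      by (simp flip: of_nat_add of_nat_mult)
    then show ?thesis using height_period[OF n] by metis
  qed
  show ?thesis using *[of i] *[of j] ij by simp
qed

lemma continuous_on_height: "continuous_on S f \<Longrightarrow> continuous_on S (\<lambda>x. height n (f x))"
  unfolding height_def by (cases "n = 0") (auto intro!: continuous_intros)

text \<open>A piecewise linear lift \<open>h\<close> of a loop through the covering \<open>height n\<close> of the circle that drops
  by \<open>d n\<close> shows that the loop has degree \<open>d\<close>.\<close>

lemma lift_word:
  assumes w: "closed_edge_path Y w" and n: "n > 0"
    and F: "\<And>i t. i < length w \<Longrightarrow> 0 \<le> t \<Longrightarrow> t \<le> 1 \<Longrightarrow>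
      F (letter_map Y (w ! i) t) = height n ((1 - t) * h i + t * h (Suc i))"
    and h: "h (length w) = h 0 - real (d * n)"
  obtains l where "continuous_on (sphere 0 1) l"
    "\<And>z. cmod z = 1 \<Longrightarrow> F (word_map Y w (circ_pos (length w) z)) = height n (l z) * z ^ d"
proof -
  let ?m = "length w"
  have m: "?m > 0"
    using w by (auto simp: closed_edge_path_def)
  \<comment> \<open>The linear term compensates the drop of the lift, so that \<open>G\<close> takes
    equal values at both ends and descends to the circle; the factor \<open>z ^ d\<close> cancels
    the term again.\<close>
  define G where "G x = (1 - frac x) * h (nat \<lfloor>x\<rfloor>) + frac x * h (Suc (nat \<lfloor>x\<rfloor>)) + real (d * n) * x / real ?m" for x
  have Gi: "G (real i + t) = (1 - t) * h i + t * h (Suc i) + real (d * n) * (real i + t) / real ?m"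
    if "0 \<le> t" "t \<le> 1" for i t
  proof (cases "t = 1")
    case True
    have "\<lfloor>real i + 1\<rfloor> = int (Suc i)" by linarith
    then have "nat \<lfloor>real i + 1\<rfloor> = Suc i" "frac (real i + 1) = 0"
      by (simp_all only: frac_def)
    then have "G (real i + 1) = h (Suc i) + real (d * n) * (real i + 1) / real ?m"
      unfolding G_def by (simp only:) simp
    then show ?thesis by (simp add: True)
  next
    case False
    then have "\<lfloor>real i + t\<rfloor> = int i" using that by linarith
    then show ?thesis by (simp add: G_def frac_def)
  qed
  have "continuous_map (top_of_set {0..real ?m}) euclideanreal G"
  proof (rule continuous_map_piecewise[OF m])
    fix i
    have "continuous_on {real i..real i + 1} (\<lambda>x. (1 - (x - real i)) * h i + (x - real i) * h (Suc i) + real (d * n) * x / real ?m)"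
      using m by (intro continuous_intros) auto
    moreover have "(1 - (x - real i)) * h i + (x - real i) * h (Suc i) + real (d * n) * x / real ?m = G x"
      if "x \<in> {real i..real i + 1}" for x
      using Gi[of "x - real i" i] that by simp
    ultimately show "continuous_map (top_of_set {real i..real i + 1}) euclideanreal G"
      by (auto intro: continuous_on_eq)
  qed
  moreover have "G 0 = G (real ?m)"
    using Gi[of 0 0] Gi[of 0 ?m] h m by simp
  ultimately have "continuous_map unit_circle euclideanreal (\<lambda>z. G (circ_pos ?m z))"
    by (rule continuous_map_on_circle[OF m])
  then have cont: "continuous_on (sphere 0 1) (\<lambda>z. G (circ_pos ?m z))"
    by simp
  have "F (word_map Y w (circ_pos ?m z)) = height n (G (circ_pos ?m z)) * z ^ d" if z: "cmod z = 1" for z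
  proof -
    obtain i t where it: "i < ?m" "0 \<le> t" "t < 1" "z = circ_pt ?m (real i + t)"
      using circ_pt_surj[OF m z] by metis
    have pos: "circ_pos ?m z = real i + t"
      using it by (auto intro!: circ_pos_pt)
    have "F (word_map Y w (circ_pos ?m z)) = height n ((1 - t) * h i + t * h (Suc i))"
      using word_boundary[OF w it(1), of t] F[OF it(1), of t] it by simp
    moreover have "height n (G (circ_pos ?m z)) =
        height n ((1 - t) * h i + t * h (Suc i)) * height n (real (d * n) * (real i + t) / real ?m)"
      unfolding pos Gi[OF it(2) less_imp_le[OF it(3)]] by (simp only: height_add)
    moreover have "height n (real (d * n) * (real i + t) / real ?m) * z ^ d = 1"
    proof -
      have "- 2 * pi * (real (d * n) * (real i + t) / real ?m) / real n = - (real d * (2 * pi * (real i + t) / real ?m))"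
        using n m by (simp add: field_simps)
      then have "height n (real (d * n) * (real i + t) / real ?m) = cis (- (real d * (2 * pi * (real i + t) / real ?m)))"
        unfolding height_def by (simp only:)
      moreover have "z ^ d = cis (real d * (2 * pi * (real i + t) / real ?m))"
        unfolding it(4) circ_pt_def by (rule Complex.DeMoivre)
      ultimately show ?thesis
        by (simp only: cis_mult) simp
    qed
    ultimately show ?thesis
      by (metis mult.assoc mult.right_neutral)
  qed
  with cont that show ?thesis by blast
qed

text \<open>Position \<open>i\<close> is the source of \<open>x i\<close>. The edge
  \<open>e i\<close> leads from position \<open>2 * i\<close> to \<open>i\<close>, and
  \<open>c i\<close> fills the strip between \<open>e i\<close> and \<open>e (Suc i)\<close>, all
  modulo \<open>n\<close>. For \<open>n = 1\<close> this is the shape of the presentation complex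
  itself. A map \<open>\<rho>\<close> to the circle measures position; it extends over every 2-cell
  but one, whose boundary has degree 1.\<close>

lemma contractible_dunce:
  fixes Y :: "('v, 'e, 'f) two_complex" and x e :: "nat \<Rightarrow> 'e" and c :: "nat \<Rightarrow> 'f"
  assumes Y: "is_two_complex Y" and n: "n > 0"
    and verts: "verts Y = (\<lambda>i. src Y (x i)) ` UNIV"
    and edges: "edges Y = range x \<union> range e" and faces: "faces Y = insert d (range c)"
    and x: "\<And>i j. x i = x j \<longleftrightarrow> i mod n = j mod n" and e: "\<And>i j. e i = e j \<longleftrightarrow> i mod n = j mod n"
    and c: "\<And>i j. c i = c j \<longleftrightarrow> i mod n = j mod n"
    and srcx: "\<And>i j. src Y (x i) = src Y (x j) \<Longrightarrow> x i = x j"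
    and xe: "\<And>i j. x i \<noteq> e j" and cd: "\<And>i. c i \<noteq> d"
    and bc: "\<And>i. bdry Y (c i) =
      [(e i, True), (x i, True), (e (Suc i), False), (x (2 * i + 1), False), (x (2 * i), False)]"
    and bd: "bdry Y d = [(e 0, True)]"
  shows "contractible_space (space_of Y)"
proof -
  have all5: "(\<forall>i<length [a0, a1, a2, a3, a4]. P i) \<longleftrightarrow> P 0 \<and> P 1 \<and> P 2 \<and> P 3 \<and> P 4" for P and a0 a1 a2 a3 a4 :: "'e \<times> bool"
  proof -
    have num: "(2::nat) = Suc (Suc 0)" "(3::nat) = Suc (Suc (Suc 0))" "(4::nat) = Suc (Suc (Suc (Suc 0)))"
      by simp_all
    show ?thesis
      unfolding num by (simp add: All_less_Suc) blast
  qed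
  have clc: "closed_edge_path Y (bdry Y (c i))" for i
    using closed_bdry[OF Y] faces by auto
  have cld: "closed_edge_path Y (bdry Y d)"
    using closed_bdry[OF Y] faces by auto
  have adj: "tgt Y (e i) = src Y (x i)" "tgt Y (x i) = tgt Y (e (Suc i))" "src Y (e i) = src Y (x (2 * i))" for i
    using clc[of i] unfolding closed_edge_path_def bc all5
    by (simp_all add: letter_start_def letter_end_def)
  have tgtx: "tgt Y (x i) = src Y (x (Suc i))" for i
    using adj by metis
  \<comment> \<open>The square that is attached last. Its third side is \<open>e n = e 0\<close>:
    here the numbering wraps round.\<close>
  define c' where "c' = c (n - 1)"
  let ?Z = "remove_face Y c'"
  have Z: "is_two_complex ?Z"
    by (rule is_two_complex_remove_face[OF Y])
  have xrep: "\<exists>i<n. y = x i" if "y \<in> range x" for y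
    using that n x by (metis imageE mod_less_divisor mod_mod_trivial)
  have erep: "\<exists>i<n. y = e i" if "y \<in> range e" for y
    using that n e by (metis imageE mod_less_divisor mod_mod_trivial)

  \<comment> \<open>The position map on the skeleton and along boundary words\<close>
  define iv where "iv v = (SOME i. v = src Y (x i))" for v
  define ix where "ix y = (SOME i. y = x i)" for y
  \<comment> \<open>For vertices and horizontal edges any representative will do, as
    \<open>height n\<close> has period \<open>n\<close>. The slope along \<open>e i\<close> depends
    on it, so the one below \<open>n\<close> is fixed. In particular \<open>e 0\<close> gets
    constant position, and the map extends over the disc.\<close>
  define ie where "ie y = (SOME i. i < n \<and> y = e i)" for y
  have iv: "iv (src Y (x i)) mod n = i mod n" for i
  proof -
    have "src Y (x i) = src Y (x (iv (src Y (x i))))"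
      unfolding iv_def by (rule someI[of _ i]) simp
    then show ?thesis using srcx x by metis
  qed
  have ix: "ix (x i) mod n = i mod n" for i
  proof -
    have "x i = x (ix (x i))"
      unfolding ix_def by (rule someI[of _ i]) simp
    then show ?thesis using x by metis
  qed
  have ie: "ie (e i) = i" if "i < n" for i
  proof -
    have "ie (e i) < n \<and> e i = e (ie (e i))"
      unfolding ie_def by (rule someI[of _ i]) (use that in simp)
    then show ?thesis using e that by (metis mod_less)
  qed
  define \<rho>0 where "\<rho>0 q = (case q of Vert v \<Rightarrow> height n (real (iv v))
    | EdgePt y s \<Rightarrow> if y \<in> range x then height n (real (ix y) + s)
        else height n (2 * real (ie y) - real (ie y) * s)
    | FacePt f z \<Rightarrow> 1)" for q :: "('v, 'e, 'f) point"
  have \<rho>0_v: "\<rho>0 (Vert (src Y (x i))) = height n (real i)" for i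
    using height_mod[OF n iv[of i], of 0] by (simp add: \<rho>0_def)
  have \<rho>0_x: "\<rho>0 (edge_map Y (x i) s) = height n (real i + s)" for i s
    using \<rho>0_v[of i] \<rho>0_v[of "Suc i"] height_mod[OF n ix[of i], of s]
    by (simp add: edge_map_def tgtx) (simp add: \<rho>0_def add.commute)
  have \<rho>0_e: "\<rho>0 (edge_map Y (e i) s) = height n (2 * real i - real i * s)" if "i < n" for i s
  proof -
    have "e i \<notin> range x"
      using xe by (metis rangeE)
    then show ?thesis
      using \<rho>0_v[of "2 * i"] \<rho>0_v[of i] ie[OF that] by (simp add: edge_map_def adj) (simp add: \<rho>0_def)
  qed
  \<comment> \<open>Positions of the corners of \<open>c i\<close> for \<open>Suc i < n\<close>. The
    values at 0 and 5 agree, so the boundary has degree 0.\<close>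
  define H where "H i k = (if k = 0 then 2 * real i else if k = 1 then real i else if k = 2 then real i + 1
    else if k = 3 then 2 * real i + 2 else if k = 4 then 2 * real i + 1 else 2 * real i)" for i k :: nat
  have lift_c: "\<rho>0 (letter_map Y (bdry Y (c i) ! k) t) = height n ((1 - t) * H i k + t * H i (Suc k))"
    if "Suc i < n" "k < length (bdry Y (c i))" for i k t
  proof -
    have "\<forall>k<length (bdry Y (c i)). \<rho>0 (letter_map Y (bdry Y (c i) ! k) t) = height n ((1 - t) * H i k + t * H i (Suc k))"
      unfolding bc all5 using that(1)
      by (simp add: letter_map_def \<rho>0_x \<rho>0_e H_def algebra_simps)
    then show ?thesis using that by blast
  qed
  \<comment> \<open>In the last square the third side is the constant edge \<open>e 0\<close>, so
    its position stays at \<open>n\<close> where the general pattern would move to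
    \<open>2 * n\<close>. This leaves a total drop of \<open>n\<close>, that is degree 1.\<close>
  define H' where "H' k = (if k = 0 then 2 * real n - 2 else if k = 1 then real n - 1 else if k = 2 then real n
    else if k = 3 then real n else if k = 4 then real n - 1 else real n - 2)" for k :: nat
  have en: "e n = e 0" and xn: "x (2 * (n - 1) + 1) = x (n - 1)"
  proof -
    have "(2 * (n - 1) + 1) = (n - 1) + n"
      using n by linarith
    then show "x (2 * (n - 1) + 1) = x (n - 1)"
      unfolding x by (metis mod_add_self2)
    show "e n = e 0"
      unfolding e by simp
  qed
  have x2: "height n (real (2 * (n - 1)) + s) = height n (real n - 2 + s)" for s
    using height_period[OF n, of "real n - 2 + s" 1] n by (simp add: algebra_simps of_nat_diff)
  have lift_c': "\<rho>0 (letter_map Y (bdry Y c' ! k) t) = height n ((1 - t) * H' k + t * H' (Suc k))"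
    if "k < length (bdry Y c')" for k t
  proof -
    have hn: "height n (real n) = height n 0"
      using height_period[OF n, of 0 1] by simp
    have h2: "height n (real n * 2 - t) = height n (real n - t)"
      using height_period[OF n, of "real n - t" 1] by (simp add: algebra_simps)
    have "\<forall>k<length (bdry Y c'). \<rho>0 (letter_map Y (bdry Y c' ! k) t) = height n ((1 - t) * H' k + t * H' (Suc k))"
      unfolding bc all5 c'_def using n x2[of "1 - t"] hn h2 \<rho>0_e[of 0 "1 - t"]
      by (simp add: letter_map_def \<rho>0_x \<rho>0_e H'_def xn[simplified] en of_nat_diff algebra_simps)
    then show ?thesis using that by blast
  qed

  \<comment> \<open>Extension of the position map over the 2-cells\<close>
  have "\<exists>l. continuous_on (cball 0 1) l \<and> (\<forall>z. cmod z = 1 \<longrightarrow> \<rho>0 (face_map Y f z) = height n (l z))"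
    if f: "f \<in> faces ?Z" for f
  proof -
    have "\<exists>l. continuous_on (sphere 0 1) l \<and> (\<forall>z. cmod z = 1 \<longrightarrow> \<rho>0 (face_map Y f z) = height n (l z))"
    proof (cases "f = d")
      case True
      have ld: "\<rho>0 (letter_map Y (bdry Y d ! i) t) = height n ((1 - t) * 0 + t * 0)" if "i < length (bdry Y d)" for i t
        using that n by (simp add: bd letter_map_def \<rho>0_e)
      obtain l where "continuous_on (sphere 0 1) l"
        "\<And>z. cmod z = 1 \<Longrightarrow> \<rho>0 (word_map Y (bdry Y d) (circ_pos (length (bdry Y d)) z)) = height n (l z) * z ^ 0"
        using lift_word[where h = "\<lambda>_. 0" and d = 0, OF cld n ld] by auto
      then show ?thesis
        by (intro exI[of _ l]) (simp add: True face_map_boundary)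
    next
      case False
      then obtain i where i: "Suc i < n" "f = c i"
      proof -
        obtain k where k: "f = c k" "f \<noteq> c'"
          using f faces False by auto
        then have "f = c (k mod n)" "k mod n < n"
          using n by (simp_all add: c)
        moreover from this k have "k mod n \<noteq> n - 1"
          by (metis c'_def)
        ultimately show ?thesis
          using that[of "k mod n"] by linarith
      qed
      obtain l where "continuous_on (sphere 0 1) l"
        "\<And>z. cmod z = 1 \<Longrightarrow> \<rho>0 (word_map Y (bdry Y (c i)) (circ_pos (length (bdry Y (c i))) z)) = height n (l z) * z ^ 0"
        using lift_word[where h = "H i" and d = 0 and F = \<rho>0, OF clc n lift_c[OF i(1)]] by (auto simp: bc H_def)
      then show ?thesis
        by (intro exI[of _ l]) (simp add: i face_map_boundary)
    qed
    then obtain l where l: "continuous_on (sphere 0 1) l" "\<And>z. cmod z = 1 \<Longrightarrow> \<rho>0 (face_map Y f z) = height n (l z)"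
      by blast
    \<comment> \<open>The real lift that degree 0 provides on the boundary extends by Tietze;
      \<open>height n\<close> of the extension serves as position on the 2-cell.\<close>
    have "closedin unit_disc (sphere 0 1)"
      by (intro closed_subset) auto
    from Tietze_unbounded[OF l(1) this] l(2) show ?thesis
      by (metis dist_0_norm mem_sphere)
  qed
  then obtain l where l: "\<And>f. f \<in> faces ?Z \<Longrightarrow> continuous_on (cball 0 1) (l f)"
    "\<And>f z. f \<in> faces ?Z \<Longrightarrow> cmod z = 1 \<Longrightarrow> \<rho>0 (face_map Y f z) = height n (l f z)"
    by metis
  define \<rho> where "\<rho> q = (case q of FacePt f z \<Rightarrow> height n (l f z) | _ \<Rightarrow> \<rho>0 q)" for q :: "('v, 'e, 'f) point"
  have \<rho>_skel: "\<rho> q = \<rho>0 q" if "in_skeleton q" for q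
    using that by (auto simp: \<rho>_def split: point.splits)
  have \<rho>_face: "\<rho> (face_map Y f z) = height n (l f z)" if "f \<in> faces ?Z" "cmod z \<le> 1" for f z
  proof (cases "cmod z < 1")
    case True
    then show ?thesis by (simp add: face_map_interior \<rho>_def)
  next
    case False
    then show ?thesis using that l(2)[OF that(1), of z] by (simp add: \<rho>_skel in_skeleton_face_map)
  qed
  have cont\<rho>: "continuous_map (space_of ?Z) unit_circle \<rho>"
  proof (rule continuous_map_space_of[OF Z])
    show "\<rho> (Vert v) \<in> topspace unit_circle" if "v \<in> verts ?Z" for v
      using that verts by (auto simp: \<rho>_skel \<rho>0_v)
    show "continuous_map unit_interval unit_circle (\<lambda>t. \<rho> (edge_map ?Z y t))" if y: "y \<in> edges ?Z" for y
    proof (cases "y \<in> range x")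
      case True
      then show ?thesis
        by (auto simp: \<rho>_skel \<rho>0_x intro!: continuous_on_height continuous_intros)
    next
      case False
      then obtain i where "i < n" "y = e i"
        using erep[of y] y edges by auto
      then show ?thesis
        by (auto simp: \<rho>_skel \<rho>0_e intro!: continuous_on_height continuous_intros)
    qed
    show "continuous_map unit_disc unit_circle (\<lambda>z. \<rho> (face_map ?Z f z))" if f: "f \<in> faces ?Z" for f
    proof -
      have "continuous_map unit_disc unit_circle (\<lambda>z. height n (l f z))"
        using l(1)[OF f] by (auto intro!: continuous_on_height)
      then show ?thesis
        by (rule continuous_map_eq) (use \<rho>_face[OF f] in auto)
    qed
  qed

  \<comment> \<open>The circle of horizontal edges\<close>
  define W where "W = map (\<lambda>i. (x i, True)) [0..<n]"
  have lenW: "length W = n" by (simp add: W_def)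
  have W: "closed_edge_path Y W"
  proof -
    have "tgt Y (x i) = src Y (x (Suc i mod n))" for i
      using tgtx[of i] x by (metis mod_mod_trivial)
    then show ?thesis
      using n edges by (auto simp: closed_edge_path_def W_def letter_start_def letter_end_def)
  qed
  \<comment> \<open>Conjugation undoes the clockwise direction of \<open>height\<close>, so that
    \<open>j\<close> inverts the position map on the circle.\<close>
  define j where "j z = word_map Y W (circ_pos n (cnj z))" for z
  have j_height: "j (height n (real i + s)) = edge_map Y (x i) s" if "i < n" "0 \<le> s" "s \<le> 1" for i s
  proof -
    have "cnj (height n (real i + s)) = circ_pt n (real i + s)"
      by (simp add: height_def circ_pt_def cis_cnj)
    then show ?thesis
      using word_boundary[OF W, of i s] that by (simp add: lenW j_def W_def letter_map_def)
  qed
  have contj: "continuous_map unit_circle (space_of Y) j"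
  proof -
    have "continuous_map unit_circle (space_of Y) (\<lambda>z. id (word_map Y W (circ_pos (length W) z)))"
      using edges by (intro continuous_map_word[OF W]) (auto simp: W_def eta_contract_eq intro!: continuous_map_edge_map[OF Y])
    moreover have "continuous_map unit_circle unit_circle cnj"
      by (auto intro!: continuous_intros)
    ultimately show ?thesis
      using continuous_map_compose[of unit_circle unit_circle cnj] by (simp add: o_def j_def[abs_def] lenW)
  qed

  \<comment> \<open>Collapse onto the circle\<close>
  define S where "S E F = Y\<lparr>edges := E, faces := F\<rparr>" for E F
  have S_sel: "verts (S E F) = verts Y" "edges (S E F) = E" "faces (S E F) = F"
    "src (S E F) = src Y" "tgt (S E F) = tgt Y" "bdry (S E F) = bdry Y" for E F
    by (auto simp: S_def)
  have S_remove: "remove_face_edge (S E F) f y = S (E - {y}) (F - {f})" for E F f y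
    by (simp add: S_def remove_face_edge_def)
  have ZS: "?Z = S (range x \<union> e ` {..<n}) (insert d (c ` {..<n - 1}))"
  proof -
    have "range e = e ` {..<n}"
      using erep by auto
    moreover have "insert d (range c) - {c'} = insert d (c ` {..<n - 1})"
    proof -
      have "range c = c ` {..<n}"
      proof -
        have "c k \<in> c ` {..<n}" for k
          using n by (intro image_eqI[of _ _ "k mod n"]) (simp_all add: c)
        then show ?thesis by auto
      qed
      also have "{..<n} = insert (n - 1) {..<n - 1}"
        using n by auto
      finally have "range c = insert c' (c ` {..<n - 1})"
        by (simp add: c'_def)
      moreover have "c' \<notin> c ` {..<n - 1}"
        using c n by (auto simp: c'_def)
      moreover have "c' \<noteq> d"
        using cd by (simp add: c'_def)
      ultimately show ?thesis
        by (metis insert_Diff_if insert_Diff_single insert_absorb singletonD Diff_insert_absorb insert_commute)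
    qed
    ultimately show ?thesis
      using faces edges by (simp add: S_def remove_face_def)
  qed
  \<comment> \<open>With the last square gone, \<open>e (n - 1)\<close> is a free side of
    \<open>c (n - 2)\<close>. Removing squares in descending order frees the third side of the next
    one each time; after \<open>k\<close> rounds the edges below \<open>n - k\<close> and the
    squares below \<open>n - 1 - k\<close> are left.\<close>
  have chain: "is_two_complex (S (range x \<union> e ` {..<n - k}) (insert d (c ` {..<n - 1 - k}))) \<and>
      deforms_into (space_of ?Z) (space_of (S (range x \<union> e ` {..<n - k}) (insert d (c ` {..<n - 1 - k}))))"
    if "k \<le> n - 1" for k
    using that
  proof (induction k)
    case 0
    have eq: "S (range x \<union> e ` {..<n - 0}) (insert d (c ` {..<n - 1 - 0})) = ?Z"
      using ZS by simp
    show ?case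
      unfolding eq using deforms_into_refl Z by blast
  next
    case (Suc k)
    define r where "r = n - 2 - k"
    have r: "n - 1 - k = Suc r" "n - k = Suc (Suc r)" "n - 1 - Suc k = r" "n - Suc k = Suc r" "Suc r < n"
      using Suc.prems n by (auto simp: r_def)
    let ?S = "S (range x \<union> e ` {..<Suc (Suc r)}) (insert d (c ` {..<Suc r}))"
    have IH: "is_two_complex ?S" "deforms_into (space_of ?Z) (space_of ?S)"
      using Suc r by auto
    have ne: "e i \<noteq> e (Suc r)" if "i \<le> r" for i
      using that r(5) e[of i "Suc r"] by simp
    have nc: "c i \<noteq> c r" if "i < r" for i
      using that r(5) c[of i r] by simp
    have free: "free_edge ?S (c r) 2"
    proof -
      have "e (Suc r) \<notin> fst ` set (bdry Y f)" if f: "f \<in> insert d (c ` {..<Suc r})" "f \<noteq> c r" for f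
      proof (cases "f = d")
        case True
        then show ?thesis using ne[of 0] by (auto simp: bd)
      next
        case False
        then obtain i where "i < r" "f = c i"
          using f by (auto simp: less_Suc_eq)
        then show ?thesis using ne[of i] ne[of "Suc i"] by (auto simp: bc xe[THEN not_sym])
      qed
      then show ?thesis
        using ne[of r] unfolding free_edge_def S_sel bc all5 by (auto simp: xe)
    qed
    have y: "fst (bdry ?S (c r) ! 2) = e (Suc r)"
      by (simp add: S_sel bc)
    have eq: "remove_face_edge ?S (c r) (e (Suc r)) = S (range x \<union> e ` {..<Suc r}) (insert d (c ` {..<r}))"
    proof -
      have "range x \<union> e ` {..<Suc (Suc r)} - {e (Suc r)} = range x \<union> e ` {..<Suc r}"
      proof -
        have "range x \<union> e ` {..<Suc (Suc r)} = insert (e (Suc r)) (range x \<union> e ` {..<Suc r})"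
          by (simp add: lessThan_Suc[of "Suc r"])
        moreover have "e (Suc r) \<notin> e ` {..<Suc r}" "e (Suc r) \<notin> range x"
          using ne xe by (metis imageE lessThan_iff less_Suc_eq_le, metis rangeE)
        ultimately show ?thesis by simp
      qed
      moreover have "insert d (c ` {..<Suc r}) - {c r} = insert d (c ` {..<r})"
        using nc cd by (auto simp: lessThan_Suc)
      ultimately show ?thesis by (simp add: S_remove)
    qed
    have "is_two_complex (remove_face_edge ?S (c r) (e (Suc r)))"
      using free y by (intro is_two_complex_remove_face_edge[OF IH(1)]) (auto simp: free_edge_def)
    then show ?case
      using deforms_into_trans[OF IH(2) deforms_into_remove_face_edge[OF IH(1) free y[symmetric]]]
      unfolding eq r by blast
  qed
  let ?S = "S (range x \<union> {e 0}) {d}" and ?C = "S (range x) {}"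
  have S0: "is_two_complex ?S" "deforms_into (space_of ?Z) (space_of ?S)"
    using chain[of "n - 1"] n by (simp_all add: lessThan_Suc)
  \<comment> \<open>No square is left now, so the disc collapses through \<open>e 0\<close>.\<close>
  have free: "free_edge ?S d 0"
    by (auto simp: free_edge_def S_sel bd)
  have eq: "remove_face_edge ?S d (e 0) = ?C"
  proof -
    have "e 0 \<notin> range x"
      using xe by (metis rangeE)
    then show ?thesis by (simp add: S_remove)
  qed
  have C: "is_two_complex ?C"
    using is_two_complex_remove_face_edge[OF S0(1), of d "e 0"] eq by (simp add: S_sel)
  have defC: "deforms_into (space_of ?Z) (space_of ?C)"
    using deforms_into_trans[OF S0(2) deforms_into_remove_face_edge[OF S0(1) free, of "e 0"]] eq
    by (simp add: S_sel bd)

  \<comment> \<open>The homotopies for attaching the last square\<close>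
  have K: "homotopic_with (\<lambda>_. True) (space_of ?Z) (space_of Y) id (j \<circ> \<rho>)"
  proof (rule deforms_into_homotopic[OF defC])
    show "continuous_map (space_of ?Z) (space_of Y) id"
      by (rule continuous_map_subcomplex[OF Y Z]) auto
    show "continuous_map (space_of ?Z) (space_of Y) (j \<circ> \<rho>)"
      by (rule continuous_map_compose[OF cont\<rho> contj])
    \<comment> \<open>On the circle itself \<open>j \<circ> \<rho>\<close> is the identity.\<close>
    show "homotopic_with (\<lambda>_. True) (space_of ?C) (space_of Y) id (j \<circ> \<rho>)"
    proof (rule homotopic_with_equal)
      show "continuous_map (space_of ?C) (space_of Y) id"
        using edges by (intro continuous_map_subcomplex[OF Y C]) (auto simp: S_sel)
      show "id q = (j \<circ> \<rho>) q" if "q \<in> topspace (space_of ?C)" for q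
      proof -
        have "q \<in> points ?C" using that by (simp add: topspace_space_of[OF C])
        then show ?thesis
        proof (cases rule: points_cases)
          case (Vert v)
          then obtain k where "v = src Y (x k)" using verts by (auto simp: S_sel)
          then obtain i where i: "i < n" "v = src Y (x i)" using xrep[of "x k"] by auto
          then show ?thesis
            using Vert j_height[OF i(1), of 0] by (simp add: \<rho>_skel \<rho>0_v edge_map_def)
        next
          case (EdgePt y s)
          then obtain i where i: "i < n" "y = x i" using xrep[of y] by (auto simp: S_sel)
          then have "q = edge_map Y (x i) s"
            using EdgePt by (simp add: edge_map_def)
          then show ?thesis
            using EdgePt j_height[OF i(1), of s] by (simp add: \<rho>_skel \<rho>0_x)
        qed (auto simp: S_sel)
      qed
    qed auto
  qed
  obtain h where h: "continuous_on (sphere 0 1) h"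
    "\<And>z. cmod z = 1 \<Longrightarrow> \<rho>0 (word_map Y (bdry Y c') (circ_pos (length (bdry Y c')) z)) = height n (h z) * z ^ 1"
    using lift_word[of Y "bdry Y c'" n \<rho>0 H' 1] clc[of "n - 1"] n lift_c' by (auto simp: c'_def bc H'_def)
  have L: "homotopic_with (\<lambda>_. True) unit_circle unit_circle id (\<lambda>z. \<rho> (face_map Y c' z))"
    unfolding homotopic_with
  \<comment> \<open>Scaling the real lift \<open>h\<close> up from 0 deforms \<open>z\<close> into
    the boundary loop \<open>height n (h z) * z\<close>.\<close>
  proof (subst homotopic_with, simp, intro exI[of _ "\<lambda>(t, z). height n (t * h z) * z"] conjI ballI)
    have "continuous_on ({0..1} \<times> sphere 0 1) (\<lambda>(t, z). height n (t * h z) * z)"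
      unfolding case_prod_beta'
      by (intro continuous_intros continuous_on_height continuous_on_compose2[OF h(1)]) auto
    then show "continuous_map (prod_topology unit_interval unit_circle) unit_circle (\<lambda>(t, z). height n (t * h z) * z)"
      by (auto simp: subtopology_Times[symmetric] euclidean_product_topology norm_mult)
    show "(case (0, z) of (t, z) \<Rightarrow> height n (t * h z) * z) = id z" for z
      by (simp add: height_def)
    show "(case (1, z) of (t, z) \<Rightarrow> height n (t * h z) * z) = \<rho> (face_map Y c' z)" if "z \<in> topspace unit_circle" for z
      using h(2)[of z] that by (simp add: face_map_boundary \<rho>_skel)
  qed simp
  show ?thesis
  proof (rule contractible_attach_disc[OF Y _ cont\<rho> contj K L])
    show "c' \<in> faces Y" by (simp add: faces c'_def)
  qed
qed

section \<open>Labelled complexes\<close>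

definition label_word :: "('e \<Rightarrow> 'g) \<Rightarrow> 'e word \<Rightarrow> 'g word" where
  "label_word lab w = map (\<lambda>(e, s). (lab e, s)) w"

lemma length_label_word [simp]: "length (label_word lab w) = length w"
  by (simp add: label_word_def)

lemma label_word_nth: "i < length w \<Longrightarrow> label_word lab w ! i = (lab (fst (w ! i)), snd (w ! i))"
  by (simp add: label_word_def case_prod_beta)

text \<open>Connectedness of the 1-skeleton, phrased without paths. In this form it passes easily
  through collapses and follows from a continuous indicator function.\<close>

definition edge_connected :: "('v, 'e, 'f) two_complex \<Rightarrow> bool" where
  "edge_connected Y \<longleftrightarrow> (\<forall>W \<subseteq> verts Y. W \<noteq> {} \<longrightarrow>
     (\<forall>e\<in>edges Y. src Y e \<in> W \<longleftrightarrow> tgt Y e \<in> W) \<longrightarrow> W = verts Y)"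

text \<open>What an immersion leaves behind after straightening. The graph is folded in the sense of
  Stallings; \<open>face_inj\<close> is local injectivity along the sides of 2-cells. It compares
  equal positions only, since different sides of a relator are different local sheets of the
  target.\<close>

locale folded_complex =
  fixes Y :: "('v, 'e, 'f) two_complex" and lab :: "'e \<Rightarrow> gen" and flab :: "'f \<Rightarrow> nat"
  assumes cpx: "is_two_complex Y"
    and fin: "finite (verts Y)" "finite (edges Y)" "finite (faces Y)"
    and flab: "c \<in> faces Y \<Longrightarrow> flab c < length (relators pres_P)"
    and lab: "c \<in> faces Y \<Longrightarrow> label_word lab (bdry Y c) = relators pres_P ! flab c"
    and src_inj: "e \<in> edges Y \<Longrightarrow> e' \<in> edges Y \<Longrightarrow> lab e = lab e' \<Longrightarrow> src Y e = src Y e' \<Longrightarrow> e = e'"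
    and tgt_inj: "e \<in> edges Y \<Longrightarrow> e' \<in> edges Y \<Longrightarrow> lab e = lab e' \<Longrightarrow> tgt Y e = tgt Y e' \<Longrightarrow> e = e'"
    and face_inj: "c \<in> faces Y \<Longrightarrow> c' \<in> faces Y \<Longrightarrow> flab c = flab c' \<Longrightarrow> i < length (bdry Y c) \<Longrightarrow>
      bdry Y c ! i = bdry Y c' ! i \<Longrightarrow> c = c'"
begin

lemma face_disc:
  assumes "c \<in> faces Y" "flab c = 0"
  obtains e where "bdry Y c = [(e, True)]" "e \<in> edges Y" "lab e = Gen_b" "src Y e = tgt Y e"
proof -
  have "label_word lab (bdry Y c) = [(Gen_b, True)]"
    using lab[OF assms(1)] assms(2) by (simp add: pres_P_def)
  then obtain e where e: "bdry Y c = [(e, True)]" "lab e = Gen_b"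
    by (auto simp: label_word_def map_eq_Cons_conv)
  moreover have "e \<in> edges Y" "src Y e = tgt Y e"
    using closed_bdry[OF cpx assms(1)] e by (auto simp: closed_edge_path_def letter_start_def letter_end_def)
  ultimately show ?thesis using that by blast
qed

text \<open>The 5-gon drawn as a square: vertical sides \<open>e\<close> and \<open>e'\<close>, the
  edge \<open>x\<close> joining their ends, the path \<open>z\<close>, \<open>y\<close> joining
  their starts.\<close>

lemma face_square:
  assumes "c \<in> faces Y" "flab c = 1"
  obtains e x e' y z where "bdry Y c = [(e, True), (x, True), (e', False), (y, False), (z, False)]"
    "{e, x, e', y, z} \<subseteq> edges Y" "lab e = Gen_b" "lab x = Gen_a" "lab e' = Gen_b" "lab y = Gen_a" "lab z = Gen_a"
    "tgt Y e = src Y x" "tgt Y x = tgt Y e'" "src Y e' = tgt Y y" "src Y y = tgt Y z" "src Y z = src Y e"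
proof -
  have "label_word lab (bdry Y c) =
      [(Gen_b, True), (Gen_a, True), (Gen_b, False), (Gen_a, False), (Gen_a, False)]"
    using lab[OF assms(1)] assms(2) by (simp add: pres_P_def)
  then obtain e x e' y z where w: "bdry Y c = [(e, True), (x, True), (e', False), (y, False), (z, False)]"
    "lab e = Gen_b" "lab x = Gen_a" "lab e' = Gen_b" "lab y = Gen_a" "lab z = Gen_a"
    by (auto simp: label_word_def map_eq_Cons_conv)
  have cl: "closed_edge_path Y [(e, True), (x, True), (e', False), (y, False), (z, False)]"
    using closed_bdry[OF cpx assms(1)] w by simp
  then have "{e, x, e', y, z} \<subseteq> edges Y"
    by (auto simp: closed_edge_path_def)
  moreover have "tgt Y e = src Y x" "tgt Y x = tgt Y e'" "src Y e' = tgt Y y" "src Y y = tgt Y z" "src Y z = src Y e"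
    using cl unfolding closed_edge_path_def
    by (auto simp: letter_start_def letter_end_def dest: spec[of _ 0] spec[of _ 1] spec[of _ 2] spec[of _ 3] spec[of _ 4])
  ultimately show ?thesis using that w by blast
qed

lemma flab_cases: "c \<in> faces Y \<Longrightarrow> flab c = 0 \<or> flab c = 1"
  using flab[of c] by (auto simp: pres_P_def less_Suc_eq)

lemma lab_cases: "lab e = Gen_a \<or> lab e = Gen_b"
  by (cases "lab e") auto

text \<open>Sides of 2-cells on \<open>e\<close>, with multiplicity: a pair is a 2-cell and a
  position in its boundary word.\<close>

definition incident :: "'e \<Rightarrow> 'f \<times> nat \<Rightarrow> bool" where
  "incident e = (\<lambda>(c, i). c \<in> faces Y \<and> i < length (bdry Y c) \<and> fst (bdry Y c ! i) = e)"

lemma folded_remove_face_edge: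
  assumes "is_two_complex (remove_face_edge Y c e)"
  shows "folded_complex (remove_face_edge Y c e) lab flab"
  by unfold_locales (use assms fin flab lab src_inj tgt_inj face_inj in \<open>auto simp: remove_face_edge_def\<close>)

lemma folded_remove_leaf:
  assumes "is_two_complex (remove_leaf Y v e)"
  shows "folded_complex (remove_leaf Y v e) lab flab"
  by unfold_locales (use assms fin flab lab src_inj tgt_inj face_inj in \<open>auto simp: remove_leaf_def\<close>)

lemma free_edgeI:
  assumes "incident e (c, i)" and "\<And>k. incident e k \<Longrightarrow> k = (c, i)"
  shows "free_edge Y c i" "fst (bdry Y c ! i) = e"
proof -
  have ci: "c \<in> faces Y" "i < length (bdry Y c)" "fst (bdry Y c ! i) = e"
    using assms(1) by (auto simp: incident_def)
  moreover have "e \<notin> fst ` set (bdry Y c')" if "c' \<in> faces Y" "c' \<noteq> c" for c'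
  proof
    assume "e \<in> fst ` set (bdry Y c')"
    then obtain k where "k < length (bdry Y c')" "fst (bdry Y c' ! k) = e"
      by (auto simp: in_set_conv_nth)
    then show False
      using assms(2)[of "(c', k)"] that by (simp add: incident_def)
  qed
  moreover have "fst (bdry Y c ! k) \<noteq> e" if "k < length (bdry Y c)" "k \<noteq> i" for k
    using assms(2)[of "(c, k)"] that ci(1) by (auto simp: incident_def)
  ultimately show "free_edge Y c i" "fst (bdry Y c ! i) = e"
    unfolding free_edge_def by blast+
qed

text \<open>The ends of the removed edge stay connected through the rest of the boundary word of
  \<open>c\<close>, or coincide if the word has a single letter.\<close>

lemma edge_connected_remove_face_edge:
  assumes conn: "edge_connected Y" and free: "free_edge Y c p" and e: "e = fst (bdry Y c ! p)"
  shows "edge_connected (remove_face_edge Y c e)"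
  unfolding edge_connected_def
proof (intro allI impI)
  fix W assume W: "W \<subseteq> verts (remove_face_edge Y c e)" "W \<noteq> {}"
    "\<forall>y\<in>edges (remove_face_edge Y c e). src (remove_face_edge Y c e) y \<in> W \<longleftrightarrow> tgt (remove_face_edge Y c e) y \<in> W"
  then have W': "src Y y \<in> W \<longleftrightarrow> tgt Y y \<in> W" if "y \<in> edges Y" "y \<noteq> e" for y
    using that by (auto simp: remove_face_edge_def)
  have c: "c \<in> faces Y" and p: "p < length (bdry Y c)"
    and un: "\<And>i. i < length (bdry Y c) \<Longrightarrow> i \<noteq> p \<Longrightarrow> fst (bdry Y c ! i) \<noteq> e"
    using free e by (auto simp: free_edge_def)
  have "src Y e \<in> W \<longleftrightarrow> tgt Y e \<in> W"
    using flab_cases[OF c]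
  proof
    assume "flab c = 0"
    then obtain e0 where "bdry Y c = [(e0, True)]" "src Y e0 = tgt Y e0"
      using face_disc[OF c] by metis
    then show ?thesis
      using p e by simp
  next
    assume "flab c = 1"
    then obtain e0 x e1 y z where w: "bdry Y c = [(e0, True), (x, True), (e1, False), (y, False), (z, False)]"
      "{e0, x, e1, y, z} \<subseteq> edges Y"
      "tgt Y e0 = src Y x" "tgt Y x = tgt Y e1" "src Y e1 = tgt Y y" "src Y y = tgt Y z" "src Y z = src Y e0"
      using face_square[OF c] by metis
    have "p = 0 \<or> p = 1 \<or> p = 2 \<or> p = 3 \<or> p = 4"
      using p w by auto
    then show ?thesis
      using un[of 0] un[of 1] un[of 2] un[of 3] un[of 4] e w
        W'[of e0] W'[of x] W'[of e1] W'[of y] W'[of z] by auto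
  qed
  then show "W = verts (remove_face_edge Y c e)"
    using conn W W' unfolding edge_connected_def by (simp add: remove_face_edge_def) metis
qed

text \<open>The size of this set is the valence of \<open>v\<close>, a loop counting twice.\<close>

definition out_letters :: "'v \<Rightarrow> ('e \<times> bool) set" where
  "out_letters v = {l. fst l \<in> edges Y \<and> letter_start Y l = v}"

lemma relator_reduced:
  assumes "k < length (relators pres_P)" "i < length (relators pres_P ! k)"
  shows "relators pres_P ! k ! (Suc i mod length (relators pres_P ! k)) \<noteq>
    (fst (relators pres_P ! k ! i), \<not> snd (relators pres_P ! k ! i))"
  using assms by (auto simp: pres_P_def less_Suc_eq)

text \<open>A boundary word running through the only edge at \<open>v\<close> would have to turn
  back there at once, but the relators are cyclically reduced. So no 2-cell prevents the
  collapse.\<close>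

lemma leafI:
  assumes "out_letters v = {(y, s)}"
  shows "leaf Y v (y, \<not> s)"
proof -
  have y: "y \<in> edges Y" "letter_start Y (y, s) = v"
  proof -
    have "(y, s) \<in> out_letters v"
      using assms by simp
    then show "y \<in> edges Y" "letter_start Y (y, s) = v"
      by (simp_all add: out_letters_def)
  qed
  have un: "e' = y \<and> s' = s" if "e' \<in> edges Y" "letter_start Y (e', s') = v" for e' s'
  proof -
    have "(e', s') \<in> out_letters v"
      using that by (simp add: out_letters_def)
    then show ?thesis using assms by simp
  qed
  have rev: "letter_end Y (e', s') = letter_start Y (e', \<not> s')" for e' s'
    by (simp add: letter_start_def letter_end_def)
  have "y \<notin> fst ` set (bdry Y c)" if c: "c \<in> faces Y" for c
  proof
    let ?w = "bdry Y c" and ?m = "length (bdry Y c)"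
    assume "y \<in> fst ` set ?w"
    then obtain i where i: "i < ?m" "fst (?w ! i) = y"
      by (auto simp: in_set_conv_nth)
    have m: "?m > 0" using i by linarith
    have adj: "letter_end Y (?w ! i) = letter_start Y (?w ! (Suc i mod ?m))" if "i < ?m" for i
      using closed_bdry[OF cpx c] that by (auto simp: closed_edge_path_def)
    \<comment> \<open>A word arriving at \<open>v\<close> can only leave along the same edge, so
      letter \<open>k\<close> and its successor are mutually inverse.\<close>
    have red: False if k: "k < ?m" and v: "letter_end Y (?w ! k) = v" for k
    proof -
      let ?k = "Suc k mod ?m"
      have k': "?k < ?m" using m by simp
      obtain a1 b1 a2 b2 where ab: "?w ! k = (a1, b1)" "?w ! ?k = (a2, b2)"
        by (meson surj_pair)
      have 1: "?w ! k = (y, \<not> s)"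
        using un[of a1 "\<not> b1"] v bdry_edges[OF cpx c k] ab rev by auto
      have 2: "?w ! ?k = (y, s)"
        using un[of a2 b2] v adj[OF k] bdry_edges[OF cpx c k'] ab by auto
      have "relators pres_P ! flab c ! k = (lab y, \<not> s)" "relators pres_P ! flab c ! ?k = (lab y, s)"
        unfolding lab[OF c, symmetric] using 1 2 k k' by (simp_all add: label_word_nth)
      then show False
        using relator_reduced[OF flab[OF c], of k] k by (simp flip: lab[OF c])
    qed
    have "snd (?w ! i) = s \<or> snd (?w ! i) = (\<not> s)" by auto
    then show False
    proof
      assume "snd (?w ! i) = s"
      then have st: "letter_start Y (?w ! i) = v"
        using i y by (cases "?w ! i") auto
      \<comment> \<open>The cyclic predecessor of \<open>i\<close>; adding \<open>?m - 1\<close>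
        avoids subtraction below 0.\<close>
      define k where "k = (i + ?m - 1) mod ?m"
      have "Suc k mod ?m = i"
        using i m by (simp add: k_def mod_Suc_eq)
      moreover have "k < ?m" using m by (simp add: k_def)
      ultimately show False
        using red[of k] adj[of k] st by simp
    next
      assume "snd (?w ! i) = (\<not> s)"
      then have "letter_end Y (?w ! i) = v"
        using i y rev by (cases "?w ! i") auto
      then show False using red i by blast
    qed
  qed
  moreover have "letter_end Y (y, \<not> s) = v"
    using y by (simp add: rev)
  moreover have "letter_start Y (y, \<not> s) \<noteq> v"
    using un[of y "\<not> s"] y by auto
  moreover have "src Y e' \<noteq> v \<and> tgt Y e' \<noteq> v" if "e' \<in> edges Y" "e' \<noteq> y" for e'
    using un[of e' True] un[of e' False] that by (auto simp: letter_start_def)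
  ultimately show ?thesis
    using y unfolding leaf_def by simp
qed

lemma edge_connected_remove_leaf:
  assumes conn: "edge_connected Y" and l: "leaf Y v l"
  shows "edge_connected (remove_leaf Y v (fst l))"
  unfolding edge_connected_def
proof (intro allI impI)
  let ?e = "fst l" and ?u = "letter_start Y l"
  fix W assume W: "W \<subseteq> verts (remove_leaf Y v ?e)" "W \<noteq> {}"
    "\<forall>y\<in>edges (remove_leaf Y v ?e). src (remove_leaf Y v ?e) y \<in> W \<longleftrightarrow> tgt (remove_leaf Y v ?e) y \<in> W"
  have W': "src Y y \<in> W \<longleftrightarrow> tgt Y y \<in> W" if "y \<in> edges Y" "y \<noteq> ?e" for y
    using that W by (auto simp: remove_leaf_def)
  have vW: "v \<notin> W" "W \<subseteq> verts Y"
    using W by (auto simp: remove_leaf_def)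
  have other: "src Y y \<noteq> v \<and> tgt Y y \<noteq> v" if "y \<in> edges Y" "y \<noteq> ?e" for y
    using l that by (auto simp: leaf_def)
  have e: "?e \<in> edges Y" "letter_end Y l = v" "?u \<noteq> v"
    using l by (auto simp: leaf_def)
  have v: "v \<in> verts Y"
    using cpx e by (auto simp: is_two_complex_def letter_end_def split: if_splits)
  \<comment> \<open>The leaf vertex joins \<open>W\<close> exactly if its only neighbour lies in
    \<open>W\<close>; this makes the set closed under the edges of the larger complex.\<close>
  define W1 where "W1 = (if ?u \<in> W then insert v W else W)"
  have "src Y y \<in> W1 \<longleftrightarrow> tgt Y y \<in> W1" if "y \<in> edges Y" for y
  proof (cases "y = ?e")
    case True
    then show ?thesis
      using e vW by (auto simp: W1_def letter_end_def letter_start_def split: if_splits)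
  next
    case False
    then show ?thesis
      using W'[OF that] other[OF that] by (auto simp: W1_def)
  qed
  moreover have "W1 \<subseteq> verts Y" "W1 \<noteq> {}"
    using vW v W(2) by (auto simp: W1_def)
  ultimately have "W1 = verts Y"
    using conn unfolding edge_connected_def by metis
  then show "W = verts (remove_leaf Y v ?e)"
    using vW by (auto simp: W1_def remove_leaf_def split: if_splits)
qed

text \<open>Horizontal edges, and vertical edges that bound nothing, carry the Euler characteristic once every
  other vertical edge meets exactly two squares.\<close>

lemma euler_char_nonpos:
  assumes nodisc: "\<And>c. c \<in> faces Y \<Longrightarrow> flab c = 1"
    and nofree: "\<And>e c i. e \<in> edges Y \<Longrightarrow> lab e = Gen_b \<Longrightarrow> incident e (c, i) \<Longrightarrow> \<exists>k. incident e k \<and> k \<noteq> (c, i)"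
    and deg: "\<And>v. v \<in> verts Y \<Longrightarrow> 2 \<le> card (out_letters v)"
  shows "euler_char Y \<le> 0"
proof -
  \<comment> \<open>The count of edge ends leaves out the vertical edges lying on squares; these
    will be balanced against the squares.\<close>
  define E where "E = {e \<in> edges Y. lab e = Gen_a \<or> (\<forall>k. \<not> incident e k)}"
  have inc: "i = 0 \<or> i = 2" if "incident e (c, i)" "lab e = Gen_b" for e c i
  proof -
    have c: "c \<in> faces Y" "i < length (bdry Y c)" "fst (bdry Y c ! i) = e"
      using that by (auto simp: incident_def)
    obtain e0 x e1 y z where w: "bdry Y c = [(e0, True), (x, True), (e1, False), (y, False), (z, False)]"
      "lab x = Gen_a" "lab y = Gen_a" "lab z = Gen_a"
      using face_square[OF c(1) nodisc[OF c(1)]] by metis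
    have "i = 0 \<or> i = 1 \<or> i = 2 \<or> i = 3 \<or> i = 4"
      using c w by auto
    then show ?thesis
      using c w that by auto
  qed
  have uniq: "c = c'" if "incident e (c, i)" "incident e (c', i)" "lab e = Gen_b" for e c c' i
  proof -
    have c: "c \<in> faces Y" "c' \<in> faces Y" "i < length (bdry Y c)" "i < length (bdry Y c')"
        "fst (bdry Y c ! i) = e" "fst (bdry Y c' ! i) = e"
      using that by (auto simp: incident_def)
    have "relators pres_P ! flab c ! i = relators pres_P ! flab c' ! i"
      using nodisc c by simp
    then have "snd (bdry Y c ! i) = snd (bdry Y c' ! i)"
      using lab[OF c(1)] lab[OF c(2)] c label_word_nth by (metis snd_conv)
    then show ?thesis
      using face_inj[OF c(1,2) _ c(3)] nodisc c by (simp add: prod_eq_iff)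
  qed
  \<comment> \<open>An edge left out of \<open>E\<close> is both a first and a third side, and the
    corners of these squares supply one horizontal edge leaving \<open>v\<close> and one arriving
    there. If no such edge meets \<open>v\<close>, its whole valence lies in
    \<open>E\<close>.\<close>
  have two: "2 \<le> card {l \<in> E \<times> UNIV. letter_start Y l = v}" if v: "v \<in> verts Y" for v
  proof (cases "\<exists>e\<in>edges Y - E. src Y e = v \<or> tgt Y e = v")
    case True
    then obtain e where e: "e \<in> edges Y" "e \<notin> E" "src Y e = v \<or> tgt Y e = v" by blast
    then obtain c i where ci: "incident e (c, i)" and b: "lab e = Gen_b"
      using lab_cases[of e] by (auto simp: E_def)
    obtain c' i' where ci': "incident e (c', i')" "(c', i') \<noteq> (c, i)"
      using nofree[OF e(1) b ci] by auto
    have "i \<noteq> i'"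
      using uniq[OF ci _ b, of c'] ci' by auto
    then obtain c0 c2 where c0: "incident e (c0, 0)" and c2: "incident e (c2, 2)"
      using inc[OF ci b] inc[OF ci'(1) b] ci ci' by metis
    have f0: "c0 \<in> faces Y" and f2: "c2 \<in> faces Y"
      using c0 c2 by (auto simp: incident_def)
    obtain e0 x0 e1 y0 z0 where w0: "bdry Y c0 = [(e0, True), (x0, True), (e1, False), (y0, False), (z0, False)]"
      "{e0, x0, e1, y0, z0} \<subseteq> edges Y" "lab x0 = Gen_a" "lab z0 = Gen_a" "tgt Y e0 = src Y x0" "src Y z0 = src Y e0"
      using face_square[OF f0 nodisc[OF f0]] by metis
    obtain e2 x2 e3 y2 z2 where w2: "bdry Y c2 = [(e2, True), (x2, True), (e3, False), (y2, False), (z2, False)]"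
      "{e2, x2, e3, y2, z2} \<subseteq> edges Y" "lab x2 = Gen_a" "lab y2 = Gen_a" "tgt Y x2 = tgt Y e3" "src Y e3 = tgt Y y2"
      using face_square[OF f2 nodisc[OF f2]] by metis
    have ee: "e0 = e" "e3 = e"
      using c0 c2 w0 w2 by (auto simp: incident_def)
    have "\<exists>p q. (p, True) \<in> {l \<in> E \<times> UNIV. letter_start Y l = v} \<and> (q, False) \<in> {l \<in> E \<times> UNIV. letter_start Y l = v}"
      using e(3)
    proof
      assume "src Y e = v"
      then show ?thesis
        using w0 w2 ee by (intro exI[of _ z0] exI[of _ y2]) (auto simp: E_def letter_start_def)
    next
      assume "tgt Y e = v"
      then show ?thesis
        using w0 w2 ee by (intro exI[of _ x0] exI[of _ x2]) (auto simp: E_def letter_start_def)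
    qed
    then obtain p q where pq: "{(p, True), (q, False)} \<subseteq> {l \<in> E \<times> UNIV. letter_start Y l = v}"
      by blast
    have "finite {l \<in> E \<times> (UNIV :: bool set). letter_start Y l = v}"
      using fin by (auto simp: E_def)
    from card_mono[OF this pq] show ?thesis by simp
  next
    case False
    then have "out_letters v = {l \<in> E \<times> UNIV. letter_start Y l = v}"
      by (auto simp: out_letters_def E_def letter_start_def split: if_splits)
    then show ?thesis
      using deg[OF v] by simp
  qed
  \<comment> \<open>Each of the \<open>2 * card E\<close> letters over \<open>E\<close> starts at
    one vertex only.\<close>
  have "2 * card (verts Y) = (\<Sum>v\<in>verts Y. 2)"
    by simp
  also have "\<dots> \<le> (\<Sum>v\<in>verts Y. card {l \<in> E \<times> (UNIV :: bool set). letter_start Y l = v})"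
    by (intro sum_mono two)
  also have "\<dots> = card (\<Union>v\<in>verts Y. {l \<in> E \<times> (UNIV :: bool set). letter_start Y l = v})"
    using fin by (subst card_UN_disjoint) (auto simp: E_def)
  also have "\<dots> \<le> card (E \<times> (UNIV :: bool set))"
    using fin by (intro card_mono) (auto simp: E_def)
  finally have V: "card (verts Y) \<le> card E"
    by (simp add: card_cartesian_product)
  \<comment> \<open>A square is determined by its first side, and that side was left out of
    \<open>E\<close>.\<close>
  have F: "card (faces Y) \<le> card (edges Y - E)"
  proof (rule card_inj_on_le)
    have first: "incident (fst (bdry Y c ! 0)) (c, 0) \<and> lab (fst (bdry Y c ! 0)) = Gen_b \<and> fst (bdry Y c ! 0) \<in> edges Y"
      if c: "c \<in> faces Y" for c
    proof -
      obtain e0 x0 e1 y0 z0 where "bdry Y c = [(e0, True), (x0, True), (e1, False), (y0, False), (z0, False)]"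
        "{e0, x0, e1, y0, z0} \<subseteq> edges Y" "lab e0 = Gen_b"
        using face_square[OF c nodisc[OF c]] by metis
      then show ?thesis using c by (auto simp: incident_def)
    qed
    show "inj_on (\<lambda>c. fst (bdry Y c ! 0)) (faces Y)"
      using first uniq by (intro inj_onI) metis
    show "(\<lambda>c. fst (bdry Y c ! 0)) ` faces Y \<subseteq> edges Y - E"
      using first by (auto simp: E_def)
  qed (use fin in auto)
  have "card (edges Y) = card E + card (edges Y - E)"
    using fin by (subst card_Diff_subset) (auto simp: E_def card_mono intro: finite_subset)
  then show ?thesis
    using V F unfolding euler_char_def by linarith
qed

end

text \<open>Equality passes forwards and backwards along the sequence, so a finite range forces pure
  periodicity, without an initial segment outside the cycle.\<close>

lemma periodic_sequence:
  fixes f :: "nat \<Rightarrow> 'a"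
  assumes step: "\<And>i j. f i = f j \<longleftrightarrow> f (Suc i) = f (Suc j)" and fin: "finite (range f)"
  obtains n where "n > 0" "\<And>i j. f i = f j \<longleftrightarrow> i mod n = j mod n"
proof -
  have shift: "f (i + k) = f (j + k) \<longleftrightarrow> f i = f j" for i j k
    by (induction k) (auto simp flip: step)
  have "\<not> inj f"
    using fin finite_imageD infinite_UNIV_nat by blast
  then obtain i j where "f i = f j" "i < j"
    by (metis injI linorder_neqE_nat)
  then have ex: "\<exists>n. n > 0 \<and> f n = f 0"
    using shift[of 0 i "j - i"] by (intro exI[of _ "j - i"]) auto
  define n where "n = (LEAST n. n > 0 \<and> f n = f 0)"
  have n: "n > 0" "f n = f 0"
    using LeastI_ex[OF ex] by (auto simp: n_def)
  have least: "n \<le> m" if "m > 0" "f m = f 0" for m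
    unfolding n_def using that by (intro Least_le) auto
  have per: "f (i + n) = f i" for i
    using shift[of n i 0] n by (simp add: add.commute)
  have "f (i + k * n) = f i" for i k
    by (induction k) (auto simp: per add.assoc[symmetric] add.commute[of n])
  then have fmod: "f i = f (i mod n)" for i
    by (metis mod_mult_div_eq mult.commute add.commute)
  have inj: False if "i < j" "j < n" "f i = f j" for i j
    using shift[of 0 i "j - i"] that least[of "j - i"] by auto
  have "f i = f j \<longleftrightarrow> i mod n = j mod n" for i j
  proof
    assume "f i = f j"
    then have "f (i mod n) = f (j mod n)" using fmod by metis
    moreover have "i mod n < n" "j mod n < n" using n by auto
    ultimately show "i mod n = j mod n"
      using inj by (metis linorder_neqE_nat)
  next
    assume "i mod n = j mod n"
    then show "f i = f j" using fmod by metis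
  qed
  then show ?thesis using that n by blast
qed

lemma single_valued_relpow:
  fixes A :: "('a \<times> 'a) set"
  shows "single_valued A \<Longrightarrow> single_valued (A ^^ n)"
proof (induction n)
  case (Suc n)
  then show ?case
    by (simp add: single_valued_relcomp)
qed (auto simp: single_valued_def)

lemma single_valued_converse_relpow:
  fixes A :: "('a \<times> 'a) set"
  shows "single_valued (A\<inverse>) \<Longrightarrow> single_valued ((A ^^ n)\<inverse>)"
  by (induction n) (auto simp: converse_relcomp single_valued_relcomp)

context folded_complex
begin

lemma square_incidence:
  assumes "incident e (c, i)" "lab e = Gen_b"
  shows "c \<in> faces Y \<and> (flab c = 0 \<and> i = 0 \<and> bdry Y c ! 0 = (e, True) \<or>
    flab c = 1 \<and> (i = 0 \<and> bdry Y c ! 0 = (e, True) \<or> i = 2 \<and> bdry Y c ! 2 = (e, False)))"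
proof -
  have c: "c \<in> faces Y" "i < length (bdry Y c)" "fst (bdry Y c ! i) = e"
    using assms by (auto simp: incident_def)
  show ?thesis
    using flab_cases[OF c(1)]
  proof
    assume 0: "flab c = 0"
    then obtain e0 where "bdry Y c = [(e0, True)]"
      using face_disc[OF c(1)] by metis
    then show ?thesis using c 0 by auto
  next
    assume 1: "flab c = 1"
    then obtain e0 x e1 y z where w: "bdry Y c = [(e0, True), (x, True), (e1, False), (y, False), (z, False)]"
      "lab x = Gen_a" "lab y = Gen_a" "lab z = Gen_a"
      using face_square[OF c(1)] by metis
    have "i = 0 \<or> i = 1 \<or> i = 2 \<or> i = 3 \<or> i = 4"
      using c w by auto
    then show ?thesis
      using c w assms 1 by auto
  qed
qed

text \<open>The vertical edge of a disc starts a chain of squares, each one sharing its third side with the first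
  side of the next. A further disc can only occur on the starting edge, so the chain closes up.\<close>

lemma contractible_of_disc:
  assumes conn: "edge_connected Y"
    and nofree: "\<And>e c i. e \<in> edges Y \<Longrightarrow> lab e = Gen_b \<Longrightarrow> incident e (c, i) \<Longrightarrow> \<exists>k. incident e k \<and> k \<noteq> (c, i)"
    and disc: "d' \<in> faces Y" "flab d' = 0"
  shows "contractible_space (space_of Y)"
proof -

  \<comment> \<open>Counting first and third sides of squares\<close>
  define B where "B s i = {e. \<exists>c\<in>faces Y. flab c = 1 \<and> bdry Y c ! i = (e, s)}" for s :: bool and i
  define D where "D = {e. \<exists>c\<in>faces Y. flab c = 0 \<and> bdry Y c ! 0 = (e, True)}"
  let ?T = "{c \<in> faces Y. flab c = 1}"
  have finT: "finite ?T" using fin by simp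
  have sq: "\<exists>e x e' y z. bdry Y c = [(e, True), (x, True), (e', False), (y, False), (z, False)] \<and>
    {e, x, e', y, z} \<subseteq> edges Y \<and> lab e = Gen_b \<and> lab x = Gen_a \<and> lab e' = Gen_b \<and> lab y = Gen_a \<and> lab z = Gen_a \<and>
    tgt Y e = src Y x \<and> tgt Y x = tgt Y e' \<and> src Y e' = tgt Y y \<and> src Y y = tgt Y z \<and> src Y z = src Y e"
    if "c \<in> ?T" for c
  proof -
    have c: "c \<in> faces Y" "flab c = 1" using that by auto
    show ?thesis using face_square[OF c] by metis
  qed
  have len: "length (bdry Y c) = 5" if "c \<in> ?T" for c
    using sq[OF that] by auto
  have Tinj: "c = c'" if "c \<in> ?T" "c' \<in> ?T" "i < 5" "bdry Y c ! i = bdry Y c' ! i" for c c' i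
    using that len face_inj[of c c' i] by auto
  have corner: "bdry Y c ! 0 = (fst (bdry Y c ! 0), True) \<and> bdry Y c ! 2 = (fst (bdry Y c ! 2), False) \<and>
      {fst (bdry Y c ! 0), fst (bdry Y c ! 2)} \<subseteq> edges Y \<and>
      lab (fst (bdry Y c ! 0)) = Gen_b \<and> lab (fst (bdry Y c ! 2)) = Gen_b" if "c \<in> ?T" for c
    using sq[OF that] by auto
  have B0: "B True 0 = (\<lambda>c. fst (bdry Y c ! 0)) ` ?T"
  proof (intro set_eqI iffI)
    fix e assume "e \<in> B True 0"
    then obtain c where "c \<in> ?T" "bdry Y c ! 0 = (e, True)" by (auto simp: B_def)
    then show "e \<in> (\<lambda>c. fst (bdry Y c ! 0)) ` ?T" by (intro image_eqI[of _ _ c]) simp_all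
  next
    fix e assume "e \<in> (\<lambda>c. fst (bdry Y c ! 0)) ` ?T"
    then obtain c where "c \<in> ?T" "e = fst (bdry Y c ! 0)" by blast
    then show "e \<in> B True 0" using corner[of c] by (auto simp: B_def)
  qed
  have B2: "B False 2 = (\<lambda>c. fst (bdry Y c ! 2)) ` ?T"
  proof (intro set_eqI iffI)
    fix e assume "e \<in> B False 2"
    then obtain c where "c \<in> ?T" "bdry Y c ! 2 = (e, False)" by (auto simp: B_def)
    then show "e \<in> (\<lambda>c. fst (bdry Y c ! 2)) ` ?T" by (intro image_eqI[of _ _ c]) simp_all
  next
    fix e assume "e \<in> (\<lambda>c. fst (bdry Y c ! 2)) ` ?T"
    then obtain c where "c \<in> ?T" "e = fst (bdry Y c ! 2)" by blast
    then show "e \<in> B False 2" using corner[of c] by (auto simp: B_def)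
  qed
  \<comment> \<open>\<open>B True 0\<close> and \<open>B False 2\<close> are the first and the third
    sides. A square is determined by either, so both sets have as many elements as there are
    squares.\<close>
  have cardB: "finite (B True 0)" "finite (B False 2)" "card (B True 0) = card (B False 2)"
  proof -
    have 0: "bij_betw (\<lambda>c. fst (bdry Y c ! 0)) ?T (B True 0)"
    proof (rule bij_betw_imageI)
      show "inj_on (\<lambda>c. fst (bdry Y c ! 0)) ?T"
      proof (rule inj_onI)
        fix c c' assume "c \<in> ?T" "c' \<in> ?T" "fst (bdry Y c ! 0) = fst (bdry Y c' ! 0)"
        then show "c = c'" using corner[of c] corner[of c'] Tinj[of c c' 0] by simp
      qed
    qed (simp add: B0)
    have 2: "bij_betw (\<lambda>c. fst (bdry Y c ! 2)) ?T (B False 2)"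
    proof (rule bij_betw_imageI)
      show "inj_on (\<lambda>c. fst (bdry Y c ! 2)) ?T"
      proof (rule inj_onI)
        fix c c' assume "c \<in> ?T" "c' \<in> ?T" "fst (bdry Y c ! 2) = fst (bdry Y c' ! 2)"
        then show "c = c'" using corner[of c] corner[of c'] Tinj[of c c' 2] by simp
      qed
    qed (simp add: B2)
    show "finite (B True 0)" "finite (B False 2)"
      using finT by (simp_all add: B0 B2)
    show "card (B True 0) = card (B False 2)"
      using bij_betw_same_card[OF 0] bij_betw_same_card[OF 2] by linarith
  qed
  have lab_B: "lab e = Gen_b \<and> e \<in> edges Y" if "e \<in> B True 0 \<or> e \<in> B False 2" for e
    using that corner unfolding B0 B2 by blast
  have inc_B: "incident e (c, i) \<Longrightarrow> lab e = Gen_b \<Longrightarrow> (i = 0 \<and> flab c = 0 \<and> e \<in> D) \<or>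
      (i = 0 \<and> flab c = 1 \<and> e \<in> B True 0) \<or> (i = 2 \<and> flab c = 1 \<and> e \<in> B False 2)" for e c i
    using square_incidence[of e c i] by (auto simp: B_def D_def)
  have B_inc: "\<exists>c\<in>?T. incident e (c, 0)" if "e \<in> B True 0" for e
    using that len unfolding B0 by (auto simp: incident_def)
  have B_inc2: "\<exists>c\<in>?T. incident e (c, 2)" if "e \<in> B False 2" for e
    using that len unfolding B2 by (auto simp: incident_def)
  have uniq: "c = c'" if "incident e (c, i)" "incident e (c', i)" "lab e = Gen_b" "flab c = flab c'" for e c c' i
  proof -
    have "i < length (bdry Y c)" using that by (simp add: incident_def)
    then show ?thesis
      using square_incidence[OF that(1,3)] square_incidence[OF that(2,3)] that(4) face_inj[of c c' i] by auto
  qed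
  \<comment> \<open>A first side that is no third side, or conversely, needs a further 2-cell on it,
    as there is no free vertical edge; only a disc is possible.\<close>
  have ends: "e \<in> D" if "e \<in> B True 0 \<and> e \<notin> B False 2 \<or> e \<in> B False 2 \<and> e \<notin> B True 0" for e
  proof -
    have le: "lab e = Gen_b" "e \<in> edges Y" using lab_B that by auto
    show ?thesis
    proof (cases "e \<in> B True 0")
      case True
      then have e2: "e \<notin> B False 2" using that by blast
      obtain c where c: "c \<in> ?T" "incident e (c, 0)" using B_inc[OF True] by blast
      obtain c' i' where ci': "incident e (c', i')" "(c', i') \<noteq> (c, 0)"
        using nofree[OF le(2,1) c(2)] by auto
      have "\<not> (i' = 0 \<and> flab c' = 1)"
        using uniq[OF c(2), of c'] ci' c(1) le by auto
      then show ?thesis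
        using inc_B[OF ci'(1) le(1)] e2 by blast
    next
      case False
      then have e2: "e \<in> B False 2" using that by blast
      obtain c where c: "c \<in> ?T" "incident e (c, 2)" using B_inc2[OF e2] by blast
      obtain c' i' where ci': "incident e (c', i')" "(c', i') \<noteq> (c, 2)"
        using nofree[OF le(2,1) c(2)] by auto
      have "\<not> (i' = 2 \<and> flab c' = 1)"
        using uniq[OF c(2), of c'] ci' c(1) le by auto
      then show ?thesis
        using inc_B[OF ci'(1) le(1)] False by blast
    qed
  qed
  have D_edge: "\<exists>c\<in>faces Y. flab c = 0 \<and> bdry Y c = [(e, True)] \<and> e \<in> edges Y \<and> lab e = Gen_b \<and> src Y e = tgt Y e"
    if eD: "e \<in> D" for e
  proof -
    obtain c where c: "c \<in> faces Y" "flab c = 0" "bdry Y c ! 0 = (e, True)"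
      using eD by (auto simp: D_def)
    obtain e' where "bdry Y c = [(e', True)]" "e' \<in> edges Y" "lab e' = Gen_b" "src Y e' = tgt Y e'"
      using face_disc[OF c(1,2)] by metis
    then show ?thesis using c by (intro bexI[of _ c]) auto
  qed
  \<comment> \<open>The chain must start at a disc whose edge is also a first side. If first and
    third sides are the same edges, the given disc qualifies, its edge lying on some square.
    Otherwise some first side is no third side and therefore bounds a disc.\<close>
  obtain e0 where e0: "e0 \<in> B True 0" "e0 \<in> D"
  proof (cases "B True 0 \<subseteq> B False 2")
    case True
    then have "B True 0 = B False 2"
      using cardB by (simp add: card_subset_eq)
    moreover obtain e where e: "bdry Y d' = [(e, True)]" "e \<in> edges Y" "lab e = Gen_b"
      using face_disc[OF disc] by metis
    have "e \<in> D" using e disc by (auto simp: D_def intro!: bexI[of _ d'])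
    have inc: "incident e (d', 0)" using e disc by (simp add: incident_def)
    obtain c' i' where ci': "incident e (c', i')" "(c', i') \<noteq> (d', 0)"
      using nofree[OF e(2,3) inc] by auto
    have "e \<in> B True 0 \<or> e \<in> B False 2"
      using inc_B[OF ci'(1) e(3)] ci' uniq[OF inc _ e(3), of c'] disc by auto
    ultimately show ?thesis using that \<open>e \<in> D\<close> by auto
  next
    case False
    then show ?thesis using that ends by blast
  qed

  \<comment> \<open>The chain of squares from the disc\<close>
  define F where "F e = (SOME c. c \<in> ?T \<and> bdry Y c ! 0 = (e, True))" for e
  have F: "F e \<in> ?T" "bdry Y (F e) ! 0 = (e, True)" if "e \<in> B True 0" for e
  proof -
    have "\<exists>c. c \<in> ?T \<and> bdry Y c ! 0 = (e, True)"
      using that by (auto simp: B_def)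
    from someI_ex[OF this] show "F e \<in> ?T" "bdry Y (F e) ! 0 = (e, True)"
      by (auto simp: F_def)
  qed
  define es where "es = rec_nat e0 (\<lambda>_ e. fst (bdry Y (F e) ! 2))"
  define c where "c i = F (es i)" for i
  define x where "x i = fst (bdry Y (c i) ! 1)" for i
  define y where "y i = fst (bdry Y (c i) ! 3)" for i
  define z where "z i = fst (bdry Y (c i) ! 4)" for i
  have es0: "es 0 = e0" and esS: "es (Suc i) = fst (bdry Y (c i) ! 2)" for i
    by (simp_all add: es_def c_def)
  have shape: "c i \<in> ?T \<and> bdry Y (c i) = [(es i, True), (x i, True), (es (Suc i), False), (y i, False), (z i, False)] \<and>
    {es i, x i, es (Suc i), y i, z i} \<subseteq> edges Y \<and> lab (es i) = Gen_b \<and> lab (x i) = Gen_a \<and> lab (es (Suc i)) = Gen_b \<and>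
    lab (y i) = Gen_a \<and> lab (z i) = Gen_a \<and>
    tgt Y (es i) = src Y (x i) \<and> tgt Y (x i) = tgt Y (es (Suc i)) \<and> src Y (es (Suc i)) = tgt Y (y i) \<and>
    src Y (y i) = tgt Y (z i) \<and> src Y (z i) = src Y (es i)" if "es i \<in> B True 0" for i
    using sq[OF F(1)[OF that]] F[OF that] unfolding x_def y_def z_def esS c_def by auto
  \<comment> \<open>One step along a horizontal edge. Foldedness makes it, and all its powers,
    partial injections.\<close>
  define A where "A = {(src Y e, tgt Y e) | e. e \<in> edges Y \<and> lab e = Gen_a}"
  have svA: "single_valued (A ^^ k)" "single_valued ((A ^^ k)\<inverse>)" for k
    using src_inj tgt_inj by (intro single_valued_relpow single_valued_converse_relpow; force simp: A_def single_valued_def)+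
  define v where "v = src Y e0"
  have v: "tgt Y e0 = v" "lab e0 = Gen_b" "e0 \<in> edges Y"
    using D_edge[OF e0(2)] by (auto simp: v_def)
  \<comment> \<open>Each square advances the path through \<open>x\<close> by one step and the path
    through \<open>z\<close> and \<open>y\<close> by two.\<close>
  have paths: "(v, tgt Y (es k)) \<in> A ^^ k \<and> (v, src Y (es k)) \<in> A ^^ (2 * k)"
    if "\<And>i. i < k \<Longrightarrow> es i \<in> B True 0" for k
    using that
  proof (induction k)
    case 0
    then show ?case using v by (simp add: es0 v_def)
  next
    case (Suc k)
    have IH: "(v, tgt Y (es k)) \<in> A ^^ k" "(v, src Y (es k)) \<in> A ^^ (2 * k)"
      using Suc by auto
    have sh: "{x k, y k, z k} \<subseteq> edges Y" "lab (x k) = Gen_a" "lab (y k) = Gen_a" "lab (z k) = Gen_a"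
      "tgt Y (es k) = src Y (x k)" "tgt Y (x k) = tgt Y (es (Suc k))" "src Y (es (Suc k)) = tgt Y (y k)"
      "src Y (y k) = tgt Y (z k)" "src Y (z k) = src Y (es k)"
      using shape[OF Suc.prems[of k]] by auto
    have "(tgt Y (es k), tgt Y (es (Suc k))) \<in> A" "(src Y (es k), tgt Y (z k)) \<in> A" "(tgt Y (z k), src Y (es (Suc k))) \<in> A"
      using sh unfolding A_def by (auto 0 4 intro: exI[of _ "x k"] exI[of _ "y k"] exI[of _ "z k"])
    then show ?case
      using IH by (auto intro: relpow_Suc_I)
  qed
  \<comment> \<open>If the chain stopped at \<open>es i\<close>, that edge would bound a disc and be
    a loop at a vertex \<open>w\<close>. Then \<open>i\<close> steps and \<open>2 * i\<close> steps
    from \<open>v\<close> both lead to \<open>w\<close>, so \<open>i\<close> steps lead to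
    \<open>w\<close> from \<open>v\<close> and from \<open>w\<close>. By injectivity
    \<open>w = v\<close>, and the edge is \<open>e0\<close> after all.\<close>
  have inB: "es i \<in> B True 0" for i
  proof (induction i rule: less_induct)
    case (less i)
    show ?case
    proof (cases i)
      case 0
      then show ?thesis using e0 es0 by simp
    next
      case (Suc k)
      show ?thesis
      proof (rule ccontr)
        assume nin: "es i \<notin> B True 0"
        have sh: "c k \<in> ?T" "bdry Y (c k) ! 2 = (es i, False)"
          using shape[of k] less Suc by auto
        then have "es i \<in> B False 2"
          by (auto simp: B_def)
        then have "es i \<in> D" using ends nin by blast
        then have loop: "src Y (es i) = tgt Y (es i)" "es i \<in> edges Y" "lab (es i) = Gen_b"
          using D_edge by auto
        let ?w = "tgt Y (es i)"
        have vw: "(v, ?w) \<in> A ^^ i" "(v, ?w) \<in> A ^^ (i + i)"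
          using paths[of i] less loop(1) by (simp_all add: mult_2)
        then obtain w' where w': "(v, w') \<in> A ^^ i" "(w', ?w) \<in> A ^^ i"
          unfolding relpow_add by blast
        have "w' = ?w"
          using single_valuedD[OF svA(1) w'(1) vw(1)] .
        then have "(?w, w') \<in> (A ^^ i)\<inverse>" "(?w, v) \<in> (A ^^ i)\<inverse>"
          using w' vw(1) by auto
        then have "w' = v"
          by (rule single_valuedD[OF svA(2)])
        then have "src Y (es i) = src Y e0"
          using \<open>w' = ?w\<close> loop(1) by (simp add: v_def)
        then have "es i = e0"
          using src_inj[of "es i" e0] loop(2,3) v(2,3) by simp
        then show False using nin e0 by simp
      qed
    qed
  qed

  \<comment> \<open>The closed chain and its period\<close>
  note sh = shape[OF inB]
  have cT: "c i \<in> ?T" for i using sh by blast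
  have bc: "bdry Y (c i) = [(es i, True), (x i, True), (es (Suc i), False), (y i, False), (z i, False)]" for i
    using sh by blast
  have eds: "es i \<in> edges Y" "x i \<in> edges Y" "y i \<in> edges Y" "z i \<in> edges Y" for i
    using sh[of i] by auto
  have labs: "lab (es i) = Gen_b" "lab (x i) = Gen_a" "lab (y i) = Gen_a" "lab (z i) = Gen_a" for i
    using sh[of i] by auto
  have adj: "tgt Y (es i) = src Y (x i)" "tgt Y (x i) = tgt Y (es (Suc i))" "src Y (es (Suc i)) = tgt Y (y i)"
    "src Y (y i) = tgt Y (z i)" "src Y (z i) = src Y (es i)" for i
    using sh[of i] by auto
  have px: "(v, src Y (x k)) \<in> A ^^ k" for k
    using paths[of k] inB adj(1) by auto
  \<comment> \<open>Both edges start at position \<open>2 * i\<close>, and a vertex has at most one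
    outgoing horizontal edge.\<close>
  have zx: "z i = x (2 * i)" for i
  proof -
    have "(v, src Y (z i)) \<in> A ^^ (2 * i)"
      using paths[of i] inB adj by auto
    then have "src Y (z i) = src Y (x (2 * i))"
      using px by (rule single_valuedD[OF svA(1)])
    then show ?thesis using src_inj[OF eds(4)[of i] eds(2)[of "2 * i"]] labs by simp
  qed
  have yx: "y i = x (2 * i + 1)" for i
  proof -
    have "src Y (y i) = tgt Y (x (2 * i))"
      using adj(4)[of i] zx by simp
    also have "\<dots> = src Y (x (2 * i + 1))"
      using adj(1)[of "Suc (2 * i)"] adj(2)[of "2 * i"] by simp
    finally show ?thesis using src_inj[OF eds(3)[of i] eds(2)[of "2 * i + 1"]] labs by simp
  qed
  \<comment> \<open>A square and its edges \<open>es i\<close>, \<open>es (Suc i)\<close> and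
    \<open>x i\<close> determine each other. This makes the step to the next square injective and
    gives all sequences the same period.\<close>
  have c_es: "c i = c j \<longleftrightarrow> es i = es j" for i j
  proof
    assume "c i = c j"
    then have "bdry Y (c i) ! 0 = bdry Y (c j) ! 0" by simp
    then show "es i = es j" unfolding bc by simp
  qed (simp add: c_def)
  have c_S: "c i = c j \<longleftrightarrow> es (Suc i) = es (Suc j)" for i j
  proof
    assume "c i = c j"
    then show "es (Suc i) = es (Suc j)" unfolding esS by simp
  next
    assume "es (Suc i) = es (Suc j)"
    then have "bdry Y (c i) ! 2 = bdry Y (c j) ! 2" unfolding bc by simp
    then show "c i = c j" using Tinj[OF cT[of i] cT[of j], of 2] by simp
  qed
  have c_x: "c i = c j \<longleftrightarrow> x i = x j" for i j
  proof
    assume "c i = c j"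
    then show "x i = x j" unfolding x_def by simp
  next
    assume "x i = x j"
    then have "bdry Y (c i) ! 1 = bdry Y (c j) ! 1" unfolding bc by simp
    then show "c i = c j" using Tinj[OF cT[of i] cT[of j], of 1] by simp
  qed
  have "range c \<subseteq> ?T"
    using cT by blast
  then have "finite (range c)"
    using finT by (rule finite_subset)
  moreover have "c i = c j \<longleftrightarrow> c (Suc i) = c (Suc j)" for i j
    using c_S c_es by blast
  ultimately obtain n where n: "n > 0" "\<And>i j. c i = c j \<longleftrightarrow> i mod n = j mod n"
    using periodic_sequence[of c] by blast
  have srcx: "x i = x j" if "src Y (x i) = src Y (x j)" for i j
    using that src_inj[OF eds(2)[of i] eds(2)[of j]] labs by simp
  let ?p = "\<lambda>i. src Y (x i)"
  have p_mod: "?p i = ?p j \<longleftrightarrow> i mod n = j mod n" for i j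
    using srcx[of i j] c_x[of i j] n(2)[of i j] by auto
  have src_es: "src Y (es i) = ?p (2 * i)" for i
    using adj(5)[of i] zx by simp
  have tgt_x: "tgt Y (x i) = ?p (Suc i)" for i
    using adj(1)[of "Suc i"] adj(2)[of i] by simp

  \<comment> \<open>The chain is the whole complex\<close>
  have dbl: "\<exists>j. ?p i = ?p (2 * j)" for i
  proof -
    \<comment> \<open>The \<open>n\<close> vertical edges start at \<open>n\<close> different
      vertices of the form \<open>?p (2 * j)\<close>, so doubling permutes the positions and every
      position is the start of some \<open>es j\<close>.\<close>
    have "inj_on (\<lambda>j. ?p (2 * j)) {..<n}"
    proof (rule inj_onI)
      fix i j assume ij: "i \<in> {..<n}" "j \<in> {..<n}" "?p (2 * i) = ?p (2 * j)"
      then have "es i = es j"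
        using src_inj[OF eds(1)[of i] eds(1)[of j]] labs src_es by simp
      then show "i = j"
        using ij c_es[of i j] n(2)[of i j] by simp
    qed
    moreover have "inj_on ?p {..<n}"
      using p_mod by (intro inj_onI) simp
    moreover have "(\<lambda>j. ?p (2 * j)) ` {..<n} \<subseteq> ?p ` {..<n}"
    proof
      fix u assume "u \<in> (\<lambda>j. ?p (2 * j)) ` {..<n}"
      then obtain j where "u = ?p (2 * j)" by blast
      then have "u = ?p (2 * j mod n)" "2 * j mod n < n"
        using p_mod n by auto
      then show "u \<in> ?p ` {..<n}" by blast
    qed
    ultimately have "(\<lambda>j. ?p (2 * j)) ` {..<n} = ?p ` {..<n}"
      by (intro card_subset_eq) (auto simp: card_image)
    moreover have "?p i \<in> ?p ` {..<n}"
      using p_mod[of i "i mod n"] n by auto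
    ultimately show ?thesis by (metis (no_types, lifting) imageE)
  qed
  have from_src: "w \<in> range x \<union> range es" if w: "w \<in> edges Y" "src Y w \<in> range ?p" for w
  proof -
    obtain i where i: "src Y w = ?p i" using w by blast
    show ?thesis
      using lab_cases[of w]
    proof
      assume "lab w = Gen_a"
      then have "w = x i" using src_inj[OF w(1) eds(2)[of i]] i labs by simp
      then show ?thesis by blast
    next
      assume b: "lab w = Gen_b"
      obtain j where "src Y w = src Y (es j)" using dbl[of i] i src_es by auto
      then have "w = es j" using src_inj[OF w(1) eds(1)[of j]] b labs by simp
      then show ?thesis by blast
    qed
  qed
  have from_tgt: "w \<in> range x \<union> range es" if w: "w \<in> edges Y" "tgt Y w \<in> range ?p" for w
  proof -
    obtain i where i: "tgt Y w = ?p i" using w by blast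
    show ?thesis
      using lab_cases[of w]
    proof
      assume a: "lab w = Gen_a"
      \<comment> \<open>The predecessor of position \<open>i\<close>, shifted by one period to stay
        within the naturals.\<close>
      have "tgt Y (x (i + n - 1)) = ?p (i + n)"
        using tgt_x[of "i + n - 1"] n by simp
      also have "\<dots> = ?p i" using p_mod by simp
      finally have "w = x (i + n - 1)" using tgt_inj[OF w(1) eds(2)[of "i + n - 1"]] i a labs by simp
      then show ?thesis by blast
    next
      assume "lab w = Gen_b"
      then have "w = es i" using tgt_inj[OF w(1) eds(1)[of i]] i labs adj(1)[of i] by simp
      then show ?thesis by blast
    qed
  qed
  have ends_in: "src Y w \<in> range ?p \<and> tgt Y w \<in> range ?p" if "w \<in> range x \<union> range es" for w
    using that tgt_x src_es adj(1) by auto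
  \<comment> \<open>Every edge touching a position belongs to the chain, so the set of positions is
    closed under edges.\<close>
  have verts: "verts Y = range ?p"
  proof -
    have "src Y w \<in> range ?p \<longleftrightarrow> tgt Y w \<in> range ?p" if "w \<in> edges Y" for w
      using from_src[OF that] from_tgt[OF that] ends_in by blast
    moreover have "range ?p \<subseteq> verts Y"
      using eds(2) cpx by (auto simp: is_two_complex_def)
    ultimately show ?thesis
      using conn unfolding edge_connected_def by (metis UNIV_not_empty image_is_empty)
  qed
  have edges: "edges Y = range x \<union> range es"
    using from_src verts cpx eds by (auto simp: is_two_complex_def)
  obtain d where d: "d \<in> faces Y" "flab d = 0" "bdry Y d = [(es 0, True)]"
    using D_edge[OF e0(2)] es0 by metis
  have faces: "faces Y = insert d (range c)"
  proof
    show "insert d (range c) \<subseteq> faces Y" using d cT by auto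
    show "faces Y \<subseteq> insert d (range c)"
    proof
      fix f assume f: "f \<in> faces Y"
      show "f \<in> insert d (range c)"
        using flab_cases[OF f]
      proof
        assume f0: "flab f = 0"
        then obtain w where w: "bdry Y f = [(w, True)]" "w \<in> edges Y" "lab w = Gen_b" "src Y w = tgt Y w"
          using face_disc[OF f] by metis
        then obtain j where j: "w = es j" using edges labs by auto
        \<comment> \<open>A disc makes \<open>es j\<close> a loop, so \<open>2 * j\<close> and
          \<open>j\<close> agree modulo \<open>n\<close>; then \<open>n\<close> divides
          \<open>j\<close> and the edge is the first one.\<close>
        then have "?p (j + j) = ?p (0 + j)" using w(4) src_es adj(1) by (simp add: mult_2)
        then have "(j + j) mod n = (0 + j) mod n" using p_mod by blast
        then have "j mod n = 0 mod n"
          using mod_eq_dvd_iff_nat[of j "j + j" n] by auto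
        then have "es j = es 0" using n c_es by blast
        then have "f = d"
          using face_inj[OF f d(1), of 0] f0 d w j by simp
        then show ?thesis by blast
      next
        assume f1: "flab f = 1"
        then have fT: "f \<in> ?T" using f by simp
        obtain e1 x1 e2 y1 z1 where w: "bdry Y f = [(e1, True), (x1, True), (e2, False), (y1, False), (z1, False)]"
          "x1 \<in> edges Y" "lab x1 = Gen_a"
          using sq[OF fT] by auto
        then obtain j where j: "x1 = x j" using edges labs by auto
        then have "f = c j"
          using Tinj[OF fT cT, of 1 j] w bc[of j] by simp
        then show ?thesis by blast
      qed
    qed
  qed
  show ?thesis
  proof (rule contractible_dunce[OF cpx n(1) verts edges faces])
    show "x i = x j \<longleftrightarrow> i mod n = j mod n" "es i = es j \<longleftrightarrow> i mod n = j mod n" "c i = c j \<longleftrightarrow> i mod n = j mod n" for i j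
      using n(2)[of i j] c_x[of i j] c_es[of i j] by auto
    show "x i \<noteq> es j" for i j using labs(1)[of j] labs(2)[of i] by auto
    show "c i \<noteq> d" for i using cT[of i] d by auto
    show "bdry Y (c i) = [(es i, True), (x i, True), (es (Suc i), False), (x (2 * i + 1), False), (x (2 * i), False)]" for i
      using bc zx yx by simp
  qed (use srcx d in auto)
qed

end

text \<open>Both kinds of collapse remove one edge together with one face or vertex, so the Euler
  characteristic is kept and contractibility is inherited backwards. This drives an induction on the
  number of edges.\<close>

theorem folded_complex_contracting:
  assumes "folded_complex Y lab flab" "edge_connected Y"
  shows "euler_char Y \<le> 0 \<or> contractible_space (space_of Y)"
  using assms
proof (induction "card (edges Y)" arbitrary: Y rule: less_induct)
  case less
  interpret folded_complex Y lab flab by fact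
  show ?case
  proof (cases "\<exists>e c i. e \<in> edges Y \<and> lab e = Gen_b \<and> incident e (c, i) \<and> (\<forall>k. incident e k \<longrightarrow> k = (c, i))")
    case True
    then obtain e c i where e: "e \<in> edges Y" "incident e (c, i)" "\<And>k. incident e k \<Longrightarrow> k = (c, i)"
      by blast
    note free = free_edgeI[OF e(2,3)]
    have c: "c \<in> faces Y" using free by (simp add: free_edge_def)
    let ?Y = "remove_face_edge Y c e"
    have Y': "is_two_complex ?Y"
      using free by (intro is_two_complex_remove_face_edge[OF cpx]) (auto simp: free_edge_def)
    have card: "card (edges ?Y) = card (edges Y) - 1" "card (faces ?Y) = card (faces Y) - 1" "verts ?Y = verts Y"
      using e(1) c fin by (simp_all add: remove_face_edge_def)
    have pos: "card (edges Y) > 0" "card (faces Y) > 0"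
      using e(1) c fin by (auto simp: card_gt_0_iff)
    have "euler_char ?Y \<le> 0 \<or> contractible_space (space_of ?Y)"
      using card pos folded_remove_face_edge[OF Y'] edge_connected_remove_face_edge[OF less.prems(2) free(1) free(2)[symmetric]]
      by (intro less.hyps) auto
    moreover have "euler_char ?Y = euler_char Y"
      using card pos by (simp add: euler_char_def of_nat_diff)
    ultimately show ?thesis
      using deforms_into_contractible[OF deforms_into_remove_face_edge[OF cpx free(1) free(2)[symmetric]]] by auto
  next
    case nofree: False
    show ?thesis
    proof (cases "\<exists>v\<in>verts Y. card (out_letters v) = 1")
      case True
      then obtain v y s where v: "v \<in> verts Y" "out_letters v = {(y, s)}"
        by (metis card_1_singletonE surj_pair)
      note leaf = leafI[OF v(2)]
      have y: "y \<in> edges Y" using leaf by (simp add: leaf_def)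
      let ?Y = "remove_leaf Y v y"
      have Y': "is_two_complex ?Y"
        using is_two_complex_remove_leaf[OF cpx leaf] by simp
      have card: "card (edges ?Y) = card (edges Y) - 1" "card (verts ?Y) = card (verts Y) - 1" "faces ?Y = faces Y"
        using y v fin by (simp_all add: remove_leaf_def)
      have pos: "card (edges Y) > 0" "card (verts Y) > 0"
        using y v fin by (auto simp: card_gt_0_iff)
      have "edge_connected ?Y"
        using edge_connected_remove_leaf[OF less.prems(2) leaf] by simp
      then have "euler_char ?Y \<le> 0 \<or> contractible_space (space_of ?Y)"
        using card pos folded_remove_leaf[OF Y'] by (intro less.hyps) auto
      moreover have "euler_char ?Y = euler_char Y"
        using card pos by (simp add: euler_char_def of_nat_diff)
      ultimately show ?thesis
        using deforms_into_contractible[OF deforms_into_remove_leaf[OF cpx leaf]] by auto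
    next
      case noleaf: False
      show ?thesis
      proof (cases "\<exists>d\<in>faces Y. flab d = 0")
        case True
        then show ?thesis
          using contractible_of_disc[OF less.prems(2)] nofree by blast
      next
        case nodisc: False
        show ?thesis
        \<comment> \<open>A vertex without edges is the whole complex by connectedness; otherwise
          all valences are at least 2 and the counting argument applies.\<close>
        proof (cases "\<exists>v\<in>verts Y. out_letters v = {}")
          case True
          then obtain v where v: "v \<in> verts Y" "out_letters v = {}" by blast
          have nv: "src Y e \<noteq> v" "tgt Y e \<noteq> v" if "e \<in> edges Y" for e
          proof -
            have "(e, True) \<notin> out_letters v" "(e, False) \<notin> out_letters v" using v by auto
            then show "src Y e \<noteq> v" "tgt Y e \<noteq> v" using that by (auto simp: out_letters_def letter_start_def)
          qed
          then have V: "verts Y = {v}"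
            using less.prems(2)[unfolded edge_connected_def, rule_format, of "{v}"] v by auto
          then have "edges Y = {}"
            using nv cpx by (fastforce simp: is_two_complex_def)
          moreover from this have "faces Y = {}"
            using bdry_edges[OF cpx _ bdry_pos[OF cpx]] by blast
          ultimately have "topspace (space_of Y) \<subseteq> {Vert v}"
            using V by (simp add: topspace_space_of[OF cpx] points_eq)
          then show ?thesis
            by (intro disjI2 contractible_space_subset_singleton)
        next
          case False
          have "2 \<le> card (out_letters v)" if "v \<in> verts Y" for v
          proof -
            have "finite (out_letters v)"
            proof (rule finite_subset)
              show "out_letters v \<subseteq> edges Y \<times> UNIV" by (auto simp: out_letters_def)
            qed (use fin in auto)
            then have "card (out_letters v) \<noteq> 0" "card (out_letters v) \<noteq> 1"
              using False noleaf that by auto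
            then show ?thesis by linarith
          qed
          moreover have "flab c = 1" if "c \<in> faces Y" for c
            using nodisc flab_cases[OF that] that by blast
          ultimately show ?thesis
            using euler_char_nonpos nofree by blast
        qed
      qed
    qed
  qed
qed

section \<open>Extending lifts to the boundary of a cell\<close>

lemma finite_disjoint_neighbourhoods:
  assumes H: "Hausdorff_space X" and F: "finite F" "F \<subseteq> topspace X"
    and N: "\<And>y. y \<in> F \<Longrightarrow> openin X (N y) \<and> y \<in> N y"
  obtains V where "\<And>y. y \<in> F \<Longrightarrow> openin X (V y) \<and> y \<in> V y \<and> V y \<subseteq> N y"
    "\<And>y y'. y \<in> F \<Longrightarrow> y' \<in> F \<Longrightarrow> y \<noteq> y' \<Longrightarrow> V y \<inter> V y' = {}"
proof -
  have "\<exists>A B. openin X A \<and> openin X B \<and> y \<in> A \<and> y' \<in> B \<and> disjnt A B"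
    if "y \<in> F" "y' \<in> F" "y \<noteq> y'" for y y'
    using H that F(2) unfolding Hausdorff_space_def by (metis subsetD)
  then obtain A B where AB: "\<And>y y'. y \<in> F \<Longrightarrow> y' \<in> F \<Longrightarrow> y \<noteq> y' \<Longrightarrow>
      openin X (A y y') \<and> openin X (B y y') \<and> y \<in> A y y' \<and> y' \<in> B y y' \<and> disjnt (A y y') (B y y')"
    by metis
  define V where "V y = \<Inter>(insert (N y) ((\<lambda>y'. A y y' \<inter> B y' y) ` (F - {y})))" for y
  show ?thesis
  proof
    fix y assume y: "y \<in> F"
    have "openin X (V y)"
      unfolding V_def using F(1) N[OF y] AB y by (intro openin_Inter) auto
    then show "openin X (V y) \<and> y \<in> V y \<and> V y \<subseteq> N y"
      using N[OF y] AB y by (auto simp: V_def)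
  next
    fix y y' assume y: "y \<in> F" "y' \<in> F" "y \<noteq> y'"
    then have "V y \<subseteq> A y y'" "V y' \<subseteq> B y y'"
      by (auto simp: V_def)
    then show "V y \<inter> V y' = {}"
      using AB[OF y] by (auto simp: disjnt_def)
  qed
qed

text \<open>Near \<open>z\<close> the values of \<open>u\<close> stay close to the finite fibre over
  \<open>\<phi> z\<close>, because \<open>f\<close> maps the compact rest of \<open>Y\<close> to a
  closed set missing \<open>\<phi> z\<close>. Fibre points have disjoint neighbourhoods and a small
  convex piece of \<open>S\<close> has connected image, so \<open>u\<close> approaches one fibre
  point only.\<close>

lemma extend_lift:
  fixes S C :: "'a::real_normed_vector set"
  assumes comp: "compact_space Y" and HY: "Hausdorff_space Y" and HX: "Hausdorff_space X"
    and f: "continuous_map Y X f" and S: "convex S" "S \<subseteq> C" "C \<subseteq> closure S"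
    and \<phi>: "continuous_map (top_of_set C) X \<phi>" and u: "continuous_map (top_of_set S) Y u"
    and fu: "\<And>s. s \<in> S \<Longrightarrow> f (u s) = \<phi> s"
    and fib: "\<And>z. z \<in> C \<Longrightarrow> finite {y \<in> topspace Y. f y = \<phi> z}"
  obtains w where "continuous_map (top_of_set C) Y w" "\<And>s. s \<in> S \<Longrightarrow> w s = u s" "\<And>z. z \<in> C \<Longrightarrow> f (w z) = \<phi> z"
proof -
  have uY: "u s \<in> topspace Y" if "s \<in> S" for s
    using continuous_map_funspace[OF u] that by auto
  have near: "\<exists>s\<in>S. dist s z < e" if "z \<in> C" "e > 0" for z e
    using that S(3) closure_approachable by blast
  \<comment> \<open>\<open>y\<close> lies over \<open>\<phi> z\<close> and is the limit of
    \<open>u\<close> at \<open>z\<close>.\<close>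
  define P where "P z y \<longleftrightarrow> y \<in> topspace Y \<and> f y = \<phi> z \<and>
    (\<forall>N. openin Y N \<and> y \<in> N \<longrightarrow> (\<exists>e>0. u ` (S \<inter> ball z e) \<subseteq> N))" for z y
  have ex: "\<exists>y. P z y" if z: "z \<in> C" for z
  proof (rule ccontr)
    assume no: "\<nexists>y. P z y"
    define F where "F = {y \<in> topspace Y. f y = \<phi> z}"
    have "\<exists>N. openin Y N \<and> y \<in> N \<and> (\<forall>e>0. \<not> u ` (S \<inter> ball z e) \<subseteq> N)" if "y \<in> F" for y
    proof -
      have "\<not> P z y" using no by blast
      then have "\<not> (\<forall>N. openin Y N \<and> y \<in> N \<longrightarrow> (\<exists>e>0. u ` (S \<inter> ball z e) \<subseteq> N))"
        using that unfolding P_def F_def by simp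
      then show ?thesis by meson
    qed
    then obtain N where N: "\<And>y. y \<in> F \<Longrightarrow> openin Y (N y) \<and> y \<in> N y \<and> (\<forall>e>0. \<not> u ` (S \<inter> ball z e) \<subseteq> N y)"
      by metis
    have "finite F" "F \<subseteq> topspace Y"
      using fib[OF z] by (auto simp: F_def)
    then obtain V where V: "\<And>y. y \<in> F \<Longrightarrow> openin Y (V y) \<and> y \<in> V y \<and> V y \<subseteq> N y"
      "\<And>y y'. y \<in> F \<Longrightarrow> y' \<in> F \<Longrightarrow> y \<noteq> y' \<Longrightarrow> V y \<inter> V y' = {}"
      using finite_disjoint_neighbourhoods[OF HY, of F N] N by blast
    define W where "W = \<Union>(V ` F)"
    have W: "openin Y W" using V(1) by (auto simp: W_def)
    have "closedin Y (topspace Y - W)"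
      using W by blast
    then have "compactin X (f ` (topspace Y - W))"
      using image_compactin[OF closedin_compact_space[OF comp] f] by blast
    then have cl: "closedin X (f ` (topspace Y - W))"
      using compactin_imp_closedin[OF HX] by blast
    have "openin (top_of_set C) {z' \<in> topspace (top_of_set C). \<phi> z' \<in> topspace X - f ` (topspace Y - W)}"
      using openin_continuous_map_preimage[OF \<phi> openin_diff[OF openin_topspace cl]] .
    moreover have "z \<in> {z' \<in> topspace (top_of_set C). \<phi> z' \<in> topspace X - f ` (topspace Y - W)}"
      using z continuous_map_funspace[OF \<phi>] V(1) by (auto simp: W_def F_def)
    ultimately obtain e where e: "e > 0"
      "ball z e \<inter> C \<subseteq> {z' \<in> topspace (top_of_set C). \<phi> z' \<in> topspace X - f ` (topspace Y - W)}"
      by (meson openin_contains_ball)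
    have uW: "u s \<in> W" if "s \<in> S \<inter> ball z e" for s
    proof (rule ccontr)
      assume "u s \<notin> W"
      then have "\<phi> s \<in> f ` (topspace Y - W)"
        using fu[of s] uY[of s] that by (intro image_eqI[of _ _ "u s"]) auto
      moreover have "s \<in> ball z e \<inter> C" using that S(2) by blast
      ultimately show False using e(2) by auto
    qed
    have conn: "connectedin Y (u ` (S \<inter> ball z e))"
    proof (rule connectedin_continuous_map_image[OF u])
      have "connected (S \<inter> ball z e)"
        using S(1) convex_ball by (intro convex_connected convex_Int)
      then show "connectedin (top_of_set S) (S \<inter> ball z e)"
        by (simp add: connectedin_subtopology)
    qed
    obtain s0 where s0: "s0 \<in> S" "dist s0 z < e"
      using near[OF z e(1)] by blast
    then have s0': "s0 \<in> S \<inter> ball z e" by (simp add: dist_commute)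
    obtain y where y: "y \<in> F" "u s0 \<in> V y"
      using uW[OF s0'] by (auto simp: W_def)
    define W' where "W' = \<Union>(V ` (F - {y}))"
    have "openin Y W'" using V(1) by (auto simp: W'_def)
    moreover have "V y \<inter> W' = {}" using V(2) y by (auto simp: W'_def)
    moreover have "u ` (S \<inter> ball z e) \<subseteq> V y \<union> W'"
    proof -
      have "W \<subseteq> V y \<union> W'" by (auto simp: W_def W'_def)
      then show ?thesis using uW by blast
    qed
    moreover have "u s0 \<in> V y \<inter> u ` (S \<inter> ball z e)"
      using y s0' by blast
    ultimately have "W' \<inter> u ` (S \<inter> ball z e) = {}"
      using conn V(1)[OF y(1)] unfolding connectedin by (metis (no_types, lifting) Int_empty_left emptyE)
    then have "u ` (S \<inter> ball z e) \<subseteq> N y"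
      using \<open>u ` (S \<inter> ball z e) \<subseteq> V y \<union> W'\<close> V(1)[OF y(1)] by blast
    then show False
      using N[OF y(1)] e(1) by blast
  qed
  have P_u: "P z (u z)" if z: "z \<in> S" for z
  proof -
    have "\<exists>e>0. u ` (S \<inter> ball z e) \<subseteq> N" if N: "openin Y N" "u z \<in> N" for N
    proof -
      have "openin (top_of_set S) {s \<in> topspace (top_of_set S). u s \<in> N}"
        using openin_continuous_map_preimage[OF u N(1)] .
      moreover have "z \<in> {s \<in> topspace (top_of_set S). u s \<in> N}"
        using z N by simp
      ultimately obtain e where "e > 0" "ball z e \<inter> S \<subseteq> {s \<in> topspace (top_of_set S). u s \<in> N}"
        by (meson openin_contains_ball)
      then show ?thesis by blast
    qed
    then show ?thesis
      using z uY fu by (simp add: P_def)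
  qed
  define w where "w z = (if z \<in> S then u z else (SOME y. P z y))" for z
  have Pw: "P z (w z)" if "z \<in> C" for z
    using P_u someI_ex[OF ex[OF that]] by (auto simp: w_def)
  \<comment> \<open>On the boundary \<open>w\<close> is only a limit of values of \<open>u\<close>,
    so neighbourhoods are replaced by closed ones, which contain such limits.\<close>
  have reg: "neighbourhood_base_of (closedin Y) Y"
    using compact_Hausdorff_imp_regular_space[OF comp HY] by (simp add: neighbourhood_base_of_closedin)
  have "continuous_map (top_of_set C) Y w"
    unfolding continuous_map_def
  proof (intro conjI allI impI)
    show "w \<in> topspace (top_of_set C) \<rightarrow> topspace Y"
      using Pw by (auto simp: P_def)
    fix N assume N: "openin Y N"
    show "openin (top_of_set C) {z \<in> topspace (top_of_set C). w z \<in> N}"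
      unfolding openin_contains_ball
    proof (intro conjI ballI)
      fix z assume "z \<in> {z \<in> topspace (top_of_set C). w z \<in> N}"
      then have z: "z \<in> C" "w z \<in> N" by auto
      then obtain U V where UV: "openin Y U" "closedin Y V" "w z \<in> U" "U \<subseteq> V" "V \<subseteq> N"
        using reg N unfolding neighbourhood_base_of by meson
      obtain e where e: "e > 0" "u ` (S \<inter> ball z e) \<subseteq> U"
        using Pw[OF z(1)] UV(1,3) unfolding P_def by blast
      have "w z' \<in> N" if z': "z' \<in> C" "z' \<in> ball z e" for z'
      proof (rule ccontr)
        assume "w z' \<notin> N"
        then have "w z' \<in> topspace Y - V"
          using Pw[OF z'(1)] UV(5) by (auto simp: P_def)
        moreover have "openin Y (topspace Y - V)"
          using UV(2) by blast
        ultimately obtain e' where e': "e' > 0" "u ` (S \<inter> ball z' e') \<subseteq> topspace Y - V"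
          using Pw[OF z'(1)] unfolding P_def by blast
        have "min e' (e - dist z z') > 0"
          using e' z' by simp
        then obtain s where s: "s \<in> S" "dist s z' < min e' (e - dist z z')"
          using near[OF z'(1)] by blast
        then have "s \<in> ball z' e'" "s \<in> ball z e"
          using dist_triangle[of z s z'] by (auto simp: dist_commute)
        then show False
          using e(2) e'(2) s UV(4) by blast
      qed
      then show "\<exists>e>0. ball z e \<inter> C \<subseteq> {z \<in> topspace (top_of_set C). w z \<in> N}"
        using e(1) by (intro exI[of _ e]) auto
    qed auto
  qed
  then show ?thesis
    using that[of w] Pw by (auto simp: w_def P_def)
qed

text \<open>The set where \<open>p\<close> and \<open>q\<close> agree is closed by the Hausdorff
  property and open by local injectivity of \<open>f\<close>.\<close>

lemma unique_lift:
  assumes conn: "connected_space Z" and HY: "Hausdorff_space Y"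
    and p: "continuous_map Z Y p" and q: "continuous_map Z Y q"
    and fpq: "\<And>z. z \<in> topspace Z \<Longrightarrow> f (p z) = f (q z)"
    and inj: "\<And>y. y \<in> topspace Y \<Longrightarrow> \<exists>U. openin Y U \<and> y \<in> U \<and> inj_on f U"
    and z0: "z0 \<in> topspace Z" "p z0 = q z0" and z: "z \<in> topspace Z"
  shows "p z = q z"
proof -
  let ?E = "{z \<in> topspace Z. p z = q z}"
  have "closedin Z ?E"
    by (rule closedin_continuous_maps_eq[OF HY p q])
  moreover have "openin Z ?E"
  proof (subst openin_subopen, intro ballI)
    fix t assume t: "t \<in> ?E"
    then have "t \<in> topspace Z" by simp
    then have "p t \<in> topspace Y" using continuous_map_funspace[OF p] by (rule funcset_mem[rotated])
    then obtain U where U: "openin Y U" "p t \<in> U" "inj_on f U"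
      using inj by blast
    let ?A = "{z \<in> topspace Z. p z \<in> U} \<inter> {z \<in> topspace Z. q z \<in> U}"
    have "openin Z ?A"
      using openin_continuous_map_preimage[OF p U(1)] openin_continuous_map_preimage[OF q U(1)] by blast
    moreover have "t \<in> ?A" using t U by auto
    moreover have "?A \<subseteq> ?E" using U(3) fpq by (auto dest: inj_onD)
    ultimately show "\<exists>T. openin Z T \<and> t \<in> T \<and> T \<subseteq> ?E" by blast
  qed
  ultimately have "?E = {} \<or> ?E = topspace Z"
    using conn unfolding connected_space_clopen_in by blast
  then show ?thesis using z0 z by blast
qed

text \<open>Inverts \<open>f\<close> over one open cell along the characteristic map
  \<open>\<iota>\<close> of the target; \<open>extend_lift\<close> will carry the result to the
  closed cell.\<close>

lemma cell_inverse:
  assumes hom: "homeomorphic_map (subtopology Y A) (subtopology X (f ` A)) f" and A: "A \<subseteq> topspace Y"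
    and \<iota>: "continuous_map (top_of_set S) X \<iota>" and im: "\<iota> ` S = f ` A"
  obtains u where "continuous_map (top_of_set S) Y u" "u ` S = A" "\<And>s. s \<in> S \<Longrightarrow> f (u s) = \<iota> s"
proof -
  obtain g where g: "homeomorphic_maps (subtopology Y A) (subtopology X (f ` A)) f g"
    using hom by (auto simp: homeomorphic_map_maps)
  have gf: "g (f x) = x" if "x \<in> A" for x
    using g that A by (auto simp: homeomorphic_maps_def)
  have "continuous_map (top_of_set S) (subtopology X (f ` A)) \<iota>"
    using \<iota> im by (simp add: continuous_map_in_subtopology Pi_iff) blast
  moreover have "continuous_map (subtopology X (f ` A)) Y g"
    using g by (auto simp: homeomorphic_maps_def continuous_map_in_subtopology)
  ultimately have "continuous_map (top_of_set S) Y (g \<circ> \<iota>)"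
    by (rule continuous_map_compose)
  moreover have "(g \<circ> \<iota>) ` S = A"
  proof -
    have "(g \<circ> \<iota>) ` S = (\<lambda>x. g (f x)) ` A"
      by (metis im image_comp image_image)
    also have "\<dots> = (\<lambda>x. x) ` A"
      by (rule image_cong) (simp_all add: gf)
    finally show ?thesis by simp
  qed
  moreover have "f ((g \<circ> \<iota>) s) = \<iota> s" if s: "s \<in> S" for s
  proof -
    have "\<iota> s \<in> f ` A"
      using im s by blast
    then obtain y where "y \<in> A" "\<iota> s = f y"
      by blast
    then show ?thesis using gf[of y] by simp
  qed
  ultimately show ?thesis using that by blast
qed

section \<open>Straightening an immersion\<close>

lemma compact_space_finite_complex:
  assumes Y: "is_two_complex Y" and fin: "finite (verts Y)" "finite (edges Y)" "finite (faces Y)"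
  shows "compact_space (space_of Y)"
proof -
  let ?\<U> = "(\<lambda>v. {Vert v}) ` verts Y \<union> (\<lambda>e. edge_map Y e ` {0..1}) ` edges Y \<union> (\<lambda>c. face_map Y c ` cball 0 1) ` faces Y"
  have "compactin (space_of Y) A" if A: "A \<in> ?\<U>" for A
  proof -
    have 1: "compactin (space_of Y) {Vert v}" if "v \<in> verts Y" for v
      using that by (auto simp: topspace_space_of[OF Y] intro: points_intros)
    have 2: "compactin (space_of Y) (edge_map Y e ` {0..1})" if "e \<in> edges Y" for e
      by (rule image_compactin[OF _ continuous_map_edge_map[OF Y that]]) (simp add: compactin_subtopology)
    have 3: "compactin (space_of Y) (face_map Y c ` cball 0 1)" if "c \<in> faces Y" for c
      by (rule image_compactin[OF _ continuous_map_face_map[OF Y that]]) (simp add: compactin_subtopology)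
    show ?thesis using A 1 2 3 by blast
  qed
  then have "compactin (space_of Y) (\<Union>?\<U>)"
    using fin by (intro compactin_Union) auto
  moreover have "points Y \<subseteq> \<Union>?\<U>"
  proof
    fix p assume "p \<in> points Y"
    then show "p \<in> \<Union>?\<U>"
    proof (cases rule: points_cases)
      case (EdgePt e t)
      then have "p \<in> edge_map Y e ` {0..1}"
        by (intro image_eqI[of _ _ t]) (auto simp: edge_map_def)
      then show ?thesis
        by (rule UnionI[rotated]) (intro UnI1 UnI2 imageI EdgePt(1))
    next
      case (FacePt c z)
      then have "p \<in> face_map Y c ` cball 0 1"
        by (intro image_eqI[of _ _ z]) (auto simp: face_map_interior)
      then show ?thesis
        by (rule UnionI[rotated]) (intro UnI2 imageI FacePt(1))
    qed auto
  qed
  moreover have "\<Union>?\<U> \<subseteq> points Y"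
    using compactin_subset_topspace[OF calculation(1)] by (simp only: topspace_space_of[OF Y])
  ultimately have "compactin (space_of Y) (points Y)"
    by (metis subset_antisym)
  then show ?thesis
    by (simp add: compact_space_def topspace_space_of[OF Y])
qed

text \<open>The words \<open>bdry Y\<close> need not match the relators, as the homeomorphisms of
  open cells may rotate, reflect or reparametrise. \<open>Y0\<close> keeps the cells of
  \<open>Y\<close>, but its ends and boundary words are read off from lifts of the characteristic
  maps of \<open>X\<close>.\<close>

lemma straighten_immersion:
  assumes Y: "is_two_complex Y" and X: "is_two_complex X" and comp: "compact_space (space_of Y)"
    and imm: "immersion Y X f"
  obtains Y0 :: "('v, 'e, 'f) two_complex" and lab flab where
    "is_two_complex Y0" "verts Y0 = verts Y" "edges Y0 = edges Y" "faces Y0 = faces Y"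
    "space_of Y0 homeomorphic_space space_of Y"
    "\<And>e. e \<in> edges Y \<Longrightarrow> lab e \<in> edges X" "\<And>c. c \<in> faces Y \<Longrightarrow> flab c \<in> faces X"
    "\<And>c. c \<in> faces Y \<Longrightarrow> label_word lab (bdry Y0 c) = bdry X (flab c)"
    "\<And>e e'. e \<in> edges Y \<Longrightarrow> e' \<in> edges Y \<Longrightarrow> lab e = lab e' \<Longrightarrow> src Y0 e = src Y0 e' \<Longrightarrow> e = e'"
    "\<And>e e'. e \<in> edges Y \<Longrightarrow> e' \<in> edges Y \<Longrightarrow> lab e = lab e' \<Longrightarrow> tgt Y0 e = tgt Y0 e' \<Longrightarrow> e = e'"
    "\<And>c c' i. c \<in> faces Y \<Longrightarrow> c' \<in> faces Y \<Longrightarrow> flab c = flab c' \<Longrightarrow> i < length (bdry Y0 c) \<Longrightarrow>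
      bdry Y0 c ! i = bdry Y0 c' ! i \<Longrightarrow> c = c'"
proof -
  have contf: "continuous_map (space_of Y) (space_of X) f"
    and cells: "\<And>n A. A \<in> open_cells Y n \<Longrightarrow> f ` A \<in> open_cells X n \<and>
        homeomorphic_map (subtopology (space_of Y) A) (subtopology (space_of X) (f ` A)) f"
    and locinj: "\<And>p. p \<in> topspace (space_of Y) \<Longrightarrow> \<exists>U. openin (space_of Y) U \<and> p \<in> U \<and> inj_on f U"
    using imm by (auto simp: immersion_def combinatorial_map_def)
  note HY = Hausdorff_space_of[OF Y] and HX = Hausdorff_space_of[OF X]
  note fin = finite_cells[OF Y comp]
  have sub: "A \<subseteq> points Y" if "A \<in> open_cells Y n" for A n
    using that unfolding points_def by blast
  have cellV: "{Vert v} \<in> open_cells Y 0" if "v \<in> verts Y" for v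
    using that by simp
  have cellE: "EdgePt e ` {0<..<1} \<in> open_cells Y (Suc 0)" if "e \<in> edges Y" for e
    using that by simp
  have cellF: "FacePt c ` ball 0 1 \<in> open_cells Y (Suc (Suc 0))" if "c \<in> faces Y" for c
    using that by simp
  have finj: "inj_on f A" if "A \<in> open_cells Y n" for A n
  proof -
    have "inj_on f (topspace (subtopology (space_of Y) A))"
      using cells[OF that] homeomorphic_imp_injective_map by blast
    moreover have "topspace (subtopology (space_of Y) A) = A"
      using sub[OF that] by (auto simp: topspace_subtopology topspace_space_of[OF Y])
    ultimately show ?thesis by simp
  qed

  \<comment> \<open>Finite fibres and lifted characteristic maps\<close>
  have fib: "finite {y \<in> topspace (space_of Y). f y = p}" for p
  proof -
    \<comment> \<open>\<open>f\<close> is injective on each of finitely many open cells, so a fibre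
      has at most one point in each.\<close>
    let ?C = "open_cells Y 0 \<union> open_cells Y (Suc 0) \<union> open_cells Y (Suc (Suc 0))"
    have "finite {y \<in> A. f y = p}" if A: "A \<in> ?C" for A
    proof -
      have "inj_on f A" using A finj by blast
      then have "{y \<in> A. f y = p} \<subseteq> {THE y. y \<in> A \<and> f y = p}"
        by (auto intro!: the_equality[symmetric] dest: inj_onD)
      then show ?thesis by (rule finite_subset) simp
    qed
    moreover have "finite ?C" using fin by simp
    ultimately have "finite (\<Union>A\<in>?C. {y \<in> A. f y = p})" by blast
    moreover have "{y \<in> topspace (space_of Y). f y = p} \<subseteq> (\<Union>A\<in>?C. {y \<in> A. f y = p})"
      unfolding topspace_space_of[OF Y] points_eq by auto
    ultimately show ?thesis by (rule finite_subset[rotated])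
  qed
  have "\<exists>g w. g \<in> edges X \<and> continuous_map unit_interval (space_of Y) w \<and> w ` {0<..<1} = EdgePt e ` {0<..<1} \<and>
      (\<forall>t\<in>{0..1}. f (w t) = edge_map X g t)" if e: "e \<in> edges Y" for e
  proof -
    let ?A = "EdgePt e ` {0<..<1} :: ('v, 'e, 'f) point set"
    obtain g where g: "g \<in> edges X" "f ` ?A = EdgePt g ` {0<..<1}"
      using cells[OF cellE[OF e]] by auto
    have eqX: "edge_map X g t = EdgePt g t" if "t \<in> {0<..<1}" for t
      using that by (auto simp: edge_map_def)
    have \<iota>: "continuous_map (top_of_set {0<..<1}) (space_of X) (edge_map X g)"
      by (rule continuous_map_from_subtopology_mono[OF continuous_map_edge_map[OF X g(1)]]) auto
    have "edge_map X g ` {0<..<1} = f ` ?A"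
      unfolding g by (rule image_cong) (simp_all add: eqX)
    then obtain u where u: "continuous_map (top_of_set {0<..<1}) (space_of Y) u" "u ` {0<..<1} = ?A"
      "\<And>t. t \<in> {0<..<1} \<Longrightarrow> f (u t) = edge_map X g t"
      using cell_inverse[OF conjunct2[OF cells[OF cellE[OF e]]] _ \<iota>] sub[OF cellE[OF e]] topspace_space_of[OF Y] by metis
    obtain w where w: "continuous_map unit_interval (space_of Y) w" "\<And>t. t \<in> {0<..<1} \<Longrightarrow> w t = u t"
      "\<And>t. t \<in> {0..1} \<Longrightarrow> f (w t) = edge_map X g t"
    proof (rule extend_lift[OF comp HY HX contf _ _ _ continuous_map_edge_map[OF X g(1)] u(1,3)])
      show "convex {0<..<1::real}" "{0<..<1::real} \<subseteq> {0..1}" "{0..1::real} \<subseteq> closure {0<..<1}"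
        by (auto simp: closure_greaterThanLessThan)
      show "finite {y \<in> topspace (space_of Y). f y = edge_map X g z}" for z
        by (rule fib)
    qed auto
    have "w ` {0<..<1} = u ` {0<..<1}"
      by (rule image_cong) (simp_all add: w(2) del: mem_ball)
    then have "w ` {0<..<1} = ?A"
      by (simp only: u(2))
    then show ?thesis
      by (intro exI[of _ g] exI[of _ w] conjI ballI g(1) w(1,3))
  qed
  then obtain lab ue where ue: "\<And>e. e \<in> edges Y \<Longrightarrow> lab e \<in> edges X"
    "\<And>e. e \<in> edges Y \<Longrightarrow> continuous_map unit_interval (space_of Y) (ue e)"
    "\<And>e. e \<in> edges Y \<Longrightarrow> ue e ` {0<..<1} = EdgePt e ` {0<..<1}"
    "\<And>e t. e \<in> edges Y \<Longrightarrow> t \<in> {0..1} \<Longrightarrow> f (ue e t) = edge_map X (lab e) t"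
    by metis
  have "\<exists>k w. k \<in> faces X \<and> continuous_map unit_disc (space_of Y) w \<and> w ` ball 0 1 = FacePt c ` ball 0 1 \<and>
      (\<forall>z\<in>cball 0 1. f (w z) = face_map X k z)" if c: "c \<in> faces Y" for c
  proof -
    let ?A = "FacePt c ` ball 0 1 :: ('v, 'e, 'f) point set"
    obtain k where k: "k \<in> faces X" "f ` ?A = FacePt k ` ball 0 1"
      using cells[OF cellF[OF c]] by auto
    have \<iota>: "continuous_map (top_of_set (ball 0 1)) (space_of X) (face_map X k)"
      by (rule continuous_map_from_subtopology_mono[OF continuous_map_face_map[OF X k(1)]]) auto
    have "face_map X k ` ball 0 1 = f ` ?A"
      unfolding k by (rule image_cong) (simp_all add: face_map_interior)
    then obtain u where u: "continuous_map (top_of_set (ball 0 1)) (space_of Y) u" "u ` ball 0 1 = ?A"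
      "\<And>t. t \<in> ball 0 1 \<Longrightarrow> f (u t) = face_map X k t"
      using cell_inverse[OF conjunct2[OF cells[OF cellF[OF c]]] _ \<iota>] sub[OF cellF[OF c]] topspace_space_of[OF Y] by metis
    obtain w where w: "continuous_map unit_disc (space_of Y) w" "\<And>t. t \<in> ball 0 1 \<Longrightarrow> w t = u t"
      "\<And>t. t \<in> cball 0 1 \<Longrightarrow> f (w t) = face_map X k t"
    proof (rule extend_lift[OF comp HY HX contf _ _ _ continuous_map_face_map[OF X k(1)] u(1,3)])
      show "convex (ball (0::complex) 1)" "ball (0::complex) 1 \<subseteq> cball 0 1" "cball (0::complex) 1 \<subseteq> closure (ball 0 1)"
        by auto
      show "finite {y \<in> topspace (space_of Y). f y = face_map X k z}" for z
        by (rule fib)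
    qed auto
    have "w ` ball 0 1 = u ` ball 0 1"
      by (rule image_cong) (simp_all add: w(2) del: mem_ball)
    then have "w ` ball 0 1 = ?A"
      by (simp only: u(2))
    then show ?thesis
      by (intro exI[of _ k] exI[of _ w] conjI ballI k(1) w(1,3))
  qed
  then obtain flab uf where uf: "\<And>c. c \<in> faces Y \<Longrightarrow> flab c \<in> faces X"
    "\<And>c. c \<in> faces Y \<Longrightarrow> continuous_map unit_disc (space_of Y) (uf c)"
    "\<And>c. c \<in> faces Y \<Longrightarrow> uf c ` ball 0 1 = FacePt c ` ball 0 1"
    "\<And>c z. c \<in> faces Y \<Longrightarrow> z \<in> cball 0 1 \<Longrightarrow> f (uf c z) = face_map X (flab c) z"
    by metis

  \<comment> \<open>How the lifts meet the open cells\<close>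
  have fV: "\<exists>w. f (Vert v) = Vert w" if "v \<in> verts Y" for v
    using cells[OF cellV[OF that]] by auto
  have fE: "\<exists>s. f (EdgePt e t) = EdgePt (lab e) s" if "e \<in> edges Y" "0 < t" "t < 1" for e t
  proof -
    have "EdgePt e t \<in> ue e ` {0<..<1}"
      using ue(3)[OF that(1)] that by auto
    then obtain s where "s \<in> {0<..<1}" "EdgePt e t = ue e s" by blast
    then show ?thesis using ue(4)[OF that(1), of s] by (auto simp: edge_map_def)
  qed
  have fF: "\<exists>s. f (FacePt c z) = FacePt (flab c) s" if "c \<in> faces Y" "cmod z < 1" for c z
  proof -
    have "FacePt c z \<in> uf c ` ball 0 1"
      using uf(3)[OF that(1)] that by auto
    then obtain s where "s \<in> ball 0 1" "FacePt c z = uf c s" by blast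
    then show ?thesis using uf(4)[OF that(1), of s] by (auto simp: face_map_interior)
  qed
  have vert_of: "\<exists>v\<in>verts Y. y = Vert v" if y: "y \<in> points Y" and fy: "f y = Vert w" for y w
    using y
  proof (cases rule: points_cases)
    case (EdgePt e t)
    then show ?thesis using fE[of e t] fy by auto
  next
    case (FacePt c z)
    then show ?thesis using fF[of c z] fy by auto
  qed auto
  have ueY: "ue e t \<in> points Y" if "e \<in> edges Y" "t \<in> {0..1}" for e t
    using continuous_map_funspace[OF ue(2)[OF that(1)]] that(2) by (auto simp: topspace_space_of[OF Y])
  have ufY: "uf c z \<in> points Y" if "c \<in> faces Y" "z \<in> cball 0 1" for c z
    using continuous_map_funspace[OF uf(2)[OF that(1)]] that(2) by (auto simp: topspace_space_of[OF Y] Pi_iff)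
  have "\<exists>v\<in>verts Y. ue e 0 = Vert v" "\<exists>v\<in>verts Y. ue e 1 = Vert v" if "e \<in> edges Y" for e
    using vert_of[OF ueY[OF that]] ue(4)[OF that] by (auto simp: edge_map_def)
  then obtain s0 t0 where st: "\<And>e. e \<in> edges Y \<Longrightarrow> s0 e \<in> verts Y \<and> ue e 0 = Vert (s0 e)"
    "\<And>e. e \<in> edges Y \<Longrightarrow> t0 e \<in> verts Y \<and> ue e 1 = Vert (t0 e)"
    by metis
  have conn_I: "connected_space unit_interval"
    by (simp add: connected_space_subtopology)
  have conn_D: "connected_space unit_disc"
    by (simp add: connected_space_subtopology convex_connected)
  have ue_mid: "\<exists>s. ue e t = EdgePt e s" if "e \<in> edges Y" "0 < t" "t < 1" for e t
  proof -
    have "ue e t \<in> ue e ` {0<..<1}"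
      using that by simp
    then show ?thesis
      unfolding ue(3)[OF that(1)] by blast
  qed
  have uf_mid: "\<exists>s. uf c z = FacePt c s" if "c \<in> faces Y" "cmod z < 1" for c z
  proof -
    have "uf c z \<in> FacePt c ` ball 0 1"
      using uf(3)[OF that(1)] that(2) by (metis dist_0_norm imageI mem_ball)
    then show ?thesis by blast
  qed

  \<comment> \<open>Boundary words of the lifts\<close>
  have letter: "\<exists>e. e \<in> edges Y \<and> lab e = fst (bdry X (flab c) ! i) \<and>
      (\<forall>t\<in>{0..1}. uf c (circ_pt (length (bdry X (flab c))) (real i + t)) =
        ue e (if snd (bdry X (flab c) ! i) then t else 1 - t))"
    if c: "c \<in> faces Y" and i: "i < length (bdry X (flab c))" for c i
  proof -
    let ?r = "bdry X (flab c)" and ?m = "length (bdry X (flab c))"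
    let ?o = "\<lambda>t. if snd (?r ! i) then t else 1 - t :: real"
    note cl = closed_bdry[OF X uf(1)[OF c]]
    define p where "p t = uf c (circ_pt ?m (real i + t))" for t
    have fp: "f (p t) = edge_map X (fst (?r ! i)) (?o t)" if "t \<in> {0..1}" for t
      using uf(4)[OF c, of "circ_pt ?m (real i + t)"] face_map_arc[OF cl i, of t] that
      by (simp add: p_def letter_map_def)
    have pY: "p t \<in> points Y" for t
      unfolding p_def by (rule ufY[OF c]) simp
    \<comment> \<open>The midpoint of an arc lies over an inner point of an edge and is fixed by
      reversal. There the lift of the 2-cell meets some \<open>ue e\<close>, and unique lifting
      spreads the coincidence over the whole arc.\<close>
    have half: "f (p (1/2)) = EdgePt (fst (?r ! i)) (1/2)"
      using fp[of "1/2"] by (simp add: edge_map_def)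
    obtain e where e: "e \<in> edges Y" "lab e = fst (?r ! i)" "p (1/2) = ue e (1/2)"
      using pY[of "1/2"]
    proof (cases rule: points_cases)
      case (Vert v)
      then show ?thesis using fV[of v] half by auto
    next
      case (FacePt c' z)
      then show ?thesis using fF[of c' z] half by auto
    next
      case (EdgePt e s)
      then have "p (1/2) \<in> ue e ` {0<..<1}"
        using ue(3)[of e] by auto
      then obtain s' where s': "s' \<in> {0<..<1}" "p (1/2) = ue e s'" by blast
      then have "f (p (1/2)) = EdgePt (lab e) s'"
        using ue(4)[OF EdgePt(1), of s'] by (auto simp: edge_map_def)
      then have "lab e = fst (?r ! i)" "s' = 1/2"
        using half by simp_all
      then show ?thesis using that[OF EdgePt(1)] s'(2) by blast
    qed
    have contp: "continuous_map unit_interval (space_of Y) p"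
    proof -
      have "?m > 0" using i by linarith
      then have "continuous_map unit_interval unit_disc (\<lambda>t. circ_pt ?m (real i + t))"
        unfolding circ_pt_def by (auto intro!: continuous_intros)
      from continuous_map_compose[OF this uf(2)[OF c]] show ?thesis
        by (simp add: o_def p_def[abs_def])
    qed
    have contq: "continuous_map unit_interval (space_of Y) (\<lambda>t. ue e (?o t))"
    proof -
      have "continuous_map unit_interval unit_interval ?o"
        by (cases "snd (?r ! i)") (auto intro!: continuous_intros)
      from continuous_map_compose[OF this ue(2)[OF e(1)]] show ?thesis
        by (simp add: o_def)
    qed
    have "p t = ue e (?o t)" if "t \<in> {0..1}" for t
    proof (rule unique_lift[OF conn_I HY contp contq _ locinj, of "1/2"])
      show "f (p z) = f (ue e (?o z))" if "z \<in> topspace unit_interval" for z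
        using fp[of z] ue(4)[OF e(1), of "?o z"] e(2) that by auto
      show "p (1/2) = ue e (?o (1/2))" using e(3) by simp
    qed (use that in auto)
    then show ?thesis using e by (auto simp: p_def)
  qed
  define le where "le c i = (SOME e. e \<in> edges Y \<and> lab e = fst (bdry X (flab c) ! i) \<and>
      (\<forall>t\<in>{0..1}. uf c (circ_pt (length (bdry X (flab c))) (real i + t)) =
        ue e (if snd (bdry X (flab c) ! i) then t else 1 - t)))" for c i
  have le: "le c i \<in> edges Y" "lab (le c i) = fst (bdry X (flab c) ! i)"
    "\<And>t. t \<in> {0..1} \<Longrightarrow> uf c (circ_pt (length (bdry X (flab c))) (real i + t)) =
        ue (le c i) (if snd (bdry X (flab c) ! i) then t else 1 - t)"
    if "c \<in> faces Y" "i < length (bdry X (flab c))" for c i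
    using someI_ex[OF letter[OF that]] unfolding le_def by blast+

  \<comment> \<open>The straightened complex\<close>
  define Y0 where "Y0 = \<lparr>verts = verts Y, edges = edges Y, faces = faces Y, src = s0, tgt = t0,
    bdry = (\<lambda>c. map (\<lambda>i. (le c i, snd (bdry X (flab c) ! i))) [0..<length (bdry X (flab c))])\<rparr>"
  have sel: "verts Y0 = verts Y" "edges Y0 = edges Y" "faces Y0 = faces Y" "src Y0 = s0" "tgt Y0 = t0"
    "length (bdry Y0 c) = length (bdry X (flab c))"
    "i < length (bdry X (flab c)) \<Longrightarrow> bdry Y0 c ! i = (le c i, snd (bdry X (flab c) ! i))" for c i
    by (simp_all add: Y0_def)
  have start: "uf c (circ_pt (length (bdry Y0 c)) (real i)) = Vert (letter_start Y0 (bdry Y0 c ! i))"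
    and finish: "uf c (circ_pt (length (bdry Y0 c)) (real i + 1)) = Vert (letter_end Y0 (bdry Y0 c ! i))"
    if c: "c \<in> faces Y" and i: "i < length (bdry Y0 c)" for c i
    using le(1)[OF c, of i] le(3)[OF c, of i 0] le(3)[OF c, of i 1] i st[of "le c i"]
    by (auto simp: sel letter_start_def letter_end_def)
  have Y0: "is_two_complex Y0"
    unfolding is_two_complex_def
  proof (intro conjI ballI)
    fix c assume "c \<in> faces Y0"
    then have c: "c \<in> faces Y" by (simp add: sel)
    let ?m = "length (bdry Y0 c)"
    have m: "?m > 0" using bdry_pos[OF X uf(1)[OF c]] by (simp add: sel)
    have "letter_end Y0 (bdry Y0 c ! i) = letter_start Y0 (bdry Y0 c ! (Suc i mod ?m))" if i: "i < ?m" for i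
    proof -
      have "circ_pt ?m (real i + 1) = circ_pt ?m (real (Suc i mod ?m))"
      proof (cases "Suc i = ?m")
        case True
        then have "real i + 1 = real ?m" by linarith
        moreover have "Suc i mod ?m = 0" using True by simp
        ultimately show ?thesis using circ_pt_period[OF m] by (simp only: of_nat_0)
      next
        case False
        then show ?thesis using i by (simp add: add.commute)
      qed
      then have "Vert (letter_end Y0 (bdry Y0 c ! i)) = (Vert (letter_start Y0 (bdry Y0 c ! (Suc i mod ?m))) :: ('v, 'e, 'f) point)"
        using finish[OF c i] start[OF c, of "Suc i mod ?m"] m by simp
      then show ?thesis by simp
    qed
    moreover have "bdry Y0 c \<noteq> []" using m by auto
    moreover have "fst ` set (bdry Y0 c) \<subseteq> edges Y0"
      using le(1)[OF c] by (auto simp: Y0_def)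
    ultimately show "closed_edge_path Y0 (bdry Y0 c)"
      unfolding closed_edge_path_def by blast
  qed (use st in \<open>auto simp: sel\<close>)

  \<comment> \<open>The homeomorphism with the given complex\<close>
  define \<Xi> where "\<Xi> q = (case q of Vert v \<Rightarrow> Vert v | EdgePt e s \<Rightarrow> ue e s | FacePt c z \<Rightarrow> uf c z)"
    for q :: "('v, 'e, 'f) point"
  have \<Xi>_edge: "\<Xi> (edge_map Y0 e s) = ue e s" if "e \<in> edges Y" for e s
    using st[OF that] by (auto simp: \<Xi>_def edge_map_def sel)
  have \<Xi>_face: "\<Xi> (face_map Y0 c z) = uf c z" if c: "c \<in> faces Y" and z: "cmod z \<le> 1" for c z
  proof (cases "cmod z < 1")
    case True
    then show ?thesis by (simp add: face_map_interior \<Xi>_def)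
  next
    case False
    then have "cmod z = 1" using z by simp
    then obtain i t where it: "i < length (bdry Y0 c)" "0 \<le> t" "t < 1" "z = circ_pt (length (bdry Y0 c)) (real i + t)"
      using circ_pt_surj[OF bdry_pos[OF Y0]] c sel(3) by metis
    have c0: "c \<in> faces Y0" using c by (simp add: sel)
    have "face_map Y0 c z = letter_map Y0 (bdry Y0 c ! i) t"
      using face_map_arc[OF closed_bdry[OF Y0 c0] it(1), of t] it by simp
    then show ?thesis
      using le(3)[OF c, of i t] le(1)[OF c, of i] it by (simp add: letter_map_def sel \<Xi>_edge)
  qed
  have cont\<Xi>: "continuous_map (space_of Y0) (space_of Y) \<Xi>"
  proof (rule continuous_map_space_of[OF Y0])
    show "\<Xi> (Vert v) \<in> topspace (space_of Y)" if "v \<in> verts Y0" for v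
      using that by (auto simp: \<Xi>_def sel topspace_space_of[OF Y] intro: points_intros)
    show "continuous_map unit_interval (space_of Y) (\<lambda>t. \<Xi> (edge_map Y0 e t))" if "e \<in> edges Y0" for e
      using that ue(2)[of e] by (simp add: \<Xi>_edge sel eta_contract_eq)
    show "continuous_map unit_disc (space_of Y) (\<lambda>z. \<Xi> (face_map Y0 c z))" if "c \<in> faces Y0" for c
      by (rule continuous_map_eq[OF uf(2)]) (use that in \<open>auto simp: \<Xi>_face sel\<close>)
  qed
  \<comment> \<open>\<open>\<Xi>\<close> preserves each open cell, and on open edges and faces
    \<open>f\<close> recovers the parameter, because the lifts lie over characteristic maps of
    \<open>X\<close>.\<close>
  have inj\<Xi>: "inj_on \<Xi> (points Y0)"
  proof (rule inj_onI)
    fix p q assume p: "p \<in> points Y0" and q: "q \<in> points Y0" and eq: "\<Xi> p = \<Xi> q"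
    have tE: "\<exists>s'. \<Xi> (EdgePt e s) = EdgePt e s'" if "e \<in> edges Y" "0 < s" "s < 1" for e s
      using ue_mid[OF that] by (simp add: \<Xi>_def)
    have tF: "\<exists>s'. \<Xi> (FacePt c s) = FacePt c s'" if "c \<in> faces Y" "cmod s < 1" for c s
      using uf_mid[OF that] by (simp add: \<Xi>_def)
    have tV: "\<Xi> (Vert v) = Vert v" for v by (simp add: \<Xi>_def)
    show "p = q"
      using p
    proof (cases rule: points_cases)
      case pv: (Vert v)
      show ?thesis using q
      proof (cases rule: points_cases)
        case (Vert w)
        then show ?thesis using pv eq tV by simp
      next
        case (EdgePt e s)
        then show ?thesis using pv eq tV tE[of e s] by (auto simp: sel)
      next
        case (FacePt c s)
        then show ?thesis using pv eq tV tF[of c s] by (auto simp: sel)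
      qed
    next
      case pe: (EdgePt e s)
      show ?thesis using q
      proof (cases rule: points_cases)
        case (Vert w)
        then show ?thesis using pe eq tV tE[of e s] by (auto simp: sel)
      next
        case qe: (EdgePt e' s')
        then obtain r r' where "\<Xi> p = EdgePt e r" "\<Xi> q = EdgePt e' r'"
          using pe tE[of e s] tE[of e' s'] by (auto simp only: sel)
        then have "e = e'" using eq by simp
        have u: "ue e s = ue e' s'"
          using eq unfolding pe(4) qe(4) \<Xi>_def by simp
        have "f (ue e s) = EdgePt (lab e) s" "f (ue e' s') = EdgePt (lab e') s'"
          using ue(4)[of e s] ue(4)[of e' s'] pe(1-3) qe(1-3) by (auto simp: sel edge_map_def)
        then have "s = s'" unfolding u by simp
        then show ?thesis unfolding pe(4) qe(4) using \<open>e = e'\<close> by simp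
      next
        case (FacePt c s')
        then show ?thesis using pe eq tE[of e s] tF[of c s'] by (auto simp: sel)
      qed
    next
      case pf: (FacePt c s)
      show ?thesis using q
      proof (cases rule: points_cases)
        case (Vert w)
        then show ?thesis using pf eq tV tF[of c s] by (auto simp: sel)
      next
        case (EdgePt e' s')
        then show ?thesis using pf eq tF[of c s] tE[of e' s'] by (auto simp: sel)
      next
        case qf: (FacePt c' s')
        then obtain r r' where "\<Xi> p = FacePt c r" "\<Xi> q = FacePt c' r'"
          using pf tF[of c s] tF[of c' s'] by (auto simp only: sel)
        then have "c = c'" using eq by simp
        have u: "uf c s = uf c' s'"
          using eq unfolding pf(3) qf(3) \<Xi>_def by simp
        have "f (uf c s) = FacePt (flab c) s" "f (uf c' s') = FacePt (flab c') s'"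
          using uf(4)[of c s] uf(4)[of c' s'] pf(1-2) qf(1-2) by (auto simp: sel face_map_interior)
        then have "s = s'" unfolding u by simp
        then show ?thesis unfolding pf(3) qf(3) using \<open>c = c'\<close> by simp
      qed
    qed
  qed
  have surj\<Xi>: "\<Xi> ` points Y0 = points Y"
  proof
    show "\<Xi> ` points Y0 \<subseteq> points Y"
      using continuous_map_image_subset_topspace[OF cont\<Xi>] by (simp add: topspace_space_of[OF Y] topspace_space_of[OF Y0])
    show "points Y \<subseteq> \<Xi> ` points Y0"
    proof
      fix p assume "p \<in> points Y"
      then show "p \<in> \<Xi> ` points Y0"
      proof (cases rule: points_cases)
        case (Vert v)
        then show ?thesis
          by (intro image_eqI[of _ _ "Vert v"]) (auto simp: \<Xi>_def sel intro: points_intros)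
      next
        case (EdgePt e t)
        then have "p \<in> ue e ` {0<..<1}" using ue(3)[of e] by auto
        then obtain s where "s \<in> {0<..<1}" "p = ue e s" by blast
        then show ?thesis using EdgePt(1)
          by (intro image_eqI[of _ _ "EdgePt e s"]) (auto simp: \<Xi>_def sel intro: points_intros)
      next
        case (FacePt c z)
        then have "p \<in> uf c ` ball 0 1" using uf(3)[of c] by auto
        then obtain s where "s \<in> ball 0 1" "p = uf c s" by blast
        then show ?thesis using FacePt(1)
          by (intro image_eqI[of _ _ "FacePt c s"]) (auto simp: \<Xi>_def sel intro: points_intros)
      qed
    qed
  qed
  have "homeomorphic_map (space_of Y0) (space_of Y) \<Xi>"
  proof (rule continuous_imp_homeomorphic_map)
    show "compact_space (space_of Y0)"
      using fin by (intro compact_space_finite_complex[OF Y0]) (simp_all add: sel)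
  qed (use HY cont\<Xi> inj\<Xi> surj\<Xi> in \<open>simp_all add: topspace_space_of[OF Y] topspace_space_of[OF Y0]\<close>)
  then have hs: "space_of Y0 homeomorphic_space space_of Y"
    by (rule homeomorphic_map_imp_homeomorphic_space)

  \<comment> \<open>Foldedness of the straightened complex\<close>
  have ue_eq: "e = e'" if e: "e \<in> edges Y" "e' \<in> edges Y" "lab e = lab e'" and t: "t \<in> {0..1}" "ue e t = ue e' t" for e e' t
  proof -
    \<comment> \<open>One common point makes two lifts over the same edge equal; the midpoint then
      identifies the edge.\<close>
    have "ue e (1/2) = ue e' (1/2)"
      by (rule unique_lift[OF conn_I HY ue(2)[OF e(1)] ue(2)[OF e(2)] _ locinj, of t])
         (use e t ue(4) in auto)
    then show ?thesis
      using ue_mid[OF e(1), of "1/2"] ue_mid[OF e(2), of "1/2"] by auto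
  qed
  show ?thesis
  proof (rule that[OF Y0 sel(1,2,3) hs ue(1) uf(1)])
    show "label_word lab (bdry Y0 c) = bdry X (flab c)" if c: "c \<in> faces Y" for c
      using le(2)[OF c] by (intro nth_equalityI) (auto simp: sel label_word_nth prod_eq_iff)
    show "e = e'" if "e \<in> edges Y" "e' \<in> edges Y" "lab e = lab e'" "src Y0 e = src Y0 e'" for e e'
      by (rule ue_eq[OF that(1-3), of 0]) (use that st in \<open>auto simp: sel\<close>)
    show "e = e'" if "e \<in> edges Y" "e' \<in> edges Y" "lab e = lab e'" "tgt Y0 e = tgt Y0 e'" for e e'
      by (rule ue_eq[OF that(1-3), of 1]) (use that st in \<open>auto simp: sel\<close>)
    show "c = c'" if c: "c \<in> faces Y" "c' \<in> faces Y" "flab c = flab c'"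
      and i: "i < length (bdry Y0 c)" "bdry Y0 c ! i = bdry Y0 c' ! i" for c c' i
    proof -
      \<comment> \<open>Sharing letter \<open>i\<close> makes the two lifts agree at the midpoint of
        that arc, hence everywhere; the centre 0 identifies the 2-cell.\<close>
      let ?z = "circ_pt (length (bdry X (flab c))) (real i + 1/2)"
      have "le c i = le c' i" using i c by (simp add: sel)
      then have "uf c ?z = uf c' ?z"
        using le(3)[OF c(1), of i "1/2"] le(3)[OF c(2), of i "1/2"] i c by (simp add: sel)
      have "uf c 0 = uf c' 0"
      proof (rule unique_lift[OF conn_D HY uf(2)[OF c(1)] uf(2)[OF c(2)] _ locinj _ \<open>uf c ?z = uf c' ?z\<close>])
        show "f (uf c z) = f (uf c' z)" if "z \<in> topspace unit_disc" for z
          using uf(4)[OF c(1), of z] uf(4)[OF c(2), of z] c(3) that by simp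
      qed simp_all
      then show ?thesis
        using uf_mid[OF c(1), of 0] uf_mid[OF c(2), of 0] by auto
    qed
  qed
qed

text \<open>The indicator of \<open>W\<close> extends to a function that is constant on every closed
  cell, hence continuous, and takes only the values 0 and 1.\<close>

lemma edge_connected_space_of:
  assumes Y: "is_two_complex Y" and conn: "connected_space (space_of Y)"
  shows "edge_connected Y"
  unfolding edge_connected_def
proof (intro allI impI)
  fix W assume W: "W \<subseteq> verts Y" "W \<noteq> {}" "\<forall>e\<in>edges Y. src Y e \<in> W \<longleftrightarrow> tgt Y e \<in> W"
  define b where "b v = (if v \<in> W then 1 else 0 :: real)" for v
  define F where "F p = (case p of Vert v \<Rightarrow> b v | EdgePt e t \<Rightarrow> b (src Y e)
    | FacePt c z \<Rightarrow> b (src Y (fst (hd (bdry Y c)))))" for p :: "('a, 'b, 'c) point"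
  have F_edge: "F (edge_map Y e t) = b (src Y e)" if "e \<in> edges Y" for e t
    using W(3) that by (auto simp: F_def edge_map_def b_def)
  have F_face: "F (face_map Y c z) = b (src Y (fst (hd (bdry Y c))))" if c: "c \<in> faces Y" "cmod z \<le> 1" for c z
  proof (cases "cmod z < 1")
    case True
    then show ?thesis by (simp add: face_map_interior F_def)
  next
    case False
    let ?w = "bdry Y c"
    have m: "length ?w > 0" using bdry_pos[OF Y c(1)] .
    have cl: "closed_edge_path Y ?w" using closed_bdry[OF Y c(1)] .
    have ls: "b (letter_start Y l) = b (src Y (fst l)) \<and> b (letter_end Y l) = b (src Y (fst l))" if "fst l \<in> edges Y" for l
      using W(3) that by (auto simp: letter_start_def letter_end_def b_def)
    \<comment> \<open>Consecutive letters share a vertex, so a boundary word cannot pass between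
      \<open>W\<close> and its complement.\<close>
    have const: "b (src Y (fst (?w ! i))) = b (src Y (fst (?w ! 0)))" if "i < length ?w" for i
      using that
    proof (induction i)
      case (Suc i)
      have "letter_end Y (?w ! i) = letter_start Y (?w ! Suc i)"
        using cl Suc.prems unfolding closed_edge_path_def by (metis Suc_lessD mod_less)
      then show ?case
        using ls[OF bdry_edges[OF Y c(1)], of i] ls[OF bdry_edges[OF Y c(1)], of "Suc i"] Suc by simp
    qed simp
    have "cmod z = 1" using False c by simp
    then obtain i t where it: "i < length ?w" "0 \<le> t" "t < 1" "z = circ_pt (length ?w) (real i + t)"
      using circ_pt_surj[OF m] by metis
    have "face_map Y c z = letter_map Y (?w ! i) t"
      using face_map_arc[OF cl it(1), of t] it by simp
    then have "F (face_map Y c z) = b (src Y (fst (?w ! i)))"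
      using F_edge[OF bdry_edges[OF Y c(1) it(1)]] by (simp add: letter_map_def)
    then show ?thesis
      using const[OF it(1)] m by (simp add: hd_conv_nth)
  qed
  have "continuous_map (space_of Y) euclideanreal F"
  proof (rule continuous_map_space_of[OF Y])
    show "continuous_map unit_interval euclideanreal (\<lambda>t. F (edge_map Y e t))" if "e \<in> edges Y" for e
      by (simp add: F_edge[OF that])
    show "continuous_map unit_disc euclideanreal (\<lambda>z. F (face_map Y c z))" if c: "c \<in> faces Y" for c
      by (rule continuous_map_eq[of _ _ "\<lambda>_. b (src Y (fst (hd (bdry Y c))))"]) (auto simp: F_face[OF c])
  qed auto
  then have op: "openin (space_of Y) {p \<in> topspace (space_of Y). F p \<in> {1/2<..}}"
    "openin (space_of Y) {p \<in> topspace (space_of Y). F p \<in> {..<1/2}}"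
    by (rule openin_continuous_map_preimage; simp)+
  have F01: "F p = 0 \<or> F p = 1" for p
    by (auto simp: F_def b_def split: point.splits)
  have cover: "topspace (space_of Y) \<subseteq> {p \<in> topspace (space_of Y). F p \<in> {1/2<..}} \<union> {p \<in> topspace (space_of Y). F p \<in> {..<1/2}}"
  proof
    fix p assume "p \<in> topspace (space_of Y)"
    then show "p \<in> {p \<in> topspace (space_of Y). F p \<in> {1/2<..}} \<union> {p \<in> topspace (space_of Y). F p \<in> {..<1/2}}"
      using F01[of p] by auto
  qed
  have disj: "{p \<in> topspace (space_of Y). F p \<in> {1/2<..}} \<inter> {p \<in> topspace (space_of Y). F p \<in> {..<1/2}} = {}"
    by auto
  obtain w where w: "w \<in> W" using W(2) by blast
  have FV: "F (Vert v) = b v" for v by (simp add: F_def)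
  have "Vert w \<in> {p \<in> topspace (space_of Y). F p \<in> {1/2<..}}"
    using w W(1) by (auto simp: topspace_space_of[OF Y] FV b_def intro: points_intros)
  then have no: "{p \<in> topspace (space_of Y). F p \<in> {..<1/2}} = {}"
    using connected_spaceD[OF conn op cover disj] by blast
  have "v \<in> W" if "v \<in> verts Y" for v
  proof (rule ccontr)
    assume "v \<notin> W"
    then have "Vert v \<in> {p \<in> topspace (space_of Y). F p \<in> {..<1/2}}"
      using that by (auto simp: topspace_space_of[OF Y] FV b_def intro: points_intros)
    then show False using no by blast
  qed
  then show "W = verts Y" using W(1) by blast
qed

theorem theorem1p1:
  shows "contracting_nonpositive_immersions TYPE('v \<times> 'e \<times> 'f) (presentation_complex pres_P)"
  unfolding contracting_nonpositive_immersions_def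
proof (intro allI impI, elim conjE)
  fix Y :: "('v, 'e, 'f) two_complex" and f
  let ?X = "presentation_complex pres_P"
  assume Y: "is_two_complex Y" and conn: "connected_space (space_of Y)"
    and comp: "compact_space (space_of Y)" and imm: "immersion Y ?X f"
  obtain Y0 :: "('v, 'e, 'f) two_complex" and lab flab where
    Y0: "is_two_complex Y0" "verts Y0 = verts Y" "edges Y0 = edges Y" "faces Y0 = faces Y"
    "space_of Y0 homeomorphic_space space_of Y"
    "\<And>c. c \<in> faces Y \<Longrightarrow> flab c \<in> faces ?X"
    "\<And>c. c \<in> faces Y \<Longrightarrow> label_word lab (bdry Y0 c) = bdry ?X (flab c)"
    "\<And>e e'. e \<in> edges Y \<Longrightarrow> e' \<in> edges Y \<Longrightarrow> lab e = lab e' \<Longrightarrow> src Y0 e = src Y0 e' \<Longrightarrow> e = e'"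
    "\<And>e e'. e \<in> edges Y \<Longrightarrow> e' \<in> edges Y \<Longrightarrow> lab e = lab e' \<Longrightarrow> tgt Y0 e = tgt Y0 e' \<Longrightarrow> e = e'"
    "\<And>c c' i. c \<in> faces Y \<Longrightarrow> c' \<in> faces Y \<Longrightarrow> flab c = flab c' \<Longrightarrow> i < length (bdry Y0 c) \<Longrightarrow>
      bdry Y0 c ! i = bdry Y0 c' ! i \<Longrightarrow> c = c'"
    by (rule straighten_immersion[OF Y is_two_complex_presentation_complex_pres_P comp imm]) blast
  have "folded_complex Y0 lab flab"
  proof unfold_locales
    show "finite (verts Y0)" "finite (edges Y0)" "finite (faces Y0)"
      using finite_cells[OF Y comp] Y0 by simp_all
    show "flab c < length (relators pres_P)" if "c \<in> faces Y0" for c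
      using Y0(6)[of c] that Y0(4) by (simp add: presentation_complex_def)
    show "label_word lab (bdry Y0 c) = relators pres_P ! flab c" if "c \<in> faces Y0" for c
      using Y0(7)[of c] that Y0(4) by (simp add: presentation_complex_def)
    show "e = e'" if "e \<in> edges Y0" "e' \<in> edges Y0" "lab e = lab e'" "src Y0 e = src Y0 e'" for e e'
      using Y0(8)[of e e'] that Y0(3) by simp
    show "e = e'" if "e \<in> edges Y0" "e' \<in> edges Y0" "lab e = lab e'" "tgt Y0 e = tgt Y0 e'" for e e'
      using Y0(9)[of e e'] that Y0(3) by simp
    show "c = c'" if "c \<in> faces Y0" "c' \<in> faces Y0" "flab c = flab c'" "i < length (bdry Y0 c)"
        "bdry Y0 c ! i = bdry Y0 c' ! i" for c c' i
      using Y0(10)[of c c' i] that Y0(4) by simp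
  qed (rule Y0(1))
  moreover have "edge_connected Y0"
    using homeomorphic_connected_space[OF Y0(5)] conn by (intro edge_connected_space_of[OF Y0(1)]) simp
  ultimately have "euler_char Y0 \<le> 0 \<or> contractible_space (space_of Y0)"
    by (rule folded_complex_contracting)
  \<comment> \<open>The sets of cells are unchanged and the spaces are homeomorphic, so both
    alternatives transfer from \<open>Y0\<close> to \<open>Y\<close>.\<close>
  then show "euler_char Y \<le> 0 \<or> contractible_space (space_of Y)"
    using homeomorphic_space_contractibility[OF Y0(5)] Y0(2-4) by (simp add: euler_char_def)
qed

end
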